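(* Let $(\mathcal C,A)$ be a unirational differential curve, $A\in\mathcal F\{x,y\}$ irreducible, with a linear differential rational parametrization $\mathcal P(u)=\big(\frac{P_1(u)}{Q_1(u)},\frac{P_2(u)}{Q_2(u)}\big)$ such that $m_i=\mathrm{ord}\big(\frac{P_i}{Q_i}\big)\ge0$ for $i=1,2$. Suppose $\mathcal P(u)$ is proper. Then $A$ is the main irreducible factor of $$R=\delta\text{-}\mathrm{Res}_u\big(xQ_1(u)-P_1(u),\,yQ_2(u)-P_2(u)\big);$$ that is, $A$ is an irreducible factor of $R$ and if $R=AB$ with $B\in\mathcal F\{x,y\}$, then $\mathrm{ord}(B)<\mathrm{ord}(R)$. In particular, $\deg_{x^{(m_2)}}A=1$ and $\deg_{y^{(m_1)}}A=1$.
   Context: $\mathcal F$ is an ordinary differential field of characteristic $0$ with derivation $\delta$, and $\mathcal E$ is a fixed universal differential extension field of $\mathcal F$; $x,y$ are differential indeterminates over $\mathcal E$, and $u\in\mathcal E$ is differentially transcendental over $\mathcal F$. $\mathcal F\{S\}$ and $\mathcal F\langle S\rangle$ denote the differential ring and differential field generated by $S$ over $\mathcal F$; $w^{(k)}=\delta^k(w)$. Orders: for a differential polynomial $f$ and an indeterminate $w$, $\mathrm{ord}_w f$ is the largest $k$ such that $w^{(k)}$ effectively appears in $f$, and $-\infty$ if no derivative of $w$ (including $w$) appears. For $f\in\mathcal F\{x,y\}$, $\mathrm{ord}(f)=\max\{\mathrm{ord}_xf,\mathrm{ord}_yf\}$. For $R(u)=P/Q\in\mathcal F\langle u\rangle$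 in reduced form ($\gcd(P,Q)=1$), $\mathrm{ord}(R)=\max\{\mathrm{ord}_uP,\mathrm{ord}_uQ\}$. Differential curves: for an irreducible $A\in\mathcal F\{x,y\}\setminus\mathcal F$, $\mathrm{sat}(A)=[A]:S_A^\infty=\{f:\exists m,\ S_A^mf\in[A]\}$, where $[A]$ is the differential ideal generated by $A$ and $S_A$ is the separant of $A$ (the partial derivative of $A$ with respect to its leader) under some ranking; it is a prime differential ideal independent of the ranking. $(\mathcal C,A)$ denotes the irreducible (plane) differential curve $\mathcal C=\mathbb V(\mathrm{sat}(A))\subset\mathbb A^2(\mathcal E)$. $\mathcal C$ is unirational if it has a generic point $\mathcal P(u)=\big(\frac{P_1(u)}{Q_1(u)},\frac{P_2(u)}{Q_2(u)}\big)\in\mathcal F\langle u\rangle^2$, i.e. the set $\mathbb I(\mathcal P(u))$ of differential polynomials in $\mathcal F\{x,y\}$ vanishing at $\mathcal P(u)$ equals $\mathrm{sat}(A)$; such $\mathcal P(u)$ (with $P_i,Q_i\in\mathcal F\{u\}$, $\gcd(P_i,Q_i)=1$) is called a differential rational parametrization of $\mathcal C$. It is linear if all of $P_1,Q_1,P_2,Q_2$ have degree at most $1$. It is proper if $\mathcal F\langle \frac{P_1(u)}{Q_1(u)},\frac{P_2(u)}{Q_2(u)}\rangle=\mathcal F\langle u\rangle$. Differential resultant: let $f_1,f_2\in\mathbb D\{u\}$ be linear differential polynomials (degree $1$ in $u$ and its derivatives, possibly with a constant term) of orders $m_1,m_2$ in $u$ over a differential domain $\mathbb D$ (here $\mathbb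 D=\mathcal F\{x,y\}$). Let $M$ be the $(m_1+m_2+2)\times(m_1+m_2+2)$ matrix whose $k$-th row is the coefficient vector of the $k$-th element of the list $f_1^{(m_2)},f_1^{(m_2-1)},\dots,f_1,f_2^{(m_1)},f_2^{(m_1-1)},\dots,f_2$ with respect to $u^{(m_1+m_2)}>u^{(m_1+m_2-1)}>\cdots>u>1$. Then $\delta\text{-}\mathrm{Res}_u(f_1,f_2):=\det(M)$. *)

theory Defs
  imports
    "HOL-Library.Poly_Mapping"
    "HOL-Library.Extended"
    "HOL-Algebra.Subrings"
    "Jordan_Normal_Form.VS_Connect"
begin

section \<open>Differential fields\<close>

text \<open>
  A field given as a type is viewed as a ring structure through \<^term>\<open>class_ring\<close>, so that the
  same notions apply to types, to subfields of a type, and to fields with a proper carrier.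
\<close>

definition derivation_on :: "('a, 'm) ring_scheme \<Rightarrow> ('a \<Rightarrow> 'a) \<Rightarrow> bool" where
  "derivation_on R d \<longleftrightarrow>
     d \<in> carrier R \<rightarrow> carrier R \<and>
     (\<forall>a\<in>carrier R. \<forall>b\<in>carrier R.
        d (a \<oplus>\<^bsub>R\<^esub> b) = d a \<oplus>\<^bsub>R\<^esub> d b \<and>
        d (a \<otimes>\<^bsub>R\<^esub> b) = (d a \<otimes>\<^bsub>R\<^esub> b) \<oplus>\<^bsub>R\<^esub> (a \<otimes>\<^bsub>R\<^esub> d b))"

abbreviation derivation :: "('a::comm_ring_1 \<Rightarrow> 'a) \<Rightarrow> bool" where
  "derivation d \<equiv> derivation_on class_ring d"

definition diff_hom ::
  "('a, 'm) ring_scheme \<Rightarrow> ('a \<Rightarrow> 'a) \<Rightarrow> ('b, 'n) ring_scheme \<Rightarrow> ('b \<Rightarrow> 'b) \<Rightarrow> ('a \<Rightarrow> 'b) \<Rightarrow> bool"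
where
  "diff_hom R dR S dS h \<longleftrightarrow> h \<in> Ring.ring_hom R S \<and> (\<forall>a\<in>carrier R. h (dR a) = dS (h a))"

definition diff_subfield :: "('a, 'm) ring_scheme \<Rightarrow> ('a \<Rightarrow> 'a) \<Rightarrow> 'a set \<Rightarrow> bool" where
  "diff_subfield R d K \<longleftrightarrow> subfield K R \<and> d ` K \<subseteq> K"

text \<open>
  The base field is a type \<^typ>\<open>'f\<close> and the extension is a type \<^typ>\<open>'e\<close> together with a
  differential (hence injective) homomorphism \<open>\<iota>\<close> from \<^typ>\<open>'f\<close> to \<^typ>\<open>'e\<close>.
  \<open>adjoin D \<iota> S\<close> is the differential field generated by \<open>S\<close> over the image of \<open>\<iota>\<close>.
\<close>

definition adjoin :: "('e \<Rightarrow> 'e) \<Rightarrow> ('f \<Rightarrow> 'e) \<Rightarrow> 'e set \<Rightarrow> 'e::field set" where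
  "adjoin D \<iota> S = diff_subfield class_ring D hull (range \<iota> \<union> S)"

text \<open>
  Universality in the sense of Kolchin: every finitely generated differential extension field
  \<open>G\<close> (not necessarily inside \<^typ>\<open>'e\<close>) of every differential field \<open>K\<close> inside \<^typ>\<open>'e\<close>
  that is finitely generated over the base field embeds over \<open>K\<close> into \<^typ>\<open>'e\<close>. The
  embedding of \<open>K\<close> into \<open>G\<close> is \<open>j\<close>. It is no restriction that the carrier of \<open>G\<close> is a
  subset of \<^typ>\<open>'e\<close> with field operations of its own: in characteristic 0 the field \<open>K\<close> is
  infinite, so \<open>G\<close> has the same cardinality as \<open>K\<close> and can be transported.
\<close>

definition universal_extension :: "('e \<Rightarrow> 'e) \<Rightarrow> ('f \<Rightarrow> 'e::field_char_0) \<Rightarrow> bool" where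
  "universal_extension D \<iota> \<longleftrightarrow>
     (\<forall>S. finite S \<longrightarrow>
       (let K = adjoin D \<iota> S; KR = class_ring\<lparr>carrier := K\<rparr> in
        \<forall>(G :: 'e ring) dG j.
          field G \<and> derivation_on G dG \<and> diff_hom KR D G dG j \<and>
          (\<exists>T. finite T \<and> T \<subseteq> carrier G \<and>
             carrier G = diff_subfield G dG hull (j ` K \<union> T)) \<longrightarrow>
          (\<exists>h. diff_hom G dG class_ring D h \<and> (\<forall>a\<in>K. h (j a) = a))))"


section \<open>Differential polynomials\<close>

text \<open>
  The pair \<open>(w, k)\<close> stands for the \<open>k\<close>-th derivative of the differential indeterminate \<open>w\<close>.
\<close>

type_synonym ('w, 'a) dpoly = "('w \<times> nat \<Rightarrow>\<^sub>0 nat) \<Rightarrow>\<^sub>0 'a"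

definition dp_const :: "'a::zero \<Rightarrow> ('w, 'a) dpoly" where
  "dp_const c = Poly_Mapping.single 0 c"

definition dp_var :: "'w \<Rightarrow> nat \<Rightarrow> ('w, 'a::zero_neq_one) dpoly" where
  "dp_var w k = Poly_Mapping.single (Poly_Mapping.single (w, k) 1) 1"

definition dp_vars :: "('w, 'a::zero) dpoly \<Rightarrow> ('w \<times> nat) set" where
  "dp_vars f = (\<Union>m\<in>Poly_Mapping.keys f. Poly_Mapping.keys m)"

definition dp_pdiff :: "'w \<times> nat \<Rightarrow> ('w, 'a::comm_ring_1) dpoly \<Rightarrow> ('w, 'a) dpoly" where
  "dp_pdiff v f =
     (\<Sum>m\<in>Poly_Mapping.keys f. Poly_Mapping.single (m - Poly_Mapping.single v 1)
                     (of_nat (Poly_Mapping.lookup m v) * Poly_Mapping.lookup f m))"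

text \<open>
  The derivation extending a derivation \<open>d\<close> of the coefficients: \<open>d\<close> applied to all
  coefficients, plus the chain rule for the derivatives of the indeterminates.
\<close>

definition dp_deriv :: "('a \<Rightarrow> 'a) \<Rightarrow> ('w, 'a::comm_ring_1) dpoly \<Rightarrow> ('w, 'a) dpoly" where
  "dp_deriv d f =
     Poly_Mapping.map d f + (\<Sum>(w, k)\<in>dp_vars f. dp_pdiff (w, k) f * dp_var w (Suc k))"

definition dp_eval ::
  "('f \<Rightarrow> 'e) \<Rightarrow> ('e \<Rightarrow> 'e) \<Rightarrow> ('w \<Rightarrow> 'e) \<Rightarrow> ('w, 'f::zero) dpoly \<Rightarrow> 'e::comm_ring_1" where
  "dp_eval \<iota> D a f =
     (\<Sum>m\<in>Poly_Mapping.keys f. \<iota> (Poly_Mapping.lookup f m) * (\<Prod>(w, k)\<in>Poly_Mapping.keys m. ((D ^^ k) (a w)) ^ Poly_Mapping.lookup m (w, k)))"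

definition dp_ord_in :: "'w \<Rightarrow> ('w, 'a::zero) dpoly \<Rightarrow> nat extended" where
  "dp_ord_in w f = (if \<exists>k. (w, k) \<in> dp_vars f then Fin (Max {k. (w, k) \<in> dp_vars f}) else -\<infinity>)"

definition dp_degree :: "('w, 'a::zero) dpoly \<Rightarrow> nat" where
  "dp_degree f = Max (insert 0 ((\<lambda>m. \<Sum>v\<in>Poly_Mapping.keys m. Poly_Mapping.lookup m v) ` Poly_Mapping.keys f))"

definition dp_degree_in :: "'w \<times> nat \<Rightarrow> ('w, 'a::zero) dpoly \<Rightarrow> nat" where
  "dp_degree_in v f = Max (insert 0 ((\<lambda>m. Poly_Mapping.lookup m v) ` Poly_Mapping.keys f))"

text \<open>
  \<open>gcd(f, g) = 1\<close>; the class of \<^const>\<open>coprime\<close> requires a division operation, which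
  \<^type>\<open>poly_mapping\<close> does not have.
\<close>

definition dp_coprime :: "('w, 'a::comm_ring_1) dpoly \<Rightarrow> ('w, 'a) dpoly \<Rightarrow> bool" where
  "dp_coprime f g \<longleftrightarrow> (\<forall>h. h dvd f \<longrightarrow> h dvd g \<longrightarrow> h dvd 1)"

definition diff_transcendental ::
  "('f::zero \<Rightarrow> 'e) \<Rightarrow> ('e \<Rightarrow> 'e) \<Rightarrow> 'e::comm_ring_1 \<Rightarrow> bool" where
  "diff_transcendental \<iota> D u \<longleftrightarrow>
     (\<forall>f :: (unit, 'f) dpoly. f \<noteq> 0 \<longrightarrow> dp_eval \<iota> D (\<lambda>_. u) f \<noteq> 0)"


section \<open>Saturation ideals\<close>

definition diff_ideal :: "('a \<Rightarrow> 'a) \<Rightarrow> ('w, 'a::comm_ring_1) dpoly set \<Rightarrow> bool" where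
  "diff_ideal d I \<longleftrightarrow>
     0 \<in> I \<and> (\<forall>f\<in>I. \<forall>g\<in>I. f + g \<in> I) \<and> (\<forall>f\<in>I. \<forall>g. g * f \<in> I) \<and> (\<forall>f\<in>I. dp_deriv d f \<in> I)"

definition ranking :: "('w \<times> nat) rel \<Rightarrow> bool" where
  "ranking r \<longleftrightarrow>
     strict_linear_order r \<and>
     (\<forall>w k. ((w, k), (w, Suc k)) \<in> r) \<and>
     (\<forall>w k w' k'. ((w, k), (w', k')) \<in> r \<longrightarrow> ((w, Suc k), (w', Suc k')) \<in> r)"

definition leader :: "('w \<times> nat) rel \<Rightarrow> ('w, 'a::zero) dpoly \<Rightarrow> 'w \<times> nat" where
  "leader r f = (THE v. v \<in> dp_vars f \<and> (\<forall>v'\<in>dp_vars f. v' \<noteq> v \<longrightarrow> (v', v) \<in> r))"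

definition separant :: "('w \<times> nat) rel \<Rightarrow> ('w, 'a::comm_ring_1) dpoly \<Rightarrow> ('w, 'a) dpoly" where
  "separant r f = dp_pdiff (leader r f) f"

definition sat ::
  "('a \<Rightarrow> 'a) \<Rightarrow> ('w \<times> nat) rel \<Rightarrow> ('w, 'a::comm_ring_1) dpoly \<Rightarrow> ('w, 'a) dpoly set" where
  "sat d r A = {f. \<exists>m. separant r A ^ m * f \<in> diff_ideal d hull {A}}"

definition vanishing_ideal ::
  "('f::zero \<Rightarrow> 'e::comm_ring_1) \<Rightarrow> ('e \<Rightarrow> 'e) \<Rightarrow> ('w \<Rightarrow> 'e) \<Rightarrow> ('w, 'f) dpoly set" where
  "vanishing_ideal \<iota> D a = {f. dp_eval \<iota> D a f = 0}"


section \<open>Plane differential curves and their parametrizations\<close>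

datatype xy = Xvar | Yvar

definition dp_ord :: "(xy, 'a::zero) dpoly \<Rightarrow> nat extended" where
  "dp_ord f = max (dp_ord_in Xvar f) (dp_ord_in Yvar f)"

text \<open>
  Differential polynomials in the single indeterminate \<open>u\<close> have type \<open>(unit, 'f) dpoly\<close>.
  The order of a fraction \<open>P/Q\<close> is meant for \<open>P\<close>, \<open>Q\<close> coprime.
\<close>

definition fraction_ord :: "(unit, 'a::zero) dpoly \<Rightarrow> (unit, 'a) dpoly \<Rightarrow> nat extended" where
  "fraction_ord P Q = max (dp_ord_in () P) (dp_ord_in () Q)"

definition fraction_at ::
  "('f::zero \<Rightarrow> 'e) \<Rightarrow> ('e \<Rightarrow> 'e) \<Rightarrow> 'e::field \<Rightarrow> (unit, 'f) dpoly \<Rightarrow> (unit, 'f) dpoly \<Rightarrow> 'e" where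
  "fraction_at \<iota> D u P Q = dp_eval \<iota> D (\<lambda>_. u) P / dp_eval \<iota> D (\<lambda>_. u) Q"

definition rational_parametrization ::
  "('f \<Rightarrow> 'f) \<Rightarrow> ('f::comm_ring_1 \<Rightarrow> 'e) \<Rightarrow> ('e \<Rightarrow> 'e) \<Rightarrow> (xy \<times> nat) rel \<Rightarrow> (xy, 'f) dpoly \<Rightarrow> 'e::field \<Rightarrow>
   (unit, 'f) dpoly \<Rightarrow> (unit, 'f) dpoly \<Rightarrow> (unit, 'f) dpoly \<Rightarrow> (unit, 'f) dpoly \<Rightarrow> bool" where
  "rational_parametrization d \<iota> D r A u P\<^sub>1 Q\<^sub>1 P\<^sub>2 Q\<^sub>2 \<longleftrightarrow>
     Q\<^sub>1 \<noteq> 0 \<and> Q\<^sub>2 \<noteq> 0 \<and> dp_coprime P\<^sub>1 Q\<^sub>1 \<and> dp_coprime P\<^sub>2 Q\<^sub>2 \<and>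
     vanishing_ideal \<iota> D (case_xy (fraction_at \<iota> D u P\<^sub>1 Q\<^sub>1) (fraction_at \<iota> D u P\<^sub>2 Q\<^sub>2)) = sat d r A"

definition proper_parametrization ::
  "('f::comm_ring_1 \<Rightarrow> 'e) \<Rightarrow> ('e \<Rightarrow> 'e) \<Rightarrow> 'e::field \<Rightarrow>
   (unit, 'f) dpoly \<Rightarrow> (unit, 'f) dpoly \<Rightarrow> (unit, 'f) dpoly \<Rightarrow> (unit, 'f) dpoly \<Rightarrow> bool" where
  "proper_parametrization \<iota> D u P\<^sub>1 Q\<^sub>1 P\<^sub>2 Q\<^sub>2 \<longleftrightarrow>
     adjoin D \<iota> {fraction_at \<iota> D u P\<^sub>1 Q\<^sub>1, fraction_at \<iota> D u P\<^sub>2 Q\<^sub>2} = adjoin D \<iota> {u}"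

definition linear_parametrization ::
  "(unit, 'f::zero) dpoly \<Rightarrow> (unit, 'f) dpoly \<Rightarrow> (unit, 'f) dpoly \<Rightarrow> (unit, 'f) dpoly \<Rightarrow> bool" where
  "linear_parametrization P\<^sub>1 Q\<^sub>1 P\<^sub>2 Q\<^sub>2 \<longleftrightarrow>
     dp_degree P\<^sub>1 \<le> 1 \<and> dp_degree Q\<^sub>1 \<le> 1 \<and> dp_degree P\<^sub>2 \<le> 1 \<and> dp_degree Q\<^sub>2 \<le> 1"


section \<open>The differential resultant of linear differential polynomials\<close>

text \<open>
  The coefficient vector of a linear differential polynomial with respect to
  \<open>u\<^sup>(\<^sup>n\<^sup>) > \<dots> > u' > u > 1\<close>.
\<close>

definition linear_coeffs :: "nat \<Rightarrow> (unit, 'a::zero) dpoly \<Rightarrow> 'a list" where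
  "linear_coeffs n f =
     map (\<lambda>k. Poly_Mapping.lookup f (Poly_Mapping.single ((), k) 1)) (rev [0..<Suc n]) @ [Poly_Mapping.lookup f 0]"

text \<open>
  \<open>d\<close> is the derivation of the coefficient domain. The value is meaningful only for
  linear \<open>f\<^sub>1\<close>, \<open>f\<^sub>2\<close> in which \<open>u\<close> or one of its derivatives appears.
\<close>

definition diff_resultant ::
  "('a \<Rightarrow> 'a) \<Rightarrow> (unit, 'a::comm_ring_1) dpoly \<Rightarrow> (unit, 'a) dpoly \<Rightarrow> 'a" where
  "diff_resultant d f\<^sub>1 f\<^sub>2 =
     (case (dp_ord_in () f\<^sub>1, dp_ord_in () f\<^sub>2) of
        (Fin m\<^sub>1, Fin m\<^sub>2) \<Rightarrow>
          det (mat_of_rows_list (m\<^sub>1 + m\<^sub>2 + 2)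
            (map (\<lambda>k. linear_coeffs (m\<^sub>1 + m\<^sub>2) ((dp_deriv d ^^ k) f\<^sub>1)) (rev [0..<Suc m\<^sub>2]) @
             map (\<lambda>k. linear_coeffs (m\<^sub>1 + m\<^sub>2) ((dp_deriv d ^^ k) f\<^sub>2)) (rev [0..<Suc m\<^sub>1])))
      | _ \<Rightarrow> 0)"

text \<open>
  The polynomial \<open>w Q(u) - P(u)\<close> as a differential polynomial in \<open>u\<close> whose coefficients are
  differential polynomials in \<open>x\<close>, \<open>y\<close>.
\<close>

definition implicit_poly ::
  "xy \<Rightarrow> (unit, 'a::comm_ring_1) dpoly \<Rightarrow> (unit, 'a) dpoly \<Rightarrow> (unit, (xy, 'a) dpoly) dpoly" where
  "implicit_poly w P Q =
     dp_const (dp_var w 0) * Poly_Mapping.map dp_const Q - Poly_Mapping.map dp_const P"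

end

theory Submission
  imports Defs "HOL-Library.Product_Lexorder"
begin

text \<open>
  Let \<open>a = P\<^sub>1(u)/Q\<^sub>1(u)\<close> and \<open>b = P\<^sub>2(u)/Q\<^sub>2(u)\<close> be the coordinates of the generic point. The argument
  compares differentials. The differentials of the elements of the field generated by \<open>u\<close> are the
  multiples of \<open>du\<close> by linear differential operators, and \<open>u\<close> satisfies no relation, so that \<open>da\<close> and
  \<open>db\<close> become operators of orders \<open>m\<^sub>1\<close> and \<open>m\<^sub>2\<close>. Properness says that \<open>du\<close> is a combination of \<open>da\<close> and
  \<open>db\<close>, that is, that the two operators generate the unit left ideal
  (\<open>generators_right_coprime\<close>). Such operators satisfy no relation \<open>C da + C' db = 0\<close> with \<open>C \<noteq> 0\<close> of
  order less than \<open>m\<^sub>2\<close> (\<open>right_coprime_relation_degree\<close>). This is used twice.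

  First, differentiating \<open>A(a, b) = 0\<close> gives a relation between \<open>da\<close> and \<open>db\<close> whose coefficients are
  the partial derivatives of \<open>A\<close> at the generic point. They do not all vanish: otherwise the separant
  would belong to the saturation ideal, and then 1 would. Hence \<open>A\<close> contains derivatives of \<open>x\<close> of
  order at least \<open>m\<^sub>2\<close> and derivatives of \<open>y\<close> of order at least \<open>m\<^sub>1\<close> (\<open>order_lower_bound\<close>).

  Second, the matrix of the resultant \<open>R\<close> is singular at the generic point, since the vector of the
  derivatives of \<open>u\<close>, followed by 1, lies in its kernel; so \<open>R\<close> belongs to the saturation ideal.
  It becomes regular when the value of the derivative of \<open>x\<close> of order \<open>m\<^sub>2\<close>, which occurs in the first
  row only, is increased by 1: a relation between the rows would again be a relation between \<open>da\<close> and
  \<open>db\<close> of too small an order. So \<open>R \<noteq> 0\<close> (\<open>resultant_neq_0\<close>).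

  Each of the two derivatives of highest order occurs in a single row of the matrix, linearly; so
  \<open>R\<close> has order at most \<open>m\<^sub>2\<close> in \<open>x\<close>, order at most \<open>m\<^sub>1\<close> in \<open>y\<close>, and degree at most 1 in
  both highest derivatives (\<open>resultant_degree\<close>). By the lower bounds, no proper derivative of the
  leader of \<open>A\<close> occurs in \<open>R\<close>. A member of the saturation ideal with this property becomes a multiple
  of \<open>A\<close> after multiplication by a power of the separant, and since irreducible polynomials are prime
  (\<open>dp_irreducible_dvd_mult\<close>), it is a multiple of \<open>A\<close> itself
  (\<open>irreducible_dvd_partially_reduced\<close>). Thus \<open>A\<close> divides \<open>R\<close>; it then contains both highest
  derivatives with degree 1, and a cofactor contains neither of them.
\<close>

section \<open>Polynomials in the derivatives of the indeterminates\<close>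

text \<open>
  A linear order of the variables orders the monomials, and leading monomials show that the
  polynomial rings have no zero divisors.
\<close>

instantiation xy :: linorder begin
definition less_eq_xy :: "xy \<Rightarrow> xy \<Rightarrow> bool" where "less_eq_xy a b \<longleftrightarrow> a = Xvar \<or> b = Yvar"
definition less_xy :: "xy \<Rightarrow> xy \<Rightarrow> bool" where "less_xy a b \<longleftrightarrow> a = Xvar \<and> b = Yvar"
instance
proof
  fix x y z :: xy
  show "x \<le> x" by (cases x) (auto simp: less_eq_xy_def)
  show "x \<le> y \<or> y \<le> x" by (cases x; cases y) (auto simp: less_eq_xy_def)
  show "x < y \<longleftrightarrow> x \<le> y \<and> \<not> y \<le> x" by (cases x; cases y) (auto simp: less_eq_xy_def less_xy_def)
  show "x \<le> y \<Longrightarrow> y \<le> z \<Longrightarrow> x \<le> z" by (cases x; cases y; cases z) (auto simp: less_eq_xy_def)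
  show "x \<le> y \<Longrightarrow> y \<le> x \<Longrightarrow> x = y" by (cases x; cases y) (auto simp: less_eq_xy_def)
qed
end

abbreviation "lookup \<equiv> Poly_Mapping.lookup"
abbreviation "keys \<equiv> Poly_Mapping.keys"
abbreviation "single \<equiv> Poly_Mapping.single"
abbreviation smult :: "'a::comm_semiring_0 \<Rightarrow> 'a poly \<Rightarrow> 'a poly" where
  "smult \<equiv> Polynomial.smult"

definition pvar :: "'w \<times> nat \<Rightarrow> ('w, 'a::zero_neq_one) dpoly" where
  "pvar v = single (single v 1) 1"

lemma dp_var_pvar: "dp_var w k = pvar (w, k)" by (simp add: dp_var_def pvar_def)

lemma dpoly_sum_monomials:
  "f = (\<Sum>m\<in>keys f. single m (lookup f m))"
  by (rule poly_mapping_eqI) (auto simp: lookup_sum lookup_single when_def in_keys_iff sum.delta)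

text \<open>
  Bilinear identities need to be checked on monomials only.
\<close>

lemma dpoly_monomial_induct [case_names monomial add]:
  fixes f :: "('w, 'a::comm_ring_1) dpoly"
  assumes "\<And>m c. P (single m c)" "\<And>f g. P f \<Longrightarrow> P g \<Longrightarrow> P (f + g)"
  shows "P f"
proof -
  have "P (\<Sum>m\<in>S. single m (lookup f m))" if "finite S" for S
    using that
  proof induction
    case empty
    then show ?case using assms(1)[of 0 0] by simp
  qed (auto intro: assms)
  from this[of "keys f"] show ?thesis using dpoly_sum_monomials[of f] by simp
qed

definition mon :: "('v \<Rightarrow> 'b::comm_monoid_mult) \<Rightarrow> ('v \<Rightarrow>\<^sub>0 nat) \<Rightarrow> 'b" where
  "mon x m = (\<Prod>v\<in>keys m. x v ^ lookup m v)"

lemma mon_superset: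
  assumes "finite S" "keys m \<subseteq> S"
  shows "mon x m = (\<Prod>v\<in>S. x v ^ lookup m v)"
  unfolding mon_def using assms by (intro prod.mono_neutral_left) (auto simp: in_keys_iff)

lemma mon_zero [simp]: "mon x 0 = 1" by (simp add: mon_def)

lemma mon_single [simp]: "mon x (single v k) = x v ^ k"
  by (simp add: mon_def)

lemma mon_add: "mon x (m + n) = mon x m * mon x n"
proof -
  let ?S = "keys m \<union> keys n"
  have "mon x (m + n) = (\<Prod>v\<in>?S. x v ^ lookup (m + n) v)"
    by (rule mon_superset) (use keys_add[of m n] in auto)
  also have "\<dots> = (\<Prod>v\<in>?S. x v ^ lookup m v) * (\<Prod>v\<in>?S. x v ^ lookup n v)"
    by (simp add: lookup_add power_add prod.distrib)
  finally show ?thesis by (simp add: mon_superset[of ?S])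
qed

lemma mon_cong: "(\<And>v. v \<in> keys m \<Longrightarrow> x v = y v) \<Longrightarrow> mon x m = mon y m"
  by (simp add: mon_def)

text \<open>
  Substitution of arbitrary values for the variables. In contrast to \<^const>\<open>dp_eval\<close>, the values of
  the derivatives of an indeterminate need not be the derivatives of its value; so this covers
  points that are perturbed in a single derivative, and substitutions of polynomials.
\<close>

definition ev :: "('a::zero \<Rightarrow> 'b::comm_ring_1) \<Rightarrow> ('w \<times> nat \<Rightarrow> 'b) \<Rightarrow> ('w, 'a) dpoly \<Rightarrow> 'b" where
  "ev \<kappa> x f = (\<Sum>m\<in>keys f. \<kappa> (lookup f m) * mon x m)"

lemma dp_eval_ev: "dp_eval \<kappa> D a = ev \<kappa> (\<lambda>(w, k). (D ^^ k) (a w))"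
  by (auto simp: dp_eval_def ev_def mon_def fun_eq_iff case_prod_unfold intro!: sum.cong)

lemma ev_cong: "(\<And>v. v \<in> dp_vars f \<Longrightarrow> x v = y v) \<Longrightarrow> ev \<kappa> x f = ev \<kappa> y f"
  unfolding ev_def by (intro sum.cong refl arg_cong2[where f="(*)"] mon_cong) (auto simp: dp_vars_def)

context comm_ring_hom
begin

lemma ev_superset:
  assumes "finite S" "keys f \<subseteq> S"
  shows "ev hom x f = (\<Sum>m\<in>S. hom (lookup f m) * mon x m)"
  unfolding ev_def using assms by (intro sum.mono_neutral_left) (auto simp: in_keys_iff)

lemma ev_zero [simp]: "ev hom x 0 = 0" by (simp add: ev_def)

lemma ev_add: "ev hom x (f + g) = ev hom x f + ev hom x g"
proof -
  let ?S = "keys f \<union> keys g"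
  have "ev hom x (f + g) = (\<Sum>m\<in>?S. hom (lookup (f + g) m) * mon x m)"
    by (rule ev_superset) (use keys_add[of f g] in auto)
  then show ?thesis
    by (simp add: lookup_add hom_add distrib_right sum.distrib ev_superset[of ?S])
qed

lemma ev_single: "ev hom x (single m c) = hom c * mon x m"
  by (simp add: ev_def)

lemma ev_mult: "ev hom x (f * g) = ev hom x f * ev hom x g"
proof (induction f rule: dpoly_monomial_induct)
  case (monomial m c)
  show ?case
  proof (induction g rule: dpoly_monomial_induct)
    case (monomial n e)
    then show ?case by (simp add: ev_single mult_single hom_mult mon_add mult_ac)
  qed (simp add: ev_add distrib_left)
qed (simp add: ev_add distrib_right)

lemma ev_const [simp]: "ev hom x (dp_const c) = hom c"
  by (simp add: dp_const_def ev_single)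

lemma ev_pvar [simp]: "ev hom x (pvar v) = x v"
  by (simp add: ev_single pvar_def)

lemma ev_comm_ring_hom: "comm_ring_hom (ev hom x)"
proof
  show "ev hom x 1 = 1" using ev_single[of x 0 1] by (simp flip: single_one)
qed (simp_all add: ev_add ev_mult)

end

lemma comm_ring_hom_dp_const: "comm_ring_hom (dp_const :: 'a::comm_ring_1 \<Rightarrow> ('w,'a) dpoly)"
  by standard (simp_all add: dp_const_def single_add mult_single)

lemma dp_const_mult_single: "dp_const c * single m e = single m (c * e :: 'a::comm_ring_1)"
  by (simp add: dp_const_def mult_single)

lemma pvar_power: "pvar v ^ k = (single (single v k) 1 :: ('w, 'a::comm_ring_1) dpoly)"
  by (induction k) (simp_all add: pvar_def mult_single flip: single_add)

lemma mon_pvar: "mon pvar m = (single m 1 :: ('w, 'a::comm_ring_1) dpoly)"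
proof -
  have "mon pvar m = (\<Prod>v\<in>keys m. single (single v (lookup m v)) (1::'a))"
    by (simp add: mon_def pvar_power)
  also have "\<dots> = single (\<Sum>v\<in>keys m. single v (lookup m v)) 1"
    by (induction rule: finite_induct[OF finite_keys[of m]]) (simp_all add: mult_single)
  also have "(\<Sum>v\<in>keys m. single v (lookup m v)) = m"
    by (rule sym, rule poly_mapping_eqI) (auto simp: lookup_sum lookup_single when_def in_keys_iff sum.delta)
  finally show ?thesis .
qed

lemma ev_id [simp]: "ev dp_const pvar f = (f :: ('w, 'a::comm_ring_1) dpoly)"
  using dpoly_sum_monomials[of f]
  by (simp add: ev_def mon_pvar dp_const_mult_single)

lemma ev_compose:
  assumes "comm_ring_hom h"
  shows "h (ev \<kappa> x f) = ev (\<lambda>c. h (\<kappa> c)) (\<lambda>v. h (x v)) f"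
proof -
  interpret comm_ring_hom h by fact
  show ?thesis by (simp add: ev_def mon_def hom_sum hom_mult hom_prod hom_power)
qed

text \<open>
  Two homomorphisms, or two derivations, agree when they agree on constants and variables.
\<close>

lemma dpoly_induct [case_names const var add mult]:
  fixes f :: "('w, 'a::comm_ring_1) dpoly"
  assumes "\<And>c. P (dp_const c)" "\<And>v. P (pvar v)"
    "\<And>f g. P f \<Longrightarrow> P g \<Longrightarrow> P (f + g)" "\<And>f g. P f \<Longrightarrow> P g \<Longrightarrow> P (f * g)"
  shows "P f"
proof (induction f rule: dpoly_monomial_induct)
  case (monomial m c)
  have 1: "P 1" using assms(1)[of 1] by (simp add: dp_const_def)
  have pow: "P (pvar v ^ k)" for v k
    by (induction k) (auto simp: 1 assms(2) intro!: assms(4))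
  have "P (\<Prod>v\<in>S. pvar v ^ lookup m v)" if "finite S" for S
    using that by (induction S) (use 1 pow assms(4) in auto)
  then have "P (mon pvar m)" unfolding mon_def by simp
  then have "P (dp_const c * mon pvar m)" using assms by blast
  then show ?case by (simp add: mon_pvar dp_const_mult_single)
qed (rule assms(3))

subsection \<open>Occurring variables\<close>

lemma finite_dp_vars [simp]: "finite (dp_vars f)"
  by (auto simp: dp_vars_def)

lemma dp_vars_const [simp]: "dp_vars (dp_const c) = {}"
  by (auto simp: dp_vars_def dp_const_def)

lemma dp_vars_zero [simp]: "dp_vars 0 = {}" by (auto simp: dp_vars_def)

lemma dp_vars_one [simp]: "dp_vars (1 :: ('w, 'a::zero_neq_one) dpoly) = {}"
  by (auto simp: dp_vars_def)

lemma dp_vars_pvar [simp]: "dp_vars (pvar v :: ('w, 'a::zero_neq_one) dpoly) = {v}"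
  by (auto simp: dp_vars_def pvar_def)

lemma dp_vars_add: "dp_vars (f + g) \<subseteq> dp_vars f \<union> dp_vars g"
  using keys_add[of f g] by (auto simp: dp_vars_def)

lemma dp_vars_uminus [simp]: "dp_vars (- f) = dp_vars (f :: ('w, 'a::ab_group_add) dpoly)"
  by (auto simp: dp_vars_def in_keys_iff)

lemma dp_vars_diff: "dp_vars (f - g) \<subseteq> dp_vars f \<union> dp_vars (g :: ('w, 'a::ab_group_add) dpoly)"
  using dp_vars_add[of f "- g"] by simp

lemma dp_vars_mult: "dp_vars (f * g) \<subseteq> dp_vars f \<union> dp_vars (g :: ('w, 'a::comm_ring_1) dpoly)"
proof
  fix v assume "v \<in> dp_vars (f * g)"
  then obtain m where "m \<in> keys (f * g)" and v: "v \<in> keys m"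
    by (auto simp: dp_vars_def)
  then obtain a b where "a \<in> keys f" "b \<in> keys g" "m = a + b"
    using keys_mult[of f g] by blast
  then show "v \<in> dp_vars f \<union> dp_vars g"
    using v keys_add[of a b] by (auto simp: dp_vars_def)
qed

lemma dp_vars_sum: "dp_vars (sum f S) \<subseteq> (\<Union>i\<in>S. dp_vars (f i))"
  by (induction S rule: infinite_finite_induct) (use dp_vars_add in fastforce)+

lemma dp_vars_power: "dp_vars (f ^ n) \<subseteq> dp_vars (f :: ('w, 'a::comm_ring_1) dpoly)"
  by (induction n) (use dp_vars_mult in fastforce)+

lemma dp_vars_empty_const: "dp_vars f = {} \<longleftrightarrow> f \<in> range dp_const"
proof
  assume "dp_vars f = {}"
  then have "keys f \<subseteq> {0}" by (auto simp: dp_vars_def simp flip: keys_eq_empty)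
  then have "f = dp_const (lookup f 0)"
    by (intro poly_mapping_eqI) (auto simp: dp_const_def lookup_single when_def in_keys_iff)
  then show "f \<in> range dp_const" by blast
qed auto

lemma dp_degree_in_le_iff: "dp_degree_in v f \<le> n \<longleftrightarrow> (\<forall>m\<in>keys f. lookup m v \<le> n)"
  by (auto simp: dp_degree_in_def)

lemma dp_degree_in_pos_iff: "0 < dp_degree_in v f \<longleftrightarrow> v \<in> dp_vars f"
  using dp_degree_in_le_iff[of v f 0] by (auto simp: dp_vars_def in_keys_iff not_le)

lemma dp_degree_in_eq_0_iff: "dp_degree_in v f = 0 \<longleftrightarrow> v \<notin> dp_vars f"
  using dp_degree_in_pos_iff[of v f] by auto

lemma dp_degree_in_add_le: "dp_degree_in v (f + g) \<le> max (dp_degree_in v f) (dp_degree_in v g)"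
proof -
  have "lookup m v \<le> max (dp_degree_in v f) (dp_degree_in v g)"
    if "m \<in> keys (f + g)" for m
    using that keys_add[of f g] dp_degree_in_le_iff[of v f "dp_degree_in v f"]
      dp_degree_in_le_iff[of v g "dp_degree_in v g"] by (fastforce simp: le_max_iff_disj)
  then show ?thesis by (simp add: dp_degree_in_le_iff)
qed

lemma dp_degree_in_mult_le:
  "dp_degree_in v (f * g :: ('w, 'a::comm_ring_1) dpoly) \<le> dp_degree_in v f + dp_degree_in v g"
proof -
  have "lookup m v \<le> dp_degree_in v f + dp_degree_in v g"
    if m: "m \<in> keys (f * g)" for m
  proof -
    obtain a b where "a \<in> keys f" "b \<in> keys g" "m = a + b"
      using keys_mult[of f g] m by blast
    then show ?thesis using dp_degree_in_le_iff[of v f "dp_degree_in v f"]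
      dp_degree_in_le_iff[of v g "dp_degree_in v g"] by (auto simp: lookup_add intro!: add_mono)
  qed
  then show ?thesis by (simp add: dp_degree_in_le_iff)
qed

lemma dp_degree_in_sum_le:
  "(\<And>i. i \<in> S \<Longrightarrow> dp_degree_in v (f i) \<le> n) \<Longrightarrow> dp_degree_in v (sum f S) \<le> n"
proof (induction S rule: infinite_finite_induct)
  case (insert x F)
  then have "dp_degree_in v (f x) \<le> n" "dp_degree_in v (sum f F) \<le> n" by auto
  then show ?case using dp_degree_in_add_le[of v "f x" "sum f F"] by (simp add: insert.hyps)
qed (auto simp: dp_degree_in_def)

lemma dp_degree_in_prod_le:
  "dp_degree_in v (prod f S :: ('w, 'a::comm_ring_1) dpoly) \<le> (\<Sum>i\<in>S. dp_degree_in v (f i))"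
proof (induction S rule: infinite_finite_induct)
  case (insert x F)
  then show ?case using dp_degree_in_mult_le[of v "f x" "prod f F"] by (simp add: insert.hyps)
qed (auto simp: dp_degree_in_def)

subsection \<open>Singling out one variable\<close>

text \<open>
  A polynomial as a univariate polynomial in \<open>v\<close>, with coefficients free of \<open>v\<close>. The coefficients
  are kept in the same type, so that the operation can be repeated for any finite set of variables.
\<close>

definition in_var :: "'w \<times> nat \<Rightarrow> ('w, 'a::comm_ring_1) dpoly \<Rightarrow> ('w, 'a) dpoly poly" where
  "in_var v = ev (\<lambda>c. [:dp_const c:]) (\<lambda>w. if w = v then [:0, 1:] else [:pvar w:])"

lemma comm_ring_hom_const_poly: "comm_ring_hom (\<lambda>c. [:c:] :: 'a::comm_ring_1 poly)"
  by standard (auto simp: one_pCons)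

lemma comm_ring_hom_in_var_coeff: "comm_ring_hom (\<lambda>c. [:dp_const c:] :: ('w, 'a::comm_ring_1) dpoly poly)"
proof -
  interpret comm_ring_hom "dp_const :: 'a \<Rightarrow> ('w, 'a) dpoly" by (rule comm_ring_hom_dp_const)
  show ?thesis by standard (auto simp: hom_add hom_mult one_pCons)
qed

lemma comm_ring_hom_in_var: "comm_ring_hom (in_var v)"
  unfolding in_var_def by (rule comm_ring_hom.ev_comm_ring_hom[OF comm_ring_hom_in_var_coeff])

lemma comm_ring_hom_poly_at: "comm_ring_hom (\<lambda>p. poly p (a::'a::comm_ring_1))"
  by standard auto

lemma poly_in_var [simp]: "poly (in_var v f) (pvar v) = f"
proof -
  have *: "(\<lambda>w. poly (if w = v then [:0, 1:] else [:pvar w:]) (pvar v)) = (pvar :: _ \<Rightarrow> ('a, 'b) dpoly)"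
    by auto
  show ?thesis unfolding in_var_def
    by (subst ev_compose[OF comm_ring_hom_poly_at]) (simp add: *)
qed

lemma in_var_eq_iff: "in_var v f = in_var v g \<longleftrightarrow> f = g"
  by (metis poly_in_var)

lemma in_var_eq_0_iff [simp]: "in_var v f = 0 \<longleftrightarrow> f = 0"
proof -
  interpret comm_ring_hom "in_var v :: ('a, 'b) dpoly \<Rightarrow> _" by (rule comm_ring_hom_in_var)
  show ?thesis using in_var_eq_iff[of v f 0] by simp
qed

lemma in_var_free: "v \<notin> dp_vars c \<Longrightarrow> in_var v c = [:c:]"
proof -
  assume "v \<notin> dp_vars c"
  then have "in_var v c = ev (\<lambda>c. [:dp_const c:]) (\<lambda>w. [:pvar w:]) c"
    unfolding in_var_def by (intro ev_cong) auto
  then show ?thesis using ev_compose[OF comm_ring_hom_const_poly, of dp_const pvar c] by simp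
qed

lemma in_var_poly:
  assumes "\<And>i. v \<notin> dp_vars (coeff p i)"
  shows "in_var v (poly p (pvar v)) = p"
proof -
  interpret comm_ring_hom "in_var v :: ('a, 'b) dpoly \<Rightarrow> _" by (rule comm_ring_hom_in_var)
  have v: "in_var v (pvar v :: ('a, 'b) dpoly) = [:0,1:]"
    unfolding in_var_def by (simp add: comm_ring_hom.ev_pvar[OF comm_ring_hom_in_var_coeff])
  have "in_var v (poly p (pvar v)) = (\<Sum>i\<le>degree p. in_var v (coeff p i) * [:0,1:] ^ i)"
    by (simp add: poly_altdef hom_sum hom_mult hom_power v)
  also have "\<dots> = (\<Sum>i\<le>degree p. monom (coeff p i) i)"
    using assms by (simp add: in_var_free monom_altdef)
  finally show ?thesis by (simp add: poly_as_sum_of_monoms)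
qed

lemma dp_vars_coeff_mult:
  fixes p :: "('w, 'a::comm_ring_1) dpoly poly"
  assumes "\<And>i. dp_vars (coeff p i) \<subseteq> U" "\<And>i. dp_vars (coeff q i) \<subseteq> U"
  shows "dp_vars (coeff (p * q) i) \<subseteq> U"
  unfolding coeff_mult
  using assms by (intro order_trans[OF dp_vars_sum] UN_least order_trans[OF dp_vars_mult]) auto

lemma dp_vars_coeff_in_var: "dp_vars (coeff (in_var v f) i) \<subseteq> dp_vars f - {v}"
proof -
  define K where "K = {p :: ('a, 'b) dpoly poly. \<forall>i. dp_vars (coeff p i) \<subseteq> dp_vars f - {v}}"
  have mult: "p * q \<in> K" if "p \<in> K" "q \<in> K" for p q
    using that dp_vars_coeff_mult[of p "dp_vars f - {v}" q] unfolding K_def by auto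
  have const: "[:c:] \<in> K" if "dp_vars c \<subseteq> dp_vars f - {v}" for c
    using that by (auto simp: K_def coeff_pCons split: nat.splits)
  have var: "[:pvar w:] \<in> K" if "m \<in> keys f" "w \<in> keys m" "w \<noteq> v" for w m
    using that by (intro const) (auto simp: dp_vars_def[of f])
  have one: "1 \<in> K" using const[of 1] by (simp add: one_pCons)
  have x: "[:0,1:] \<in> K" by (auto simp: K_def coeff_pCons split: nat.splits)
  have pow: "p ^ k \<in> K" if "p \<in> K" for p k
    by (induction k) (use that mult one in auto)
  have prod: "prod g S \<in> K" if "\<And>i. i \<in> S \<Longrightarrow> g i \<in> K" for g and S :: "('a \<times> nat) set"
    using that by (induction S rule: infinite_finite_induct) (use mult one in auto)
  have sum: "sum g S \<in> K" if "\<And>i. i \<in> S \<Longrightarrow> g i \<in> K" for g and S :: "('a \<times> nat \<Rightarrow>\<^sub>0 nat) set"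
    unfolding K_def mem_Collect_eq coeff_sum using that
    by (intro allI order_trans[OF dp_vars_sum] UN_least) (auto simp: K_def)
  have "in_var v f \<in> K"
    unfolding in_var_def ev_def mon_def
    by (intro sum mult prod pow const)
      (auto intro!: const x simp del: dp_vars_const simp: var const dp_vars_const)
  then show ?thesis by (auto simp: K_def)
qed

text \<open>
  The terms of \<open>f\<close> bound the degree of the univariate polynomial from above; substituting the
  variable back into it bounds it from below.
\<close>

lemma dp_degree_in_eq_degree: "dp_degree_in v f = degree (in_var v f)"
proof (rule antisym)
  have free: "dp_degree_in v (coeff (in_var v f) i) = 0" for i
    using dp_vars_coeff_in_var[of v f i] by (auto simp: dp_degree_in_eq_0_iff)
  have pw: "dp_degree_in v (pvar v ^ i :: ('a, 'b) dpoly) \<le> i" for i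
    by (auto simp: pvar_power dp_degree_in_le_iff)
  have "dp_degree_in v (\<Sum>i\<le>degree (in_var v f). coeff (in_var v f) i * pvar v ^ i) \<le> degree (in_var v f)"
  proof (rule dp_degree_in_sum_le)
    fix i assume "i \<in> {..degree (in_var v f)}"
    then show "dp_degree_in v (coeff (in_var v f) i * pvar v ^ i) \<le> degree (in_var v f)"
      using dp_degree_in_mult_le[of v "coeff (in_var v f) i" "pvar v ^ i"] free[of i] pw[of i] by simp
  qed
  then show "dp_degree_in v f \<le> degree (in_var v f)"
    using poly_in_var[of v f] by (simp add: poly_altdef)
next
  show "degree (in_var v f) \<le> dp_degree_in v f"
    unfolding in_var_def ev_def
  proof (rule degree_sum_le)
    fix m assume m: "m \<in> keys f"
    let ?x = "\<lambda>w. if w = v then [:0, 1:] else [:pvar w :: ('a, 'b) dpoly:]"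
    have "degree (mon ?x m) \<le> (\<Sum>w\<in>keys m. degree (?x w ^ lookup m w))"
      unfolding mon_def using degree_prod_sum_le[of "keys m"] by (simp add: comp_def)
    also have "\<dots> \<le> (\<Sum>w\<in>keys m. if w = v then lookup m w else 0)"
      by (intro sum_mono) (auto intro!: order_trans[OF degree_power_le] simp: poly_const_pow)
    also have "\<dots> \<le> lookup m v" by (simp add: sum.delta)
    also have "\<dots> \<le> dp_degree_in v f"
      using m dp_degree_in_le_iff[of v f "dp_degree_in v f"] by auto
    finally show "degree ([:dp_const (lookup f m):] * mon ?x m) \<le> dp_degree_in v f"
      using degree_mult_le[of "[:dp_const (lookup f m):]" "mon ?x m"] by simp
  qed simp
qed

lemma dp_degree_in_mult:
  fixes f g :: "('w::linorder, 'a::idom) dpoly"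
  assumes "f \<noteq> 0" "g \<noteq> 0"
  shows "dp_degree_in v (f * g) = dp_degree_in v f + dp_degree_in v g"
proof -
  interpret comm_ring_hom "in_var v :: ('w, 'a) dpoly \<Rightarrow> _" by (rule comm_ring_hom_in_var)
  have "in_var v f \<noteq> 0" "in_var v g \<noteq> 0" using assms in_var_eq_iff[of v f 0] in_var_eq_iff[of v g 0] by simp_all
  then show ?thesis unfolding dp_degree_in_eq_degree hom_mult by (rule degree_mult_eq)
qed

lemma dp_vars_dvd:
  fixes f g :: "('w::linorder, 'a::idom) dpoly"
  assumes "f dvd g" "g \<noteq> 0"
  shows "dp_vars f \<subseteq> dp_vars g"
proof -
  obtain h where "g = f * h" using assms(1) by (rule dvdE)
  then have "dp_degree_in v g = dp_degree_in v f + dp_degree_in v h" for v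
    using dp_degree_in_mult[of f h v] assms(2) by auto
  then have "v \<in> dp_vars g" if "v \<in> dp_vars f" for v
    using that by (simp flip: dp_degree_in_pos_iff)
  then show ?thesis by blast
qed

lemma dp_degree_in_dvd:
  fixes f g :: "('w::linorder, 'a::idom) dpoly"
  assumes "f dvd g" "g \<noteq> 0"
  shows "dp_degree_in v f \<le> dp_degree_in v g"
proof -
  obtain h where "g = f * h" using assms(1) by (rule dvdE)
  then show ?thesis using dp_degree_in_mult[of f h v] assms(2) by auto
qed

section \<open>Irreducible polynomials are prime\<close>

lemma poly_pseudo_division:
  fixes p t :: "('w::linorder, 'a::idom) dpoly poly"
  assumes "\<And>i. dp_vars (coeff p i) \<subseteq> U" and t: "\<And>i. dp_vars (coeff t i) \<subseteq> U" and "t \<noteq> 0"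
  shows "\<exists>N q r. (\<forall>i. dp_vars (coeff q i) \<subseteq> U) \<and> (\<forall>i. dp_vars (coeff r i) \<subseteq> U) \<and>
           smult (lead_coeff t ^ N) p = q * t + r \<and> (r = 0 \<or> degree r < degree t)"
  using assms(1)
proof (induction "if p = 0 then 0 else Suc (degree p)" arbitrary: p rule: less_induct)
  case less
  show ?case
  proof (cases "p = 0 \<or> degree p < degree t")
    case True
    then show ?thesis using less.prems by (intro exI[of _ 0] exI[of _ 0] exI[of _ p]) auto
  next
    case False
    define s where "s = monom (lead_coeff p) (degree p - degree t)"
    define p' where "p' = smult (lead_coeff t) p - s * t"
    have cs: "dp_vars (coeff s i) \<subseteq> U" for i
      using less.prems[of "degree p"] by (auto simp: s_def)
    have csmult: "dp_vars (coeff (smult c q) i) \<subseteq> U"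
      if "dp_vars c \<subseteq> U" "\<And>i. dp_vars (coeff q i) \<subseteq> U" for c i and q :: "('w, 'a) dpoly poly"
      using that by (auto dest!: set_mp[OF dp_vars_mult])
    have cadd: "dp_vars (coeff (q + q') i) \<subseteq> U"
      if "\<And>i. dp_vars (coeff q i) \<subseteq> U" "\<And>i. dp_vars (coeff q' i) \<subseteq> U" for i and q q' :: "('w, 'a) dpoly poly"
      using that by (auto dest!: set_mp[OF dp_vars_add])
    have cdiff: "dp_vars (coeff (q - q') i) \<subseteq> U"
      if "\<And>i. dp_vars (coeff q i) \<subseteq> U" "\<And>i. dp_vars (coeff q' i) \<subseteq> U" for i and q q' :: "('w, 'a) dpoly poly"
      using that by (auto dest!: set_mp[OF dp_vars_diff])
    have cp': "dp_vars (coeff p' i) \<subseteq> U" for i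
      unfolding p'_def by (intro cdiff csmult dp_vars_coeff_mult less.prems t cs)
    have le: "degree t \<le> degree p" and p0: "p \<noteq> 0" using False by auto
    have "degree s = degree p - degree t"
      unfolding s_def using p0 by (intro Polynomial.degree_monom_eq) auto
    moreover have "s \<noteq> 0" using p0 by (simp add: s_def)
    ultimately have "degree (s * t) = degree p"
      using \<open>t \<noteq> 0\<close> le by (simp add: degree_mult_eq)
    moreover have "lead_coeff (s * t) = lead_coeff p * lead_coeff t"
      using \<open>degree s = degree p - degree t\<close> by (simp add: lead_coeff_mult) (simp add: s_def)
    ultimately have top: "coeff p' (degree p) = 0"
      by (simp add: p'_def)
    have deg: "degree p' \<le> degree p"
      unfolding p'_def using \<open>degree (s * t) = degree p\<close>
      by (intro degree_diff_le) (auto intro: degree_smult_le)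
    have "p' = 0 \<or> degree p' < degree p"
      using top deg by (metis le_neq_implies_less leading_coeff_0_iff)
    then have "(if p' = 0 then 0 else Suc (degree p')) < (if p = 0 then 0 else Suc (degree p))"
      using p0 by auto
    from less.hyps[OF this cp'] obtain N q r
      where q: "\<forall>i. dp_vars (coeff q i) \<subseteq> U" and r: "\<forall>i. dp_vars (coeff r i) \<subseteq> U"
        and eq: "smult (lead_coeff t ^ N) p' = q * t + r" and dr: "r = 0 \<or> degree r < degree t"
      by blast
    have lcN: "dp_vars (lead_coeff t ^ N) \<subseteq> U"
      using dp_vars_power t by blast
    have "smult (lead_coeff t ^ Suc N) p = smult (lead_coeff t ^ N) (p' + s * t)"
      by (simp add: p'_def mult.commute)
    also have "\<dots> = (q + smult (lead_coeff t ^ N) s) * t + r"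
      by (simp add: smult_add_right eq algebra_simps)
    finally have "smult (lead_coeff t ^ Suc N) p = (q + smult (lead_coeff t ^ N) s) * t + r" .
    moreover have "\<forall>i. dp_vars (coeff (q + smult (lead_coeff t ^ N) s) i) \<subseteq> U"
      by (intro allI cadd csmult lcN cs) (use q in auto)
    ultimately show ?thesis using r dr by blast
  qed
qed

lemma dp_vars_poly:
  fixes p :: "('w, 'a::comm_ring_1) dpoly poly"
  assumes "\<And>i. dp_vars (coeff p i) \<subseteq> U"
  shows "dp_vars (poly p (pvar v)) \<subseteq> insert v U"
proof -
  have "dp_vars (coeff p i * pvar v ^ i) \<subseteq> insert v U" for i
    using dp_vars_mult[of "coeff p i" "pvar v ^ i"] dp_vars_power[of "pvar v" i] assms[of i] by auto
  then show ?thesis unfolding poly_altdef by (intro order_trans[OF dp_vars_sum]) auto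
qed

text \<open>
  Division with remainder in the main variable \<open>v\<close>, at the price of multiplying by a power of the
  leading coefficient. All the data stay inside the polynomial ring generated by \<open>v\<close> and \<open>U\<close>, which
  is what allows inductions on the number of variables.
\<close>

lemma dp_pseudo_division:
  fixes f t :: "('w::linorder, 'a::idom) dpoly"
  assumes "dp_vars f \<subseteq> insert v U" "dp_vars t \<subseteq> insert v U" "v \<notin> U" "t \<noteq> 0"
  shows "\<exists>N q r. dp_vars q \<subseteq> insert v U \<and> dp_vars r \<subseteq> insert v U \<and>
           lead_coeff (in_var v t) ^ N * f = q * t + r \<and> (r = 0 \<or> dp_degree_in v r < dp_degree_in v t)"
proof -
  interpret comm_ring_hom "in_var v :: ('w, 'a) dpoly \<Rightarrow> _" by (rule comm_ring_hom_in_var)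
  have c: "dp_vars (coeff (in_var v f) i) \<subseteq> U" "dp_vars (coeff (in_var v t) i) \<subseteq> U" for i
    using dp_vars_coeff_in_var[of v f i] dp_vars_coeff_in_var[of v t i] assms by auto
  have "in_var v t \<noteq> 0" using assms(4) in_var_eq_iff[of v t 0] by simp
  from poly_pseudo_division[OF c this] obtain N q r
    where q: "\<forall>i. dp_vars (coeff q i) \<subseteq> U" and r: "\<forall>i. dp_vars (coeff r i) \<subseteq> U"
      and eq: "smult (lead_coeff (in_var v t) ^ N) (in_var v f) = q * in_var v t + r"
      and dr: "r = 0 \<or> degree r < degree (in_var v t)"
    by blast
  have "lead_coeff (in_var v t) ^ N * f = poly q (pvar v) * t + poly r (pvar v)"
    using arg_cong[OF eq, of "\<lambda>p. poly p (pvar v)"] by simp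
  moreover have "poly r (pvar v) = 0 \<or> dp_degree_in v (poly r (pvar v)) < dp_degree_in v t"
  proof -
    have "in_var v (poly r (pvar v)) = r" using r assms(3) by (intro in_var_poly) auto
    then show ?thesis using dr by (auto simp: dp_degree_in_eq_degree)
  qed
  moreover have "dp_vars (poly q (pvar v)) \<subseteq> insert v U" "dp_vars (poly r (pvar v)) \<subseteq> insert v U"
    using q r by (auto intro!: dp_vars_poly del: subsetI)
  ultimately show ?thesis by blast
qed

text \<open>
  The sum of the degrees in all variables is additive on products and vanishes only on constants, so
  it decreases when a nontrivial factor is split off.
\<close>

definition dp_size :: "('w, 'a::zero) dpoly \<Rightarrow> nat" where
  "dp_size f = (\<Sum>v\<in>dp_vars f. dp_degree_in v f)"

lemma dp_size_superset:
  assumes "finite W" "dp_vars f \<subseteq> W"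
  shows "dp_size f = (\<Sum>v\<in>W. dp_degree_in v f)"
  unfolding dp_size_def using assms
  by (intro sum.mono_neutral_left) (auto simp: dp_degree_in_eq_0_iff)

lemma dp_size_mult:
  fixes f g :: "('w::linorder, 'a::idom) dpoly"
  assumes "f \<noteq> 0" "g \<noteq> 0"
  shows "dp_size (f * g) = dp_size f + dp_size g"
proof -
  let ?W = "dp_vars f \<union> dp_vars g"
  have "dp_size (f * g) = (\<Sum>v\<in>?W. dp_degree_in v (f * g))"
    by (rule dp_size_superset) (use dp_vars_mult[of f g] in auto)
  then show ?thesis
    using assms by (simp add: dp_degree_in_mult sum.distrib dp_size_superset[of ?W])
qed

lemma dp_unit_iff:
  fixes f :: "('w::linorder, 'a::field) dpoly"
  shows "f dvd 1 \<longleftrightarrow> f \<noteq> 0 \<and> dp_vars f = {}"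
proof
  assume "f dvd 1"
  then show "f \<noteq> 0 \<and> dp_vars f = {}" using dp_vars_dvd[of f 1] by auto
next
  assume f: "f \<noteq> 0 \<and> dp_vars f = {}"
  then obtain c where c: "f = dp_const c" using dp_vars_empty_const by blast
  with f have "c \<noteq> 0" by (auto simp: dp_const_def)
  then have "f * dp_const (inverse c) = 1"
    by (simp add: c dp_const_def mult_single)
  then show "f dvd 1" by (metis dvd_triv_left)
qed

lemma dp_size_pos:
  fixes f :: "('w::linorder, 'a::field) dpoly"
  assumes "f \<noteq> 0" "\<not> f dvd 1"
  shows "0 < dp_size f"
proof -
  obtain v where "v \<in> dp_vars f" using assms dp_unit_iff by blast
  then show ?thesis
    unfolding dp_size_def by (intro sum_pos2[of _ v]) (auto simp: dp_degree_in_pos_iff)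
qed

abbreviation dp_irreducible :: "('w, 'a::comm_ring_1) dpoly \<Rightarrow> bool" where
  "dp_irreducible f \<equiv> comm_semiring_1_class.irreducible f"

lemmas dp_irreducible_def = comm_semiring_1_class.irreducible_def

lemma exists_irreducible_factor:
  fixes f :: "('w::linorder, 'a::field) dpoly"
  assumes "f \<noteq> 0" "\<not> f dvd 1"
  shows "\<exists>p. dp_irreducible p \<and> p dvd f"
  using assms
proof (induction "dp_size f" arbitrary: f rule: less_induct)
  case less
  show ?case
  proof (cases "dp_irreducible f")
    case False
    then obtain a b where ab: "f = a * b" "\<not> a dvd 1" "\<not> b dvd 1"
      using less.prems by (auto simp: dp_irreducible_def)
    then have "a \<noteq> 0" "b \<noteq> 0" using less.prems by auto
    then have "dp_size a < dp_size f" using ab dp_size_pos[of b] by (simp add: dp_size_mult)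
    from less.hyps[OF this \<open>a \<noteq> 0\<close> ab(2)] show ?thesis using ab by (auto intro: dvd_mult2)
  qed auto
qed

text \<open>
  Primality tested only against polynomials in the variables \<open>U\<close>: the induction on the number of
  variables needs this relative notion, because the induction hypothesis concerns all irreducible
  polynomials of the smaller ring.
\<close>

definition prime_within :: "('w \<times> nat) set \<Rightarrow> ('w, 'a::comm_ring_1) dpoly \<Rightarrow> bool" where
  "prime_within U p \<longleftrightarrow>
     (\<forall>g h. dp_vars g \<subseteq> U \<longrightarrow> dp_vars h \<subseteq> U \<longrightarrow> p dvd g * h \<longrightarrow> p dvd g \<or> p dvd h)"

lemma dvd_iff_in_var:
  fixes p g :: "('w::linorder, 'a::idom) dpoly"
  assumes "v \<notin> dp_vars p"
  shows "p dvd g \<longleftrightarrow> (\<forall>i. p dvd coeff (in_var v g) i)"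
proof -
  interpret comm_ring_hom "in_var v :: ('w, 'a) dpoly \<Rightarrow> _" by (rule comm_ring_hom_in_var)
  have "p dvd g \<longleftrightarrow> [:p:] dvd in_var v g"
  proof
    assume "p dvd g"
    then show "[:p:] dvd in_var v g" using hom_dvd[of p g] in_var_free[OF assms] by simp
  next
    assume "[:p:] dvd in_var v g"
    then obtain q where "in_var v g = [:p:] * q" by blast
    then have "g = p * poly q (pvar v)"
      using poly_in_var[of v g] by simp
    then show "p dvd g" by simp
  qed
  then show ?thesis by (simp add: const_poly_dvd_iff)
qed

text \<open>
  The classical Gauss argument: if \<open>p\<close> divides neither factor, look at the first coefficients in
  \<open>v\<close> that it does not divide.
\<close>

lemma prime_within_insert:
  fixes p :: "('w::linorder, 'a::idom) dpoly"
  assumes p: "prime_within U p" and "dp_vars p \<subseteq> U" "v \<notin> U"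
  shows "prime_within (insert v U) p"
  unfolding prime_within_def
proof (intro allI impI, rule ccontr)
  fix g h
  assume g: "dp_vars g \<subseteq> insert v U" and h: "dp_vars h \<subseteq> insert v U" and dvd: "p dvd g * h"
    and neg: "\<not> (p dvd g \<or> p dvd h)"
  interpret comm_ring_hom "in_var v :: ('w, 'a) dpoly \<Rightarrow> _" by (rule comm_ring_hom_in_var)
  have v: "v \<notin> dp_vars p" using assms by auto
  let ?g = "in_var v g" and ?h = "in_var v h"
  obtain i0 j0 where "\<not> p dvd coeff ?g i0" "\<not> p dvd coeff ?h j0"
    using neg dvd_iff_in_var[OF v, of g] dvd_iff_in_var[OF v, of h] by blast
  obtain i where i: "\<not> p dvd coeff ?g i" "\<And>k. k < i \<Longrightarrow> p dvd coeff ?g k"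
    using exists_least_iff[of "\<lambda>i. \<not> p dvd coeff ?g i"] \<open>\<not> p dvd coeff ?g i0\<close> by blast
  obtain j where j: "\<not> p dvd coeff ?h j" "\<And>k. k < j \<Longrightarrow> p dvd coeff ?h k"
    using exists_least_iff[of "\<lambda>i. \<not> p dvd coeff ?h i"] \<open>\<not> p dvd coeff ?h j0\<close> by blast
  have "p dvd (\<Sum>k\<in>{..i+j} - {i}. coeff ?g k * coeff ?h (i + j - k))"
  proof (rule dvd_sum)
    fix k assume "k \<in> {..i+j} - {i}"
    then have "k < i \<or> i + j - k < j" by auto
    then show "p dvd coeff ?g k * coeff ?h (i + j - k)"
      using i(2) j(2) by (auto intro: dvd_mult dvd_mult2)
  qed
  moreover have "p dvd (\<Sum>k\<le>i+j. coeff ?g k * coeff ?h (i + j - k))"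
    using dvd dvd_iff_in_var[OF v, of "g * h"] by (simp add: hom_mult coeff_mult)
  moreover have "(\<Sum>k\<le>i+j. coeff ?g k * coeff ?h (i + j - k)) =
      coeff ?g i * coeff ?h j + (\<Sum>k\<in>{..i+j} - {i}. coeff ?g k * coeff ?h (i + j - k))"
    by (subst sum.remove[of _ i]) auto
  ultimately have "p dvd coeff ?g i * coeff ?h j"
    by (simp add: dvd_add_left_iff)
  moreover have "dp_vars (coeff ?g i) \<subseteq> U" "dp_vars (coeff ?h j) \<subseteq> U"
    using dp_vars_coeff_in_var[of v g i] dp_vars_coeff_in_var[of v h j] g h by auto
  ultimately show False using p i(1) j(1) unfolding prime_within_def by blast
qed

definition primitive_over :: "('w \<times> nat) set \<Rightarrow> ('w, 'a::comm_ring_1) dpoly \<Rightarrow> bool" where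
  "primitive_over U t \<longleftrightarrow> (\<forall>p. dp_irreducible p \<longrightarrow> dp_vars p \<subseteq> U \<longrightarrow> \<not> p dvd t)"

lemma primitive_part_exists:
  fixes t :: "('w::linorder, 'a::field) dpoly"
  assumes "t \<noteq> 0"
  shows "\<exists>e s. t = e * s \<and> dp_vars e \<subseteq> U \<and> primitive_over U s"
  using assms
proof (induction "dp_size t" arbitrary: t rule: less_induct)
  case less
  show ?case
  proof (cases "primitive_over U t")
    case True
    then show ?thesis by (intro exI[of _ 1] exI[of _ t]) simp
  next
    case False
    then obtain p t' where p: "dp_irreducible p" "dp_vars p \<subseteq> U" and t: "t = p * t'"
      unfolding primitive_over_def by (metis dvdE)
    then have nz: "p \<noteq> 0" "t' \<noteq> 0" "\<not> p dvd 1" using less.prems by (auto simp: dp_irreducible_def)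
    then have "dp_size t' < dp_size t" using dp_size_pos[of p] by (simp add: t dp_size_mult)
    from less.hyps[OF this nz(2)] obtain e s where "t' = e * s" "dp_vars e \<subseteq> U" "primitive_over U s"
      by blast
    moreover have "t = (p * e) * s" using t \<open>t' = e * s\<close> by (simp only: mult.assoc)
    moreover have "dp_vars (p * e) \<subseteq> U" using dp_vars_mult[of p e] p(2) \<open>dp_vars e \<subseteq> U\<close> by blast
    ultimately show ?thesis by blast
  qed
qed

text \<open>
  An irreducible factor of \<open>c\<close> divides \<open>q t\<close> but not the primitive \<open>t\<close>, so it divides \<open>q\<close> and can
  be cancelled. In the end \<open>c\<close> is a unit.
\<close>

lemma primitive_dvd_cancel:
  fixes t :: "('w::linorder, 'a::field) dpoly"
  assumes prime: "\<And>p :: ('w, 'a) dpoly. dp_irreducible p \<Longrightarrow> dp_vars p \<subseteq> U \<Longrightarrow> prime_within W p"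
    and t: "primitive_over U t" "dp_vars t \<subseteq> W"
    and "c \<noteq> 0" "dp_vars c \<subseteq> U" "dp_vars q \<subseteq> W" "c * f = q * t"
  shows "t dvd f"
  using assms(4-)
proof (induction "dp_size c" arbitrary: c q rule: less_induct)
  case less
  show ?case
  proof (cases "c dvd 1")
    case True
    then obtain c' where "1 = c * c'" by (rule dvdE)
    have "f = (c * c') * f" unfolding \<open>1 = c * c'\<close>[symmetric] by simp
    also have "\<dots> = (c' * q) * t" using less.prems(4) by (simp add: mult_ac)
    finally show ?thesis by (metis dvd_triv_right)
  next
    case False
    then obtain p c' where p: "dp_irreducible p" and c: "c = p * c'"
      using exists_irreducible_factor[of c] less.prems(1) by (metis dvdE)
    have pU: "dp_vars p \<subseteq> U" using dp_vars_dvd[of p c] c less.prems by auto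
    have nz: "p \<noteq> 0" "c' \<noteq> 0" "\<not> p dvd 1" using c p less.prems by (auto simp: dp_irreducible_def)
    have "p dvd q * t" using less.prems(4) c by (metis dvd_triv_left mult.assoc)
    moreover have "\<not> p dvd t" using t p pU by (auto simp: primitive_over_def)
    ultimately have "p dvd q" using prime[OF p pU] t(2) less.prems(3) by (auto simp: prime_within_def)
    then obtain q' where q: "q = p * q'" by (rule dvdE)
    show ?thesis
    proof (cases "q = 0")
      case True
      then show ?thesis using less.prems by auto
    next
      case False
      have "p * (c' * f) = p * (q' * t)" using less.prems(4) c q by (simp add: mult.assoc)
      then have "c' * f = q' * t" using nz by simp
      moreover have "dp_size c' < dp_size c" using nz dp_size_pos[of p] by (simp add: c dp_size_mult)
      moreover have "dp_vars c' \<subseteq> U" "dp_vars q' \<subseteq> W"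
        using dp_vars_dvd[of c' c] dp_vars_dvd[of q' q] less.prems False c q by auto
      ultimately show ?thesis using less.hyps nz by blast
    qed
  qed
qed

text \<open>
  Bezout identity up to content: a combination \<open>t\<close> of \<open>f\<close> and \<open>g\<close> of minimal degree in \<open>v\<close>
  pseudo-divides both.
\<close>

lemma pseudo_gcd_exists:
  fixes f g :: "('w::linorder, 'a::idom) dpoly"
  assumes "dp_vars f \<subseteq> insert v U" "dp_vars g \<subseteq> insert v U" "v \<notin> U" "f \<noteq> 0"
  shows "\<exists>t \<alpha> \<beta> c q q'. t = \<alpha> * f + \<beta> * g \<and> t \<noteq> 0 \<and> c \<noteq> 0 \<and> dp_vars c \<subseteq> U \<and>
           dp_vars t \<subseteq> insert v U \<and> dp_vars q \<subseteq> insert v U \<and> dp_vars q' \<subseteq> insert v U \<and>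
           c * f = q * t \<and> c * g = q' * t"
proof -
  let ?W = "insert v U"
  define I where "I t \<longleftrightarrow> dp_vars t \<subseteq> ?W \<and> (\<exists>\<alpha> \<beta>. t = \<alpha> * f + \<beta> * g)" for t
  have "f = 1 * f + 0 * g" "g = 0 * f + 1 * g" by simp_all
  then have "I f" "I g" unfolding I_def using assms by blast+
  obtain t where t: "t \<noteq> 0" "I t" and min: "\<And>s. s \<noteq> 0 \<Longrightarrow> I s \<Longrightarrow> dp_degree_in v t \<le> dp_degree_in v s"
    using ex_has_least_nat[of "\<lambda>t. t \<noteq> 0 \<and> I t" f "dp_degree_in v"] \<open>I f\<close> assms(4) by blast
  define l where "l = lead_coeff (in_var v t)"
  have l: "l \<noteq> 0" "dp_vars l \<subseteq> U"
    using t dp_vars_coeff_in_var[of v t "degree (in_var v t)"]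
    by (auto simp: l_def I_def)
  have lN: "l ^ N \<noteq> 0" "dp_vars (l ^ N) \<subseteq> U" for N
    using l dp_vars_power[of l N] by auto
  have div: "\<exists>N q. dp_vars q \<subseteq> ?W \<and> l ^ N * h = q * t" if h: "I h" for h
  proof -
    have "dp_vars h \<subseteq> ?W" "dp_vars t \<subseteq> ?W" using h t unfolding I_def by simp_all
    from dp_pseudo_division[OF this assms(3) t(1)] obtain N q r
      where q: "dp_vars q \<subseteq> ?W" and r: "dp_vars r \<subseteq> ?W"
      and eq: "l ^ N * h = q * t + r" and dr: "r = 0 \<or> dp_degree_in v r < dp_degree_in v t"
      unfolding l_def by blast
    obtain \<alpha> \<beta> where "h = \<alpha> * f + \<beta> * g" using h unfolding I_def by blast
    moreover obtain \<alpha>' \<beta>' where "t = \<alpha>' * f + \<beta>' * g" using t unfolding I_def by blast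
    ultimately have "r = (l ^ N * \<alpha> - q * \<alpha>') * f + (l ^ N * \<beta> - q * \<beta>') * g"
      using eq by (simp add: algebra_simps)
    then have "I r" using r unfolding I_def by blast
    then have "r = 0" using dr min[of r] not_le by blast
    then show ?thesis using q eq by auto
  qed
  obtain N q where q: "dp_vars q \<subseteq> ?W" "l ^ N * f = q * t" using div[OF \<open>I f\<close>] by blast
  obtain M q' where q': "dp_vars q' \<subseteq> ?W" "l ^ M * g = q' * t" using div[OF \<open>I g\<close>] by blast
  have "l ^ (N + M) * f = (l ^ M * q) * t" "l ^ (N + M) * g = (l ^ N * q') * t"
    using arg_cong[OF q(2), of "\<lambda>x. l ^ M * x"] arg_cong[OF q'(2), of "\<lambda>x. l ^ N * x"]
    by (simp_all add: power_add mult_ac)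
  moreover have "dp_vars (l ^ M * q) \<subseteq> ?W" "dp_vars (l ^ N * q') \<subseteq> ?W"
    using dp_vars_mult[of "l ^ M" q] dp_vars_mult[of "l ^ N" q'] lN[of M] lN[of N] q q' by auto
  ultimately show ?thesis using t lN[of "N + M"] unfolding I_def by blast
qed

text \<open>
  Gauss's lemma by induction on the variables. Let \<open>s\<close> be the primitive part of a pseudo-gcd \<open>t\<close> of
  \<open>f\<close> and \<open>g\<close>; it divides both. Since \<open>f\<close> is irreducible, either \<open>s\<close> is associated to \<open>f\<close>, and then
  \<open>f\<close> divides \<open>g\<close>, or \<open>s\<close> is a unit. In the second case \<open>t\<close> is free of \<open>v\<close>, and the identity
  \<open>t h = \<alpha> f h + \<beta> g h\<close> shows that \<open>f\<close> divides \<open>t h\<close>, hence \<open>h\<close>.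
\<close>

lemma irreducible_prime_within:
  fixes f :: "('w::linorder, 'a::field) dpoly"
  assumes "finite V" "dp_irreducible f" "dp_vars f \<subseteq> V"
  shows "prime_within V f"
  using assms
proof (induction V arbitrary: f rule: finite_induct)
  case empty
  then show ?case using dp_unit_iff[of f] by (auto simp: dp_irreducible_def)
next
  case (insert v U)
  have prime: "prime_within (insert v U) p" if "dp_irreducible p" "dp_vars p \<subseteq> U" for p :: "('w, 'a) dpoly"
    using prime_within_insert insert that by blast
  show ?case
  proof (cases "v \<in> dp_vars f")
    case False
    then show ?thesis using prime insert.prems by auto
  next
    case True
    have f0: "f \<noteq> 0" and funit: "\<not> f dvd 1" using insert.prems by (auto simp: dp_irreducible_def)
    have "f dvd g \<or> f dvd h"
      if g: "dp_vars g \<subseteq> insert v U" and h: "dp_vars h \<subseteq> insert v U" and dvd: "f dvd g * h" for g h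
    proof -
      obtain t \<alpha> \<beta> c q q' where t: "t = \<alpha> * f + \<beta> * g" "t \<noteq> 0"
        and c: "c \<noteq> 0" "dp_vars c \<subseteq> U" and tW: "dp_vars t \<subseteq> insert v U"
        and q: "dp_vars q \<subseteq> insert v U" "dp_vars q' \<subseteq> insert v U"
        and eq: "c * f = q * t" "c * g = q' * t"
        using pseudo_gcd_exists[OF insert.prems(2) g insert.hyps(2) f0] by blast
      obtain e s where s: "t = e * s" "dp_vars e \<subseteq> U" "primitive_over U s"
        using primitive_part_exists[OF t(2)] by blast
      have sW: "dp_vars s \<subseteq> insert v U" using dp_vars_dvd[of s t] tW t(2) unfolding s(1) by auto
      have qe: "dp_vars (q * e) \<subseteq> insert v U" "dp_vars (q' * e) \<subseteq> insert v U"
        using dp_vars_mult[of q e] dp_vars_mult[of q' e] q s(2) by auto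
      have "s dvd f" "s dvd g"
        by (rule primitive_dvd_cancel[OF prime s(3) sW c qe(1)], simp_all add: eq s(1) mult_ac)
          (rule primitive_dvd_cancel[OF prime s(3) sW c qe(2)], simp_all add: eq s(1) mult_ac)
      then obtain k where k: "f = s * k" by (elim dvdE)
      then consider "s dvd 1" | "k dvd 1" using insert.prems by (auto simp: dp_irreducible_def)
      then show "f dvd g \<or> f dvd h"
      proof cases
        case 2
        then obtain k' where "1 = k * k'" by (rule dvdE)
        then have "s = f * k'" using k by (simp add: mult.assoc flip: \<open>1 = k * k'\<close>)
        then have "f dvd s" by simp
        then show ?thesis using \<open>s dvd g\<close> dvd_trans by blast
      next
        case 1
        then have tU: "dp_vars t \<subseteq> U" using s dp_unit_iff[of s] dp_vars_mult[of e s] by auto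
        have "t * h = (\<alpha> * h) * f + \<beta> * (g * h)" using t(1) by (simp add: algebra_simps)
        then have "f dvd t * h" using dvd by simp
        then obtain w where "t * h = f * w" by (rule dvdE)
        then have w: "t * h = w * f" by (simp only: mult.commute)
        \<comment> \<open>an irreducible factor free of \<open>v\<close> would be associated to \<open>f\<close>, in which \<open>v\<close> occurs\<close>
        have prim: "primitive_over U f" unfolding primitive_over_def
        proof (intro allI impI notI)
          fix p assume p: "dp_irreducible p" "dp_vars p \<subseteq> U" "p dvd f"
          obtain x where x: "f = p * x" using p(3) by (rule dvdE)
          then have "x dvd 1" using insert.prems p by (auto simp: dp_irreducible_def)
          then have "dp_vars f \<subseteq> U" using x p dp_unit_iff[of x] dp_vars_mult[of p x] by auto
          then show False using True insert.hyps by auto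
        qed
        have "f dvd h"
        proof (cases "h = 0")
          case False
          have "w dvd t * h" unfolding w by (rule dvd_triv_left)
          then have "dp_vars w \<subseteq> dp_vars (t * h)" using t(2) False by (intro dp_vars_dvd) auto
          also have "\<dots> \<subseteq> insert v U" using dp_vars_mult[of t h] tW h by blast
          finally have "dp_vars w \<subseteq> insert v U" .
          then show ?thesis
            using primitive_dvd_cancel[OF prime prim insert.prems(2) t(2) tU _ w] by blast
        qed simp
        then show ?thesis ..
      qed
    qed
    then show ?thesis unfolding prime_within_def by blast
  qed
qed

theorem dp_irreducible_dvd_mult:
  fixes f g h :: "('w::linorder, 'a::field) dpoly"
  assumes "dp_irreducible f" "f dvd g * h"
  shows "f dvd g \<or> f dvd h"
proof -
  have "prime_within (dp_vars f \<union> dp_vars g \<union> dp_vars h) f"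
    using assms by (intro irreducible_prime_within) auto
  then show ?thesis using assms(2) by (auto simp: prime_within_def)
qed

section \<open>Derivations of differential polynomials\<close>

locale derivation_ring =
  fixes d :: "'a::comm_ring_1 \<Rightarrow> 'a"
  assumes d_add: "d (a + b) = d a + d b" and d_mult: "d (a * b) = d a * b + a * d b"
begin

lemma d_0 [simp]: "d 0 = 0" using d_add[of 0 0] by simp

lemma d_1 [simp]: "d 1 = 0" using d_mult[of 1 1] by simp

end

lemma derivation_iff: "derivation d \<longleftrightarrow> derivation_ring d"
  by (auto simp: derivation_on_def derivation_ring_def)

lemma diff_hom_class_ring:
  assumes "diff_hom class_ring d class_ring D h"
  shows "comm_ring_hom h" "h (d c) = D (h c)"
proof -
  have h: "h \<in> Ring.ring_hom class_ring class_ring" using assms by (simp add: diff_hom_def)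
  have add: "h (a + b) = h a + h b" for a b using ring_hom_add[OF h, of a b] by simp
  have "h (a * b) = h a * h b" "h 1 = 1" for a b
    using ring_hom_mult[OF h, of a b] ring_hom_one[OF h] by simp_all
  moreover have "h 0 = 0" using add[of 0 0] by simp
  ultimately show "comm_ring_hom h" using add by unfold_locales auto
  show "h (d c) = D (h c)" using assms by (simp add: diff_hom_def)
qed

subsection \<open>Partial derivatives\<close>

lemma dp_pdiff_superset:
  assumes "finite S" "keys f \<subseteq> S"
  shows "dp_pdiff v f = (\<Sum>m\<in>S. single (m - single v 1)
                     (of_nat (lookup m v) * lookup f m))"
  unfolding dp_pdiff_def using assms by (intro sum.mono_neutral_left) (auto simp: in_keys_iff)

lemma dp_pdiff_add: "dp_pdiff v (f + g) = dp_pdiff v f + dp_pdiff v g"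
proof -
  let ?S = "keys f \<union> keys g"
  have "keys (f + g) \<subseteq> ?S" using keys_add[of f g] by auto
  then show ?thesis
    by (simp add: dp_pdiff_superset[of ?S] lookup_add distrib_left single_add sum.distrib)
qed

lemma dp_pdiff_single:
  "dp_pdiff v (single m c) =
     single (m - single v 1) (of_nat (lookup m v) * c)"
  by (simp add: dp_pdiff_def)

lemma dp_pdiff_mult: "dp_pdiff v (f * g) = dp_pdiff v f * g + f * dp_pdiff v g"
proof (induction f rule: dpoly_monomial_induct)
  case (monomial m c)
  show ?case
  proof (induction g rule: dpoly_monomial_induct)
    case (monomial n e)
    have shift: "m + n - single v 1 = (m - single v 1) + n"
      if "lookup m v \<noteq> 0" for m n :: "'a \<times> nat \<Rightarrow>\<^sub>0 nat"
      using that by (intro poly_mapping_eqI) (auto simp: lookup_add lookup_minus lookup_single when_def)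
    have "single (m + n - single v 1) (of_nat (lookup m v) * (c * e)) =
        single (m - single v 1 + n) (of_nat (lookup m v) * (c * e))"
      using shift[of m n] by (cases "lookup m v = 0") auto
    moreover have "single (m + n - single v 1) (of_nat (lookup n v) * (c * e)) =
        single (m + (n - single v 1)) (of_nat (lookup n v) * (c * e))"
      using shift[of n m] by (cases "lookup n v = 0") (auto simp: add.commute)
    ultimately show ?case
      by (simp add: mult_single dp_pdiff_single lookup_add distrib_right distrib_left single_add
          mult_ac add_ac)
  qed (simp add: dp_pdiff_add distrib_left)
qed (simp add: dp_pdiff_add distrib_right)

lemma dp_pdiff_const [simp]: "dp_pdiff v (dp_const c) = 0"
  by (simp add: dp_const_def dp_pdiff_single)

lemma dp_pdiff_pvar: "dp_pdiff v (pvar w) = (if v = w then 1 else 0)"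
  by (auto simp: pvar_def dp_pdiff_single lookup_single simp flip: single_one)

lemma dp_pdiff_free: "v \<notin> dp_vars f \<Longrightarrow> dp_pdiff v f = 0"
  unfolding dp_pdiff_def by (intro sum.neutral) (auto simp: dp_vars_def in_keys_iff)

lemma keys_dp_pdiff:
  "keys (dp_pdiff v f) \<subseteq>
     (\<lambda>m. m - single v 1) ` {m\<in>keys f. 0 < lookup m v}"
proof
  fix n assume "n \<in> keys (dp_pdiff v f)"
  then obtain m where m: "m \<in> keys f"
    and "n \<in> keys (single (m - single v 1)
                     (of_nat (lookup m v) * lookup f m))"
    unfolding dp_pdiff_def using keys_sum by fastforce
  then have "n = m - single v 1 \<and> lookup m v \<noteq> 0"
    by (cases "lookup m v = 0") (auto split: if_splits)
  then show "n \<in> (\<lambda>m. m - single v 1) ` {m\<in>keys f. 0 < lookup m v}"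
    using m by auto
qed

lemma dp_vars_pdiff: "dp_vars (dp_pdiff v f) \<subseteq> dp_vars f"
proof
  fix w assume "w \<in> dp_vars (dp_pdiff v f)"
  then obtain n where "n \<in> keys (dp_pdiff v f)" and w: "w \<in> keys n"
    by (auto simp: dp_vars_def)
  then obtain m where "m \<in> keys f" and n: "n = m - single v 1"
    using keys_dp_pdiff[of v f] by auto
  moreover have "w \<in> keys m"
    using w by (auto simp: n in_keys_iff lookup_minus)
  ultimately show "w \<in> dp_vars f" by (auto simp: dp_vars_def)
qed

lemma dp_degree_in_pdiff_less:
  assumes "v \<in> dp_vars f"
  shows "dp_degree_in v (dp_pdiff v f) < dp_degree_in v f"
proof -
  have pos: "0 < dp_degree_in v f" using assms by (simp add: dp_degree_in_pos_iff)
  have "dp_degree_in v (dp_pdiff v f) \<le> dp_degree_in v f - 1"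
    unfolding dp_degree_in_le_iff
  proof
    fix n assume "n \<in> keys (dp_pdiff v f)"
    then obtain m where "m \<in> keys f" "n = m - single v 1"
      using keys_dp_pdiff[of v f] by auto
    moreover from this have "lookup m v \<le> dp_degree_in v f"
      using dp_degree_in_le_iff[of v f "dp_degree_in v f"] by blast
    ultimately show "lookup n v \<le> dp_degree_in v f - 1"
      by (simp add: lookup_minus)
  qed
  then show ?thesis using pos by simp
qed

subsection \<open>The total derivative\<close>

text \<open>
  The chain rule may be summed over any larger set of variables, which puts several polynomials on
  a common index set.
\<close>

lemma dp_deriv_superset:
  assumes "finite V" "dp_vars f \<subseteq> V"
  shows "dp_deriv d f = Poly_Mapping.map d f + (\<Sum>v\<in>V. dp_pdiff v f * pvar (fst v, Suc (snd v)))"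
proof -
  have "(\<Sum>(w, k)\<in>dp_vars f. dp_pdiff (w, k) f * dp_var w (Suc k)) =
      (\<Sum>v\<in>dp_vars f. dp_pdiff v f * pvar (fst v, Suc (snd v)))"
    by (simp add: case_prod_unfold dp_var_pvar)
  also have "\<dots> = (\<Sum>v\<in>V. dp_pdiff v f * pvar (fst v, Suc (snd v)))"
    using assms by (intro sum.mono_neutral_left) (auto simp: dp_pdiff_free)
  finally show ?thesis by (simp add: dp_deriv_def)
qed

lemma lookup_map_zero: "d 0 = 0 \<Longrightarrow> lookup (Poly_Mapping.map d f) m = d (lookup f m)"
  by (simp add: Poly_Mapping.map.rep_eq when_def)

lemma dp_vars_map: "dp_vars (Poly_Mapping.map d f) \<subseteq> dp_vars f"
proof -
  have "keys (Poly_Mapping.map d f) \<subseteq> keys f"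
    by (auto simp: in_keys_iff Poly_Mapping.map.rep_eq when_def split: if_splits)
  then show ?thesis by (auto simp: dp_vars_def)
qed

lemma dp_vars_deriv: "dp_vars (dp_deriv d f) \<subseteq> dp_vars f \<union> (\<lambda>v. (fst v, Suc (snd v))) ` dp_vars f"
proof -
  have "dp_vars (dp_pdiff v f * pvar (fst v, Suc (snd v))) \<subseteq> dp_vars f \<union> (\<lambda>v. (fst v, Suc (snd v))) ` dp_vars f"
    if "v \<in> dp_vars f" for v
    using that dp_vars_mult[of "dp_pdiff v f" "pvar (fst v, Suc (snd v))"] dp_vars_pdiff[of v f] by auto
  then have "dp_vars (\<Sum>v\<in>dp_vars f. dp_pdiff v f * pvar (fst v, Suc (snd v))) \<subseteq>
      dp_vars f \<union> (\<lambda>v. (fst v, Suc (snd v))) ` dp_vars f"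
    by (intro order_trans[OF dp_vars_sum] UN_least)
  then show ?thesis
    unfolding dp_deriv_superset[OF finite_dp_vars order_refl]
    using dp_vars_map[of d f] by (intro order_trans[OF dp_vars_add]) auto
qed

context derivation_ring
begin

lemma map_d_add: "Poly_Mapping.map d (f + g) = Poly_Mapping.map d f + Poly_Mapping.map d g"
  by (rule poly_mapping_eqI) (simp add: lookup_map_zero lookup_add d_add)

lemma map_d_mult: "Poly_Mapping.map d (f * g) = Poly_Mapping.map d f * g + f * Poly_Mapping.map d (g :: ('w, 'a) dpoly)"
proof (induction f rule: dpoly_monomial_induct)
  case (monomial m c)
  show ?case
  proof (induction g rule: dpoly_monomial_induct)
    case (monomial n e)
    then show ?case by (simp add: mult_single map_single d_mult single_add)
  qed (simp add: map_d_add distrib_left)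
qed (simp add: map_d_add distrib_right)

lemma dp_deriv_add: "dp_deriv d (f + g) = dp_deriv d f + dp_deriv d g"
  using dp_vars_add[of f g]
  by (simp add: dp_deriv_superset[of "dp_vars f \<union> dp_vars g"] map_d_add dp_pdiff_add
      distrib_right sum.distrib)

lemma dp_deriv_mult: "dp_deriv d (f * g) = dp_deriv d f * g + f * dp_deriv d g"
  using dp_vars_mult[of f g]
  by (simp add: dp_deriv_superset[of "dp_vars f \<union> dp_vars g"] map_d_mult dp_pdiff_mult
      distrib_right distrib_left sum.distrib sum_distrib_left sum_distrib_right mult_ac)

lemma dp_deriv_derivation: "derivation_ring (dp_deriv d)"
  by unfold_locales (rule dp_deriv_add dp_deriv_mult)+

lemma dp_deriv_const [simp]: "dp_deriv d (dp_const c) = dp_const (d c)"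
proof -
  have "Poly_Mapping.map d (dp_const c) = dp_const (d c)"
    by (rule poly_mapping_eqI) (auto simp: lookup_map_zero dp_const_def lookup_single when_def)
  then show ?thesis by (simp add: dp_deriv_superset[of "{}"])
qed

lemma dp_deriv_pvar [simp]: "dp_deriv d (pvar v) = pvar (fst v, Suc (snd v))"
proof -
  have "Poly_Mapping.map d (pvar v) = 0"
    by (simp add: pvar_def map_single)
  then show ?thesis by (simp add: dp_deriv_superset[of "{v}"] dp_pdiff_pvar)
qed

text \<open>
  Both sides are derivations along the evaluation homomorphism, and they agree on constants and
  on variables.
\<close>

lemma dp_eval_deriv:
  assumes "comm_ring_hom \<kappa>" "derivation_ring D" "\<And>c. D (\<kappa> c) = \<kappa> (d c)"
  shows "D (dp_eval \<kappa> D a f) = dp_eval \<kappa> D a (dp_deriv d f)"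
proof -
  interpret comm_ring_hom \<kappa> by fact
  interpret D: derivation_ring D by fact
  show ?thesis unfolding dp_eval_ev
    by (induction f rule: dpoly_induct)
      (simp_all add: assms(3) ev_add ev_mult D.d_add D.d_mult dp_deriv_add dp_deriv_mult case_prod_unfold)
qed

lemma dp_eval_deriv_iterate:
  assumes "comm_ring_hom \<kappa>" "derivation_ring D" "\<And>c. D (\<kappa> c) = \<kappa> (d c)"
  shows "(D ^^ k) (dp_eval \<kappa> D a f) = dp_eval \<kappa> D a ((dp_deriv d ^^ k) f)"
  by (induction k) (simp_all add: dp_eval_deriv[OF assms])

end

section \<open>Partially reduced members of the saturation ideal\<close>

lemma ranking_trans: "ranking r \<Longrightarrow> (a, b) \<in> r \<Longrightarrow> (b, c) \<in> r \<Longrightarrow> (a, c) \<in> r"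
  unfolding ranking_def strict_linear_order_on_def by (blast dest: transD)

lemma ranking_irrefl: "ranking r \<Longrightarrow> (a, a) \<notin> r"
  unfolding ranking_def strict_linear_order_on_def irrefl_def by blast

lemma ranking_total: "ranking r \<Longrightarrow> a \<noteq> b \<Longrightarrow> (a, b) \<in> r \<or> (b, a) \<in> r"
  unfolding ranking_def strict_linear_order_on_def total_on_def by blast

lemma ranking_Suc: "ranking r \<Longrightarrow> ((w, k), (w, Suc k)) \<in> r"
  unfolding ranking_def by blast

lemma ranking_deriv: "ranking r \<Longrightarrow> ((w, k), (w', k')) \<in> r \<Longrightarrow> ((w, Suc k), (w', Suc k')) \<in> r"
  unfolding ranking_def by blast

lemma ranking_less:
  assumes r: "ranking r" and "i < j"
  shows "((w, i), (w, j)) \<in> r"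
  using assms(2) ranking_Suc[OF r] ranking_trans[OF r] by (rule less_Suc_induct)

lemma leader_props:
  assumes r: "ranking r" and "dp_vars f \<noteq> {}"
  shows "leader r f \<in> dp_vars f" "v' \<in> dp_vars f \<Longrightarrow> v' \<noteq> leader r f \<Longrightarrow> (v', leader r f) \<in> r"
proof -
  have "\<exists>v\<in>V. \<forall>v'\<in>V. v' \<noteq> v \<longrightarrow> (v', v) \<in> r" if "finite V" "V \<noteq> {}" for V
    using that
  proof (induction V rule: finite_ne_induct)
    case (insert x F)
    then obtain v where v: "v \<in> F" "\<forall>v'\<in>F. v' \<noteq> v \<longrightarrow> (v', v) \<in> r" by blast
    show ?case
    proof (cases "(x, v) \<in> r")
      case True
      then show ?thesis using v by blast
    next
      case False
      then have "(v, x) \<in> r" using ranking_total[OF r, of x v] insert.hyps v by blast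
      then have "\<forall>v'\<in>insert x F. v' \<noteq> x \<longrightarrow> (v', x) \<in> r"
        using v(2) ranking_trans[OF r, of _ v x] by auto
      then show ?thesis by blast
    qed
  qed auto
  then obtain v where v: "v \<in> dp_vars f" "\<forall>v'\<in>dp_vars f. v' \<noteq> v \<longrightarrow> (v', v) \<in> r"
    using assms(2) finite_dp_vars by blast
  have "leader r f = v"
    unfolding leader_def
  proof (rule the_equality)
    show "v \<in> dp_vars f \<and> (\<forall>v'\<in>dp_vars f. v' \<noteq> v \<longrightarrow> (v', v) \<in> r)" using v by blast
    show "v2 = v" if "v2 \<in> dp_vars f \<and> (\<forall>v'\<in>dp_vars f. v' \<noteq> v2 \<longrightarrow> (v', v2) \<in> r)" for v2
      using that v ranking_trans[OF r, of v v2 v] ranking_irrefl[OF r, of v]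
      by (cases "v2 = v") auto
  qed
  then show "leader r f \<in> dp_vars f" "v' \<in> dp_vars f \<Longrightarrow> v' \<noteq> leader r f \<Longrightarrow> (v', leader r f) \<in> r"
    using v by auto
qed

definition below :: "('w \<times> nat) rel \<Rightarrow> 'w \<times> nat \<Rightarrow> ('w \<times> nat) set" where
  "below r v = {v'. (v', v) \<in> r}"

lemma below_deriv:
  assumes r: "ranking r" and "dp_vars f \<subseteq> below r (w, k)"
  shows "dp_vars (dp_deriv d f) \<subseteq> below r (w, Suc k)"
proof -
  have "v \<in> below r (w, Suc k) \<and> (fst v, Suc (snd v)) \<in> below r (w, Suc k)" if "v \<in> dp_vars f" for v
  proof -
    have lt: "((fst v, snd v), (w, k)) \<in> r" using that assms(2) by (auto simp: below_def)
    show ?thesis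
      using ranking_trans[OF r lt ranking_Suc[OF r]] ranking_deriv[OF r lt] by (simp add: below_def)
  qed
  then show ?thesis using dp_vars_deriv[of d f] by auto
qed

context derivation_ring
begin

text \<open>
  The first differentiation produces the separant as the coefficient of the derivative of the
  leader. Further ones only raise the order of that derivative: everything else they produce stays
  below it in the ranking.
\<close>

lemma proper_derivative_form:
  assumes r: "ranking r" and ne: "dp_vars A \<noteq> {}" and lead: "leader r A = (w, k)"
  shows "\<exists>T. (dp_deriv d ^^ Suc j) A = separant r A * pvar (w, k + Suc j) + T \<and>
             dp_vars T \<subseteq> below r (w, k + Suc j)"
proof (induction j)
  case 0
  let ?S = "separant r A"
  define T where "T = Poly_Mapping.map d A + (\<Sum>v\<in>dp_vars A - {(w, k)}. dp_pdiff v A * pvar (fst v, Suc (snd v)))"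
  have wk: "(w, k) \<in> dp_vars A" using leader_props(1)[OF r ne] lead by simp
  have lt: "(v, (w, k)) \<in> r" if "v \<in> dp_vars A" "v \<noteq> (w, k)" for v
    using leader_props(2)[OF r ne] lead that by auto
  have A: "dp_vars A \<subseteq> below r (w, Suc k)"
  proof
    fix v assume "v \<in> dp_vars A"
    then show "v \<in> below r (w, Suc k)"
      using lt[of v] ranking_trans[OF r, of v "(w, k)" "(w, Suc k)"] ranking_Suc[OF r, of w k]
      by (cases "v = (w, k)") (auto simp: below_def)
  qed
  have sh: "(fst v, Suc (snd v)) \<in> below r (w, Suc k)" if "v \<in> dp_vars A - {(w, k)}" for v
    using ranking_deriv[OF r, of "fst v" "snd v" w k] lt[of v] that by (auto simp: below_def)
  have "dp_vars (\<Sum>v\<in>dp_vars A - {(w, k)}. dp_pdiff v A * pvar (fst v, Suc (snd v))) \<subseteq> below r (w, Suc k)"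
    using dp_vars_pdiff[of _ A] A sh
    by (intro order_trans[OF dp_vars_sum] UN_least order_trans[OF dp_vars_mult]) auto
  then have "dp_vars T \<subseteq> below r (w, Suc k)"
    unfolding T_def using dp_vars_map[of d A] A by (intro order_trans[OF dp_vars_add]) auto
  moreover have "dp_deriv d A = ?S * pvar (w, Suc k) + T"
    unfolding dp_deriv_superset[OF finite_dp_vars order_refl] T_def separant_def lead
    by (subst sum.remove[OF finite_dp_vars wk]) simp
  ultimately show ?case by auto
next
  case (Suc j)
  let ?S = "separant r A"
  from Suc obtain T where T: "(dp_deriv d ^^ Suc j) A = ?S * pvar (w, k + Suc j) + T"
    "dp_vars T \<subseteq> below r (w, k + Suc j)" by blast
  define T' where "T' = dp_deriv d ?S * pvar (w, k + Suc j) + dp_deriv d T"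
  have up: "(v, (w, k + Suc j)) \<in> r" if "(v, (w, k)) \<in> r \<or> v = (w, k)" for v
    using that ranking_trans[OF r, of v "(w, k)" "(w, k + Suc j)"] ranking_less[OF r, of k "k + Suc j" w]
    by auto
  have "dp_vars ?S \<subseteq> below r (w, k + Suc j)"
  proof
    fix v assume "v \<in> dp_vars ?S"
    then have "v \<in> dp_vars A" using dp_vars_pdiff[of "(w, k)" A] by (auto simp: separant_def lead)
    then show "v \<in> below r (w, k + Suc j)"
      using up[of v] leader_props(2)[OF r ne, of v] lead by (auto simp: below_def)
  qed
  then have "dp_vars (dp_deriv d ?S) \<subseteq> below r (w, k + Suc (Suc j))"
    using below_deriv[OF r, of ?S w "k + Suc j"] by simp
  moreover have "(w, k + Suc j) \<in> below r (w, k + Suc (Suc j))"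
    using ranking_Suc[OF r, of w "k + Suc j"] by (simp add: below_def)
  ultimately have "dp_vars T' \<subseteq> below r (w, k + Suc (Suc j))"
    unfolding T'_def using below_deriv[OF r T(2), of d] dp_vars_mult[of "dp_deriv d ?S" "pvar (w, k + Suc j)"]
    by (intro order_trans[OF dp_vars_add]) auto
  moreover have "(dp_deriv d ^^ Suc (Suc j)) A = ?S * pvar (w, k + Suc (Suc j)) + T'"
    using T(1) by (simp add: T'_def dp_deriv_add dp_deriv_mult add_ac)
  ultimately show ?case by blast
qed

end

text \<open>\<open>derivative_ideal d A J\<close> is the ideal generated by the first \<open>J\<close> of \<open>A\<close>, \<open>A'\<close>, \<open>A''\<close>, \<dots>\<close>

primrec derivative_ideal :: "('a \<Rightarrow> 'a) \<Rightarrow> ('w, 'a::comm_ring_1) dpoly \<Rightarrow> nat \<Rightarrow> ('w, 'a) dpoly set" where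
  "derivative_ideal d A 0 = {0}"
| "derivative_ideal d A (Suc J) = {g + c * (dp_deriv d ^^ J) A | g c. g \<in> derivative_ideal d A J}"

lemma derivative_ideal_SucI:
  "g \<in> derivative_ideal d A J \<Longrightarrow> g + c * (dp_deriv d ^^ J) A \<in> derivative_ideal d A (Suc J)"
  by auto

lemma derivative_ideal_Suc: "g \<in> derivative_ideal d A J \<Longrightarrow> g \<in> derivative_ideal d A (Suc J)"
  using derivative_ideal_SucI[of g d A J 0] by simp

lemma derivative_ideal_mono: "J \<le> J' \<Longrightarrow> derivative_ideal d A J \<subseteq> derivative_ideal d A J'"
  by (rule lift_Suc_mono_le[of "derivative_ideal d A"]) (auto intro: derivative_ideal_Suc simp del: derivative_ideal.simps)

lemma derivative_ideal_add:
  "f \<in> derivative_ideal d A J \<Longrightarrow> g \<in> derivative_ideal d A J \<Longrightarrow> f + g \<in> derivative_ideal d A J"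
proof (induction J arbitrary: f g)
  case (Suc J)
  then obtain f' b g' c where "f = f' + b * (dp_deriv d ^^ J) A" "g = g' + c * (dp_deriv d ^^ J) A"
    and "f' \<in> derivative_ideal d A J" "g' \<in> derivative_ideal d A J" by auto
  moreover from this have "f + g = (f' + g') + (b + c) * (dp_deriv d ^^ J) A"
    by (simp add: algebra_simps)
  ultimately show ?case using Suc.IH unfolding derivative_ideal.simps by blast
qed simp

lemma derivative_ideal_mult:
  "f \<in> derivative_ideal d A J \<Longrightarrow> h * f \<in> derivative_ideal d A J"
proof (induction J arbitrary: f)
  case (Suc J)
  then obtain f' b where "f = f' + b * (dp_deriv d ^^ J) A" "f' \<in> derivative_ideal d A J" by auto
  moreover from this have "h * f = h * f' + (h * b) * (dp_deriv d ^^ J) A"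
    by (simp add: algebra_simps)
  ultimately show ?case using Suc.IH unfolding derivative_ideal.simps by blast
qed simp

lemma derivative_ideal_1: "f \<in> derivative_ideal d A (Suc 0) \<Longrightarrow> A dvd f"
  by auto

context derivation_ring
begin

lemma derivative_ideal_deriv:
  "f \<in> derivative_ideal d A J \<Longrightarrow> dp_deriv d f \<in> derivative_ideal d A (Suc J)"
proof (induction J arbitrary: f)
  case 0
  interpret dd: derivation_ring "dp_deriv d :: ('b, 'a) dpoly \<Rightarrow> _" by (rule dp_deriv_derivation)
  show ?case using 0 by (auto intro: exI[of _ 0])
next
  case (Suc J)
  then obtain g c where f: "f = g + c * (dp_deriv d ^^ J) A" and g: "g \<in> derivative_ideal d A J" by auto
  have "dp_deriv d f = (dp_deriv d g + dp_deriv d c * (dp_deriv d ^^ J) A) + c * (dp_deriv d ^^ Suc J) A"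
    by (simp add: f dp_deriv_add dp_deriv_mult)
  moreover have "dp_deriv d g + dp_deriv d c * (dp_deriv d ^^ J) A \<in> derivative_ideal d A (Suc J)"
  proof (rule derivative_ideal_add[OF Suc.IH[OF g]])
    have "0 \<in> derivative_ideal d A J" using derivative_ideal_mult[OF g, of 0] by simp
    from derivative_ideal_SucI[OF this]
    show "dp_deriv d c * (dp_deriv d ^^ J) A \<in> derivative_ideal d A (Suc J)" by simp
  qed
  ultimately show ?case using derivative_ideal_SucI by metis
qed

text \<open>
  Differentiation leads from one ideal of the chain to the next, so the union of the chain is a
  differential ideal.
\<close>

lemma diff_ideal_hull_derivative_ideal:
  assumes "f \<in> diff_ideal d hull {A}"
  shows "\<exists>J. f \<in> derivative_ideal d A J"
proof -
  let ?Z = "\<Union>J. derivative_ideal d A J"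
  have "diff_ideal d ?Z"
    unfolding diff_ideal_def
  proof (intro conjI ballI allI)
    show "0 \<in> ?Z" using derivative_ideal.simps(1)[of d A] by blast
    show "dp_deriv d f \<in> ?Z" if f: "f \<in> ?Z" for f
      using f derivative_ideal_deriv[of f A] by blast
    show "h * f \<in> ?Z" if f: "f \<in> ?Z" for f h
      using f derivative_ideal_mult[of f d A _ h] by blast
    show "f + g \<in> ?Z" if fg: "f \<in> ?Z" "g \<in> ?Z" for f g
    proof -
      obtain J J' where "f \<in> derivative_ideal d A J" "g \<in> derivative_ideal d A J'" using fg by blast
      then have "f \<in> derivative_ideal d A (max J J')" "g \<in> derivative_ideal d A (max J J')"
        using derivative_ideal_mono[of J "max J J'" d A] derivative_ideal_mono[of J' "max J J'" d A] by auto
      then have "f + g \<in> derivative_ideal d A (max J J')" by (rule derivative_ideal_add)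
      then show ?thesis by blast
    qed
  qed
  moreover have "A \<in> derivative_ideal d A (Suc 0)"
    using derivative_ideal_SucI[of 0 d A 0 1] by simp
  then have "{A} \<subseteq> ?Z" by blast
  ultimately have "diff_ideal d hull {A} \<subseteq> ?Z" by (intro hull_minimal)
  then show ?thesis using assms by blast
qed

end

text \<open>
  Pseudo-division by \<open>B\<close>, which is linear in \<open>v\<close> with leading coefficient \<open>S\<close>, removes \<open>v\<close> from the
  coefficients of a combination of generators that are free of \<open>v\<close> themselves.
\<close>

lemma pseudo_divide_linear:
  fixes c B S T :: "('w::linorder, 'a::idom) dpoly"
  assumes B: "B = S * pvar v + T" and "v \<notin> dp_vars S" "v \<notin> dp_vars T" "S \<noteq> 0"
  shows "in_var v B = [:T, S:]" "\<exists>N q r. S ^ N * c = q * B + r \<and> v \<notin> dp_vars r"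
proof -
  interpret comm_ring_hom "in_var v :: ('w, 'a) dpoly \<Rightarrow> _" by (rule comm_ring_hom_in_var)
  have "in_var v (pvar v :: ('w, 'a) dpoly) = [:0, 1:]"
    unfolding in_var_def by (simp add: comm_ring_hom.ev_pvar[OF comm_ring_hom_in_var_coeff])
  then show inB: "in_var v B = [:T, S:]"
    using assms by (simp add: hom_add hom_mult in_var_free)
  let ?U = "(dp_vars c \<union> dp_vars B) - {v}"
  have "B \<noteq> 0" using inB assms(4) by auto
  then obtain N q r where "lead_coeff (in_var v B) ^ N * c = q * B + r"
    and dr: "r = 0 \<or> dp_degree_in v r < dp_degree_in v B"
    using dp_pseudo_division[of c v ?U B] by blast
  moreover have "v \<notin> dp_vars r"
    using dr assms(4) inB by (auto simp: dp_degree_in_eq_degree simp flip: dp_degree_in_pos_iff)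
  moreover have "lead_coeff (in_var v B) = S" using inB assms(4) by simp
  ultimately show "\<exists>N q r. S ^ N * c = q * B + r \<and> v \<notin> dp_vars r" by auto
qed

lemma derivative_ideal_eliminate:
  fixes A B S T :: "('w::linorder, 'a::idom) dpoly"
  assumes B: "B = S * pvar v + T" "v \<notin> dp_vars S" "v \<notin> dp_vars T" "S \<noteq> 0"
    and free: "\<And>i. i < J \<Longrightarrow> v \<notin> dp_vars ((dp_deriv d ^^ i) A)"
    and "g \<in> derivative_ideal d A J"
  shows "\<exists>N q g'. S ^ N * g = q * B + g' \<and> g' \<in> derivative_ideal d A J \<and> v \<notin> dp_vars g'"
  using free assms(6)
proof (induction J arbitrary: g)
  case 0
  then show ?case by (intro exI[of _ 0] exI[of _ 0] exI[of _ 0]) simp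
next
  case (Suc J)
  let ?A = "(dp_deriv d ^^ J) A"
  from Suc.prems(2) obtain h c where g: "g = h + c * ?A" and h: "h \<in> derivative_ideal d A J" by auto
  obtain N q h' where IH: "S ^ N * h = q * B + h'" "h' \<in> derivative_ideal d A J" "v \<notin> dp_vars h'"
    using Suc.IH[OF _ h] Suc.prems(1) by auto
  obtain M p s where c: "S ^ M * c = p * B + s" "v \<notin> dp_vars s"
    using pseudo_divide_linear(2)[OF B] by blast
  have "S ^ (N + M) * g = S ^ M * (S ^ N * h) + S ^ N * (S ^ M * c) * ?A"
    by (simp add: g power_add algebra_simps)
  also have "\<dots> = (S ^ M * q + S ^ N * p * ?A) * B + (S ^ M * h' + S ^ N * s * ?A)"
    unfolding IH(1) c(1) by (simp add: algebra_simps)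
  finally have "S ^ (N + M) * g = (S ^ M * q + S ^ N * p * ?A) * B + (S ^ M * h' + S ^ N * s * ?A)" .
  moreover have "S ^ M * h' + S ^ N * s * ?A \<in> derivative_ideal d A (Suc J)"
    by (intro derivative_ideal_SucI derivative_ideal_mult IH(2))
  moreover have "v \<notin> dp_vars (S ^ M * h' + S ^ N * s * ?A)"
  proof -
    have "dp_vars (S ^ M * h' + S ^ N * s * ?A) \<subseteq> dp_vars S \<union> dp_vars h' \<union> dp_vars s \<union> dp_vars ?A"
      using dp_vars_add[of "S ^ M * h'" "S ^ N * s * ?A"] dp_vars_mult[of "S ^ M" h']
        dp_vars_mult[of "S ^ N * s" ?A] dp_vars_mult[of "S ^ N" s] dp_vars_power[of S M] dp_vars_power[of S N]
      by blast
    then show ?thesis using B(2) IH(3) c(2) Suc.prems(1)[of J] by auto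
  qed
  ultimately show ?case by blast
qed

text \<open>
  Proper derivatives of the leader can be removed one after the other, from the highest one
  downwards, because none of them occurs in \<open>f\<close>.
\<close>

lemma partially_reduced_descent:
  fixes A f :: "('w::linorder, 'a::idom) dpoly"
  assumes "derivation_ring d" and r: "ranking r" and ne: "dp_vars A \<noteq> {}" and lead: "leader r A = (w, k)"
    and S: "separant r A \<noteq> 0" and f: "\<And>j. (w, k + Suc j) \<notin> dp_vars f"
    and "separant r A ^ m * f \<in> derivative_ideal d A (Suc J)"
  shows "\<exists>m. A dvd separant r A ^ m * f"
  using assms(7)
proof (induction J arbitrary: m)
  case 0
  then show ?case using derivative_ideal_1[of _ d A] by blast
next
  case (Suc J)
  interpret derivation_ring d by fact
  let ?S = "separant r A" and ?v = "(w, k + Suc J)" and ?B = "(dp_deriv d ^^ Suc J) A"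
  have less: "((w, k + i), ?v) \<in> r" if "i < Suc J" for i
    using ranking_less[OF r] that by simp
  have A: "v' = (w, k) \<or> (v', (w, k)) \<in> r" if "v' \<in> dp_vars A" for v'
    using leader_props(2)[OF r ne that] lead by auto
  have free0: "?v \<notin> dp_vars A"
    using A[of ?v] less[of 0] ranking_trans[OF r, of ?v "(w, k)" ?v] ranking_irrefl[OF r, of ?v] by auto
  have free: "?v \<notin> dp_vars ((dp_deriv d ^^ i) A)" if "i < Suc J" for i
  proof (cases i)
    case 0
    then show ?thesis using free0 by simp
  next
    case (Suc i')
    obtain T where T: "(dp_deriv d ^^ i) A = ?S * pvar (w, k + i) + T" "dp_vars T \<subseteq> below r (w, k + i)"
      using proper_derivative_form[OF r ne lead, of i'] Suc by auto
    have "?v \<notin> dp_vars T"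
      using T(2) less[OF that] ranking_trans[OF r, of ?v "(w, k + i)" ?v] ranking_irrefl[OF r, of ?v]
      by (auto simp: below_def)
    moreover have "?v \<notin> dp_vars ?S" using free0 dp_vars_pdiff[of "leader r A" A] by (auto simp: separant_def)
    ultimately show ?thesis
      using T(1) dp_vars_add[of "?S * pvar (w, k + i)" T] dp_vars_mult[of ?S "pvar (w, k + i)"] that by auto
  qed
  obtain T where B: "?B = ?S * pvar ?v + T" and T: "dp_vars T \<subseteq> below r ?v"
    using proper_derivative_form[OF r ne lead, of J] by blast
  have vT: "?v \<notin> dp_vars T" using T ranking_irrefl[OF r] by (auto simp: below_def)
  have vS: "?v \<notin> dp_vars ?S" using free0 dp_vars_pdiff[of "leader r A" A] by (auto simp: separant_def)
  from Suc.prems obtain g c where g: "g \<in> derivative_ideal d A (Suc J)" and eq: "?S ^ m * f = g + c * ?B"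
    unfolding derivative_ideal.simps(2)[of d A "Suc J"] by blast
  obtain N q g' where g': "?S ^ N * g = q * ?B + g'" "g' \<in> derivative_ideal d A (Suc J)" "?v \<notin> dp_vars g'"
    using derivative_ideal_eliminate[OF B vS vT S free g] by blast
  \<comment> \<open>the left side is free of \<open>?v\<close>, while a nonzero multiple of \<open>?B\<close> is not: so both sides vanish\<close>
  have eq': "?S ^ (N + m) * f - g' = (q + ?S ^ N * c) * ?B"
  proof -
    have "?S ^ (N + m) * f = ?S ^ N * (?S ^ m * f)" by (simp add: power_add mult.assoc)
    also have "\<dots> = ?S ^ N * g + ?S ^ N * c * ?B" unfolding eq by (simp add: algebra_simps)
    finally show ?thesis unfolding g'(1) by (simp add: algebra_simps)
  qed
  have "dp_vars (?S ^ (N + m) * f - g') \<subseteq> dp_vars ?S \<union> dp_vars f \<union> dp_vars g'"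
    using dp_vars_diff[of "?S ^ (N + m) * f" g'] dp_vars_mult[of "?S ^ (N + m)" f] dp_vars_power[of ?S "N + m"] by blast
  then have "?v \<notin> dp_vars (?S ^ (N + m) * f - g')" using vS f g'(3) by blast
  then have deg0: "dp_degree_in ?v ((q + ?S ^ N * c) * ?B) = 0"
    unfolding eq' dp_degree_in_eq_0_iff .
  have deg1: "dp_degree_in ?v ?B = 1"
    unfolding dp_degree_in_eq_degree pseudo_divide_linear(1)[OF B vS vT S] using S by simp
  then have "?B \<noteq> 0" by (auto simp: dp_degree_in_def)
  then have "q + ?S ^ N * c = 0"
    using deg0 deg1 dp_degree_in_mult[of "q + ?S ^ N * c" ?B ?v] by (cases "q + ?S ^ N * c = 0") auto
  then have "?S ^ (N + m) * f = g'" using eq' by simp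
  then show ?case using Suc.IH g'(2) by metis
qed

text \<open>
  The power of the separant can be cancelled because \<open>A\<close> is prime and has a larger degree in its
  leader than its separant.
\<close>

theorem irreducible_dvd_partially_reduced:
  fixes A f :: "('w::linorder, 'a::field) dpoly"
  assumes d: "derivation_ring d" and r: "ranking r" and irr: "dp_irreducible A" and ne: "dp_vars A \<noteq> {}"
    and S: "separant r A \<noteq> 0" and lead: "leader r A = (w, k)" and f: "\<And>j. (w, k + Suc j) \<notin> dp_vars f"
    and sat: "f \<in> sat d r A"
  shows "A dvd f"
proof -
  obtain m where "separant r A ^ m * f \<in> diff_ideal d hull {A}" using sat by (auto simp: sat_def)
  then obtain J where J: "separant r A ^ m * f \<in> derivative_ideal d A J"
    using derivation_ring.diff_ideal_hull_derivative_ideal[OF d] by blast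
  then obtain m where m: "A dvd separant r A ^ m * f"
    using partially_reduced_descent[OF d r ne lead S f derivative_ideal_Suc[OF J]] by blast
  have nS: "\<not> A dvd separant r A"
  proof
    assume "A dvd separant r A"
    then have "dp_degree_in (w, k) A \<le> dp_degree_in (w, k) (separant r A)" using S by (rule dp_degree_in_dvd)
    moreover have "dp_degree_in (w, k) (separant r A) < dp_degree_in (w, k) A"
      unfolding separant_def lead using leader_props(1)[OF r ne] lead by (intro dp_degree_in_pdiff_less) simp
    ultimately show False by simp
  qed
  show ?thesis using m
  proof (induction m)
    case (Suc m)
    then have "A dvd separant r A * (separant r A ^ m * f)" by (simp add: mult.assoc)
    then show ?case using dp_irreducible_dvd_mult[OF irr] nS Suc.IH by blast
  qed simp
qed

section \<open>Linear differential operators\<close>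

interpretation poly_vs: vector_space "smult :: 'e::field \<Rightarrow> 'e poly \<Rightarrow> 'e poly"
  by unfold_locales (simp_all add: smult_add_right smult_add_left)

lemma poly_span_minimal:
  assumes "x \<in> poly_vs.span S" "poly_vs.subspace M" "\<And>y. y \<in> S \<Longrightarrow> y \<in> M"
  shows "x \<in> M"
  using poly_vs.span_minimal[of S M] assms by auto

text \<open>
  The polynomial \<open>\<Sum>i. p\<^sub>i X\<^sup>i\<close> encodes the operator \<open>\<Sum>i. p\<^sub>i D\<^sup>i\<close>. Composition with \<open>D\<close> on the left is
  \<open>dshift D\<close>, and composition with the operator \<open>C\<close> on the left is \<open>op_apply D C\<close>.
\<close>

definition dshift :: "('e::comm_ring_1 \<Rightarrow> 'e) \<Rightarrow> 'e poly \<Rightarrow> 'e poly" where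
  "dshift D p = pCons 0 p + map_poly D p"

definition op_apply :: "('e::comm_ring_1 \<Rightarrow> 'e) \<Rightarrow> 'e poly \<Rightarrow> 'e poly \<Rightarrow> 'e poly" where
  "op_apply D C p = (\<Sum>k\<le>degree C. smult (coeff C k) ((dshift D ^^ k) p))"

lemma smult_sum_right: "smult c (sum f S) = (\<Sum>i\<in>S. smult c (f i))"
  by (induction S rule: infinite_finite_induct) (simp_all add: smult_add_right)

context derivation_ring
begin

lemma coeff_dshift: "coeff (dshift d p) i = d (coeff p i) + (if i = 0 then 0 else coeff p (i - 1))"
  by (cases i) (simp_all add: dshift_def coeff_map_poly)

lemma dshift_add: "dshift d (p + q) = dshift d p + dshift d q"
  by (rule poly_eqI) (simp add: coeff_dshift d_add)

lemma dshift_smult: "dshift d (smult c p) = smult c (dshift d p) + smult (d c) p"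
  by (rule poly_eqI) (simp add: coeff_dshift d_mult algebra_simps)

lemma dshift_0 [simp]: "dshift d 0 = 0"
  by (simp add: dshift_def)

lemma dshift_iterate_0 [simp]: "(dshift d ^^ k) 0 = 0"
  by (induction k) simp_all

lemma dshift_monom: "dshift d (monom 1 k) = monom 1 (Suc k)"
  by (rule poly_eqI) (auto simp: coeff_dshift)

lemma degree_dshift:
  assumes "p \<noteq> 0"
  shows "degree (dshift d p) = Suc (degree p)" "dshift d p \<noteq> 0"
proof -
  have "coeff (dshift d p) (Suc (degree p)) = lead_coeff p"
    by (simp add: coeff_dshift coeff_eq_0)
  moreover have "degree (dshift d p) \<le> Suc (degree p)"
    by (rule degree_le) (auto simp: coeff_dshift coeff_eq_0)
  ultimately show "degree (dshift d p) = Suc (degree p)" "dshift d p \<noteq> 0"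
    using assms by (auto intro!: antisym le_degree)
qed

lemma degree_dshift_iterate:
  assumes "p \<noteq> 0"
  shows "degree ((dshift d ^^ k) p) = degree p + k" "(dshift d ^^ k) p \<noteq> 0"
  using assms by (induction k) (simp_all add: degree_dshift)

lemma op_apply_superset:
  assumes "degree C \<le> n"
  shows "op_apply d C p = (\<Sum>k\<le>n. smult (coeff C k) ((dshift d ^^ k) p))"
  unfolding op_apply_def using assms by (intro sum.mono_neutral_left) (auto simp: coeff_eq_0)

lemma op_apply_add: "op_apply d (B + C) p = op_apply d B p + op_apply d C p"
  using degree_add_le_max[of B C]
  by (simp add: op_apply_superset[of _ "max (degree B) (degree C)"] smult_add_left sum.distrib)

lemma op_apply_smult: "op_apply d (smult c C) p = smult c (op_apply d C p)"
  using degree_smult_le[of c C]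
  by (simp add: op_apply_superset[of _ "degree C"] smult_sum_right)

lemma op_apply_0 [simp]: "op_apply d 0 p = 0"
  by (simp add: op_apply_def)

lemma op_apply_monom: "op_apply d (monom 1 k) p = (dshift d ^^ k) p"
proof -
  have "(\<Sum>i\<le>k. smult (coeff (monom 1 k) i) ((dshift d ^^ i) p)) =
      (\<Sum>i\<le>k. if i = k then (dshift d ^^ k) p else 0)"
    by (intro sum.cong) auto
  then show ?thesis by (simp add: op_apply_superset[of _ k] degree_monom_le)
qed

end

lemma degree_op_apply:
  fixes C p :: "'e::field poly"
  assumes "derivation_ring D" "C \<noteq> 0" "p \<noteq> 0"
  shows "op_apply D C p \<noteq> 0" "degree (op_apply D C p) = degree C + degree p"
proof -
  interpret derivation_ring D by fact
  let ?n = "degree C + degree p"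
  have small: "coeff (smult (coeff C k) ((dshift D ^^ k) p)) ?n = 0" if "k < degree C" for k
    using that assms(3) by (simp add: coeff_eq_0 degree_dshift_iterate)
  have "coeff (op_apply D C p) ?n = (\<Sum>k\<in>{degree C}. coeff (smult (coeff C k) ((dshift D ^^ k) p)) ?n)"
    unfolding op_apply_def coeff_sum
    by (rule sum.mono_neutral_right) (use small le_neq_implies_less in auto)
  also have "\<dots> = lead_coeff C * lead_coeff ((dshift D ^^ degree C) p)"
    using assms(3) by (simp add: degree_dshift_iterate add.commute)
  also have "\<dots> \<noteq> 0"
    by (intro no_zero_divisors leading_coeff_neq_0 assms degree_dshift_iterate)
  finally have top: "coeff (op_apply D C p) ?n \<noteq> 0" .
  then show "op_apply D C p \<noteq> 0" by auto
  have "degree (op_apply D C p) \<le> ?n"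
    unfolding op_apply_def using assms(3)
    by (intro degree_sum_le) (auto simp: degree_dshift_iterate intro!: order_trans[OF degree_smult_le])
  then show "degree (op_apply D C p) = ?n" using top by (intro antisym le_degree)
qed

text \<open>\<open>p\<close> and \<open>q\<close> generate the unit left ideal of the ring of differential operators.\<close>

definition right_coprime :: "('e::field \<Rightarrow> 'e) \<Rightarrow> 'e poly \<Rightarrow> 'e poly \<Rightarrow> bool" where
  "right_coprime D p q \<longleftrightarrow>
     (\<forall>N. poly_vs.subspace N \<longrightarrow> dshift D ` N \<subseteq> N \<longrightarrow> p \<in> N \<longrightarrow> q \<in> N \<longrightarrow> 1 \<in> N)"

lemma right_coprime_commute: "right_coprime D p q \<longleftrightarrow> right_coprime D q p"
  by (auto simp: right_coprime_def)

lemma right_coprime_smult: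
  assumes "a \<noteq> 0" "b \<noteq> 0"
  shows "right_coprime D (smult a p) (smult b q) \<longleftrightarrow> right_coprime D p q"
proof -
  have "smult c p \<in> N \<longleftrightarrow> p \<in> N" if "poly_vs.subspace N" "c \<noteq> 0" for c p N
    using poly_vs.subspace_scale[OF that(1), of "smult c p" "inverse c"]
      poly_vs.subspace_scale[OF that(1), of p c] that(2) by auto
  then show ?thesis using assms unfolding right_coprime_def by metis
qed

lemma independent_monoms: "poly_vs.independent (monom (1::'e::field) ` {..<n})"
proof -
  have inj: "inj_on (monom (1::'e)) {..<n}"
    by (rule inj_on_inverseI[of _ degree]) (simp add: Polynomial.degree_monom_eq)
  have "u (monom 1 i) = 0"
    if "(\<Sum>v\<in>monom (1::'e) ` {..<n}. smult (u v) v) = 0" "i < n" for u i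
  proof -
    have "0 = coeff (\<Sum>j<n. smult (u (monom 1 j)) (monom 1 j)) i"
      using that(1) by (simp add: sum.reindex[OF inj])
    also have "\<dots> = (\<Sum>j<n. if j = i then u (monom 1 j) else 0)"
      unfolding coeff_sum by (intro sum.cong) auto
    finally show ?thesis using that(2) by simp
  qed
  then show ?thesis by (subst poly_vs.dependent_finite) auto
qed

text \<open>
  The relation expresses the derivatives of \<open>p\<close> from order \<open>degree C\<close> on by lower ones and by
  derivatives of \<open>q\<close>. The remaining derivatives of \<open>p\<close> and those of \<open>q\<close> still span all operators,
  and counting dimensions in a large degree gives the bound.
\<close>

theorem right_coprime_relation_degree:
  fixes p q C C' :: "'e::field poly"
  assumes D: "derivation_ring D" and cop: "right_coprime D p q" and "q \<noteq> 0"
    and rel: "op_apply D C p + op_apply D C' q = 0" and "C \<noteq> 0"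
  shows "degree q \<le> degree C"
proof -
  interpret derivation_ring D by fact
  let ?T = "dshift D" and ?c = "degree C"
  let ?P = "(\<lambda>i. (?T ^^ i) p) ` {..<?c}"
  define Q where "Q n = (\<lambda>k. (?T ^^ k) q) ` {..<n}" for n
  define N where "N = poly_vs.span (?P \<union> range (\<lambda>k. (?T ^^ k) q))"
  have subN: "poly_vs.subspace N" unfolding N_def by simp
  have qN: "(?T ^^ k) q \<in> N" for k unfolding N_def by (intro poly_vs.span_base) auto
  have pN: "(?T ^^ i) p \<in> N" if "i < ?c" for i
    unfolding N_def using that by (intro poly_vs.span_base) auto
  have opq: "op_apply D B q \<in> N" for B
    unfolding op_apply_def by (intro poly_vs.subspace_sum subN poly_vs.subspace_scale qN)
  have "smult (lead_coeff C) ((?T ^^ ?c) p) =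
      - (\<Sum>k<?c. smult (coeff C k) ((?T ^^ k) p)) - op_apply D C' q"
    using rel unfolding op_apply_def[of D C] lessThan_Suc_atMost[symmetric] sum.lessThan_Suc
    by (simp add: algebra_simps eq_neg_iff_add_eq_0)
  also have "\<dots> \<in> N"
    using pN opq
    by (intro poly_vs.subspace_diff poly_vs.subspace_neg poly_vs.subspace_sum poly_vs.subspace_scale subN) auto
  finally have "smult (inverse (lead_coeff C)) (smult (lead_coeff C) ((?T ^^ ?c) p)) \<in> N"
    by (rule poly_vs.subspace_scale[OF subN])
  moreover have "smult (inverse (lead_coeff C)) (smult (lead_coeff C) x) = x" for x
    by (simp only: smult_smult smult_1_left
        division_ring_class.left_inverse[OF leading_coeff_neq_0[OF \<open>C \<noteq> 0\<close>]])
  ultimately have pc: "(?T ^^ ?c) p \<in> N" by (simp only:)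
  have pN': "(?T ^^ i) p \<in> N" if "i \<le> ?c" for i
  proof (cases "i = ?c")
    case True
    then show ?thesis using pc by (simp only:)
  next
    case False
    then show ?thesis using that by (intro pN) simp
  qed
  have shN: "?T x \<in> N" if "x \<in> N" for x
  proof -
    have "x \<in> poly_vs.span (?P \<union> range (\<lambda>k. (?T ^^ k) q))" using that unfolding N_def .
    then have "x \<in> {x \<in> N. ?T x \<in> N}"
    proof (rule poly_span_minimal)
      show "poly_vs.subspace {x \<in> N. ?T x \<in> N}"
        by (auto simp: poly_vs.subspace_def dshift_add dshift_smult
            intro!: poly_vs.subspace_add poly_vs.subspace_scale poly_vs.subspace_0 subN)
      fix x assume "x \<in> ?P \<union> range (\<lambda>k. (?T ^^ k) q)"
      then show "x \<in> {x \<in> N. ?T x \<in> N}"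
      proof
        assume "x \<in> ?P"
        then obtain i where i: "x = (?T ^^ i) p" "i \<in> {..<?c}" by (rule imageE)
        have "(?T ^^ Suc i) p \<in> N" by (rule pN') (use i(2) in simp)
        moreover have "(?T ^^ i) p \<in> N" by (rule pN') (use i(2) in simp)
        ultimately show ?thesis unfolding i(1) by simp
      next
        assume "x \<in> range (\<lambda>k. (?T ^^ k) q)"
        then obtain k where k: "x = (?T ^^ k) q" by (rule rangeE)
        show ?thesis using qN[of k] qN[of "Suc k"] unfolding k by simp
      qed
    qed
    then show ?thesis by simp
  qed
  have "p \<in> N" using pN'[of 0] by simp
  moreover have "q \<in> N" using qN[of 0] by simp
  moreover have "?T ` N \<subseteq> N" using shN by blast
  ultimately have "1 \<in> N" using cop subN unfolding right_coprime_def by blast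
  \<comment> \<open>so all operators are combinations of the generators of \<open>N\<close>; those of degree less than \<open>n\<close>
    need only the finitely many generators of degree less than \<open>n\<close>\<close>
  have monN: "monom 1 k \<in> N" for k
  proof (induction k)
    case 0
    then show ?case using \<open>1 \<in> N\<close> by (simp add: one_pCons monom_0)
  next
    case (Suc k)
    then show ?case using shN[of "monom 1 k"] by (simp add: dshift_monom)
  qed
  \<comment> \<open>large enough for all derivatives of \<open>p\<close> that remain\<close>
  define n where "n = degree p + ?c + degree q"
  have bounded: "x \<in> poly_vs.span (?P \<union> Q (n - degree q))" if x: "x \<in> N" "degree x < n" for x
  proof -
    obtain a b where ab: "x = a + b" "a \<in> poly_vs.span ?P" "b \<in> poly_vs.span (range (\<lambda>k. (?T ^^ k) q))"
      using x(1) unfolding N_def poly_vs.span_Un by auto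
    have "a \<in> {a. a = 0 \<or> degree a < n}" using ab(2)
    proof (rule poly_span_minimal)
      show "poly_vs.subspace {a::'e poly. a = 0 \<or> degree a < n}"
      proof (rule poly_vs.subspaceI)
        fix a b :: "'e poly" assume "a \<in> {a. a = 0 \<or> degree a < n}" "b \<in> {a. a = 0 \<or> degree a < n}"
        then show "a + b \<in> {a. a = 0 \<or> degree a < n}" by (auto intro: degree_add_less)
      qed (auto intro: le_less_trans[OF degree_smult_le])
      fix a assume "a \<in> ?P"
      then obtain i where "i < ?c" "a = (?T ^^ i) p" by auto
      then show "a \<in> {a. a = 0 \<or> degree a < n}"
        by (cases "p = 0") (auto simp: degree_dshift_iterate n_def)
    qed
    then have "b = 0 \<or> degree b < n"
      using x(2) degree_diff_less[of x n a] ab(1) by (cases "a = 0") (auto simp: algebra_simps)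
    have "b \<in> range (\<lambda>B. op_apply D B q)" using ab(3)
    proof (rule poly_span_minimal)
      show "poly_vs.subspace (range (\<lambda>B. op_apply D B q))"
      proof (rule poly_vs.subspaceI)
        show "0 \<in> range (\<lambda>B. op_apply D B q)" by (rule range_eqI[of _ _ 0]) simp
      next
        fix a b assume "a \<in> range (\<lambda>B. op_apply D B q)" "b \<in> range (\<lambda>B. op_apply D B q)"
        then show "a + b \<in> range (\<lambda>B. op_apply D B q)"
          by (auto simp flip: op_apply_add)
      next
        fix a c assume "a \<in> range (\<lambda>B. op_apply D B q)"
        then show "smult c a \<in> range (\<lambda>B. op_apply D B q)"
          by (auto simp flip: op_apply_smult)
      qed
      fix a assume "a \<in> range (\<lambda>k. (?T ^^ k) q)"
      then show "a \<in> range (\<lambda>B. op_apply D B q)" by (auto simp flip: op_apply_monom)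
    qed
    then obtain B where B: "b = op_apply D B q" by auto
    have "b \<in> poly_vs.span (Q (n - degree q))"
    proof (cases "B = 0")
      case True
      then show ?thesis using B poly_vs.span_zero by simp
    next
      case False
      have "b \<noteq> 0" "degree b = degree B + degree q"
        unfolding B using degree_op_apply[OF D False \<open>q \<noteq> 0\<close>] by simp_all
      then have "degree B < n - degree q" using \<open>b = 0 \<or> degree b < n\<close> by auto
      then show ?thesis unfolding B op_apply_def Q_def
        by (intro poly_vs.span_sum poly_vs.span_scale poly_vs.span_base) auto
    qed
    then show ?thesis
      using ab(2) unfolding ab(1) poly_vs.span_Un by auto
  qed
  have "monom 1 ` {..<n} \<subseteq> poly_vs.span (?P \<union> Q (n - degree q))"
    using bounded monN by (auto simp: Polynomial.degree_monom_eq)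
  then have "card (monom (1::'e) ` {..<n}) \<le> card (?P \<union> Q (n - degree q))"
    using poly_vs.independent_span_bound[OF _ independent_monoms, of "?P \<union> Q (n - degree q)" n]
    by (simp add: Q_def)
  also have "\<dots> \<le> ?c + (n - degree q)"
    using card_Un_le[of ?P "Q (n - degree q)"] card_image_le[of "{..<?c}" "\<lambda>i. (?T ^^ i) p"]
      card_image_le[of "{..<n - degree q}" "\<lambda>i. (?T ^^ i) q"] by (simp add: Q_def)
  finally have "n \<le> ?c + (n - degree q)"
    by (subst (asm) card_image)
      (auto intro: inj_on_inverseI[of _ degree] simp: Polynomial.degree_monom_eq)
  then show ?thesis by (simp add: n_def)
qed

section \<open>Differentials of rational functions\<close>

text \<open>
  \<open>Dual g p\<close> stands for \<open>g + p \<epsilon>\<close> with \<open>\<epsilon>\<^sup>2 = 0\<close>, where \<open>X\<^sup>j\<close> in \<open>p\<close> is the differential of the \<open>j\<close>-th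
  derivative of \<open>u\<close>. Evaluating a polynomial at dual numbers computes its value together with its
  differential, so the rules for differentials are ring identities.
\<close>

(* polynomials are defined by means of the overloaded 0 *)
declare [[typedef_overloaded]]

datatype 'e dual = Dual (base: 'e) (diff: "'e poly")

instantiation dual :: (comm_ring_1) comm_ring_1
begin
definition "0 = Dual 0 0"
definition "1 = Dual 1 0"
definition "x + y = Dual (base x + base y) (diff x + diff y)"
definition "x - y = Dual (base x - base y) (diff x - diff y)"
definition "- x = Dual (- base x) (- diff x)"
definition "x * y = Dual (base x * base y) (smult (base x) (diff y) + smult (base y) (diff x))"
instance
  by standard
    (simp_all add: zero_dual_def one_dual_def plus_dual_def minus_dual_def uminus_dual_def times_dual_def
      algebra_simps smult_add_right smult_add_left)
end

lemma dual_simps [simp]: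
  fixes x y :: "'e::comm_ring_1 dual"
  shows "base (0 :: 'e dual) = 0" "diff (0 :: 'e dual) = 0"
  "base (1 :: 'e dual) = 1" "diff (1 :: 'e dual) = 0"
  "base (x + y) = base x + base y" "diff (x + y) = diff x + diff y"
  "base (x - y) = base x - base y" "diff (x - y) = diff x - diff y"
  "base (- x) = - base x" "diff (- x) = - diff x"
  "base (x * y) = base x * base y"
  "diff (x * y) = smult (base x) (diff y) + smult (base y) (diff x)"
  by (simp_all add: zero_dual_def one_dual_def plus_dual_def minus_dual_def uminus_dual_def times_dual_def)

lemma dual_eq_iff: "x = y \<longleftrightarrow> base x = base y \<and> diff x = diff y"
  by (cases x; cases y) simp

lemma comm_ring_hom_base: "comm_ring_hom (base :: 'e::comm_ring_1 dual \<Rightarrow> 'e)"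
  by standard simp_all

lemma dual_unit:
  fixes z :: "'e::field dual"
  assumes "base z \<noteq> 0"
  shows "z * Dual (inverse (base z)) (- smult (inverse (base z) ^ 2) (diff z)) = 1"
  using assms by (simp add: dual_eq_iff power2_eq_square field_simps)

definition dual_deriv :: "('e::comm_ring_1 \<Rightarrow> 'e) \<Rightarrow> 'e dual \<Rightarrow> 'e dual" where
  "dual_deriv D z = Dual (D (base z)) (dshift D (diff z))"

lemma dual_deriv_simps [simp]:
  "base (dual_deriv D z) = D (base z)" "diff (dual_deriv D z) = dshift D (diff z)"
  by (simp_all add: dual_deriv_def)

lemma dual_deriv_iterate [simp]:
  "base ((dual_deriv D ^^ k) z) = (D ^^ k) (base z)" "diff ((dual_deriv D ^^ k) z) = (dshift D ^^ k) (diff z)"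
  by (induction k) simp_all

lemma (in derivation_ring) dual_deriv_derivation: "derivation_ring (dual_deriv d)"
  by unfold_locales
    (simp_all add: dual_eq_iff d_add d_mult dshift_add dshift_smult algebra_simps)

definition dual_const :: "('f \<Rightarrow> 'e::comm_ring_1) \<Rightarrow> 'f \<Rightarrow> 'e dual" where
  "dual_const \<iota> c = Dual (\<iota> c) 0"

lemma dual_const_simps [simp]: "base (dual_const \<iota> c) = \<iota> c" "diff (dual_const \<iota> c) = 0"
  by (simp_all add: dual_const_def)

lemma comm_ring_hom_dual_const:
  assumes "comm_ring_hom \<iota>"
  shows "comm_ring_hom (dual_const \<iota>)"
proof -
  interpret comm_ring_hom \<iota> by fact
  show ?thesis by standard (simp_all add: dual_eq_iff hom_add hom_mult)
qed

lemma base_ev: "base (ev (dual_const \<iota>) x f) = ev \<iota> (\<lambda>v. base (x v)) f"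
  by (simp add: ev_compose[OF comm_ring_hom_base])

text \<open>
  The first-order Taylor formula.
\<close>

lemma diff_ev:
  fixes f :: "('w, 'a::comm_ring_1) dpoly"
  assumes "comm_ring_hom \<iota>" "finite V" "dp_vars f \<subseteq> V"
  shows "diff (ev (dual_const \<iota>) x f) =
           (\<Sum>v\<in>V. smult (ev \<iota> (\<lambda>v. base (x v)) (dp_pdiff v f)) (diff (x v)))"
proof -
  interpret comm_ring_hom \<iota> by fact
  interpret dual: comm_ring_hom "dual_const \<iota>" by (rule comm_ring_hom_dual_const) fact
  have "\<exists>W. finite W \<and> (\<forall>V. finite V \<longrightarrow> W \<subseteq> V \<longrightarrow>
      diff (ev (dual_const \<iota>) x f) =
        (\<Sum>v\<in>V. smult (ev \<iota> (\<lambda>v. base (x v)) (dp_pdiff v f)) (diff (x v))))"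
  proof (induction f rule: dpoly_induct)
    case (const c)
    then show ?case by (intro exI[of _ "{}"]) simp
  next
    case (var v)
    have "(\<Sum>w\<in>V. smult (ev \<iota> (\<lambda>v. base (x v)) (dp_pdiff w (pvar v))) (diff (x w))) =
        (\<Sum>w\<in>V. if w = v then diff (x v) else 0)" for V
      using ev_const[of "\<lambda>v. base (x v)" 1]
      by (intro sum.cong) (auto simp: dp_pdiff_pvar dp_const_def)
    then show ?case by (intro exI[of _ "{v}"]) simp
  next
    case (add f g)
    then obtain W W' where "finite W" "finite W'" and
      "\<And>V. finite V \<Longrightarrow> W \<subseteq> V \<Longrightarrow> diff (ev (dual_const \<iota>) x f) =
        (\<Sum>v\<in>V. smult (ev \<iota> (\<lambda>v. base (x v)) (dp_pdiff v f)) (diff (x v)))"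
      "\<And>V. finite V \<Longrightarrow> W' \<subseteq> V \<Longrightarrow> diff (ev (dual_const \<iota>) x g) =
        (\<Sum>v\<in>V. smult (ev \<iota> (\<lambda>v. base (x v)) (dp_pdiff v g)) (diff (x v)))"
      by blast
    then show ?case
      by (intro exI[of _ "W \<union> W'"])
        (simp add: dual.ev_add ev_add dp_pdiff_add smult_add_left sum.distrib)
  next
    case (mult f g)
    then obtain W W' where "finite W" "finite W'" and
      "\<And>V. finite V \<Longrightarrow> W \<subseteq> V \<Longrightarrow> diff (ev (dual_const \<iota>) x f) =
        (\<Sum>v\<in>V. smult (ev \<iota> (\<lambda>v. base (x v)) (dp_pdiff v f)) (diff (x v)))"
      "\<And>V. finite V \<Longrightarrow> W' \<subseteq> V \<Longrightarrow> diff (ev (dual_const \<iota>) x g) =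
        (\<Sum>v\<in>V. smult (ev \<iota> (\<lambda>v. base (x v)) (dp_pdiff v g)) (diff (x v)))"
      by blast
    then show ?case
      by (intro exI[of _ "W \<union> W'"])
        (simp add: dual.ev_mult ev_add ev_mult dp_pdiff_mult smult_add_left sum.distrib base_ev
          smult_sum_right mult_ac add_ac)
  qed
  then obtain W where W: "finite W" and
    "diff (ev (dual_const \<iota>) x f) =
      (\<Sum>v\<in>V \<union> W. smult (ev \<iota> (\<lambda>v. base (x v)) (dp_pdiff v f)) (diff (x v)))"
    using assms(2) by (meson Un_upper2 finite_UnI)
  note this(2)
  also have "\<dots> = (\<Sum>v\<in>V. smult (ev \<iota> (\<lambda>v. base (x v)) (dp_pdiff v f)) (diff (x v)))"
  proof (rule sum.mono_neutral_right)
    have "dp_pdiff v f = 0" if "v \<in> (V \<union> W) - V" for v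
      using that assms(3) by (intro dp_pdiff_free) auto
    then have "smult (ev \<iota> (\<lambda>v. base (x v)) (dp_pdiff v f)) (diff (x v)) = 0"
      if "v \<in> (V \<union> W) - V" for v
      using that by (simp only: ev_zero smult_0_left)
    then show "\<forall>v\<in>(V \<union> W) - V. smult (ev \<iota> (\<lambda>v. base (x v)) (dp_pdiff v f)) (diff (x v)) = 0"
      by blast
  qed (use assms(2) W(1) in auto)
  finally show ?thesis .
qed

locale transcendental_extension =
  \<delta>: derivation_ring \<delta> + D: derivation_ring D + \<iota>: comm_ring_hom \<iota>
  for \<delta> :: "'f::field \<Rightarrow> 'f" and D :: "'e::field \<Rightarrow> 'e" and \<iota> :: "'f \<Rightarrow> 'e" +
  fixes u :: 'e
  assumes \<iota>_\<delta>: "D (\<iota> c) = \<iota> (\<delta> c)" and transcendental: "diff_transcendental \<iota> D u"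
begin

sublocale dual: comm_ring_hom "dual_const \<iota>"
  by (rule comm_ring_hom_dual_const) (rule \<iota>.comm_ring_hom_axioms)

sublocale \<Delta>: derivation_ring "dual_deriv D"
  by (rule D.dual_deriv_derivation)

lemma dual_const_\<delta>: "dual_deriv D (dual_const \<iota> c) = dual_const \<iota> (\<delta> c)"
  by (simp add: dual_eq_iff \<iota>_\<delta>)

definition at_u :: "(unit, 'f) dpoly \<Rightarrow> 'e" where
  "at_u f = dp_eval \<iota> D (\<lambda>_. u) f"

definition at_du :: "(unit, 'f) dpoly \<Rightarrow> 'e dual" where
  "at_du f = dp_eval (dual_const \<iota>) (dual_deriv D) (\<lambda>_. Dual u 1) f"

sublocale at_u: comm_ring_hom at_u
  unfolding at_u_def dp_eval_ev by (rule \<iota>.ev_comm_ring_hom)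

sublocale at_du: comm_ring_hom at_du
  unfolding at_du_def dp_eval_ev by (rule dual.ev_comm_ring_hom)

lemma at_u_eq_0_iff: "at_u f = 0 \<longleftrightarrow> f = 0"
  using transcendental at_u.hom_zero unfolding diff_transcendental_def at_u_def by blast

lemma base_dp_eval: "base (dp_eval (dual_const \<iota>) (dual_deriv D) a f) = dp_eval \<iota> D (\<lambda>w. base (a w)) f"
  by (simp add: dp_eval_ev base_ev case_prod_unfold)

lemma base_at_du [simp]: "base (at_du f) = at_u f"
  by (simp add: at_du_def base_dp_eval at_u_def)

lemma at_du_deriv: "dual_deriv D (at_du f) = at_du (dp_deriv \<delta> f)"
  unfolding at_du_def
  by (rule \<delta>.dp_eval_deriv[OF dual.comm_ring_hom_axioms \<Delta>.derivation_ring_axioms dual_const_\<delta>])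

text \<open>
  The graph of the universal differential on the field of differential rational functions of \<open>u\<close>:
  it sends \<open>g\<close> to \<open>\<Sum>j. (\<partial>g / \<partial>u\<^sup>(\<^sup>j\<^sup>)) X\<^sup>j\<close>, so that \<open>u\<close> itself is sent to \<open>1\<close>.
\<close>

definition differentials :: "'e dual set" where
  "differentials = {z. \<exists>P Q. at_u Q \<noteq> 0 \<and> z * at_du Q = at_du P}"

lemma differentialsI: "at_u Q \<noteq> 0 \<Longrightarrow> z * at_du Q = at_du P \<Longrightarrow> z \<in> differentials"
  by (auto simp: differentials_def)

lemma differentialsE:
  assumes "z \<in> differentials"
  obtains P Q where "at_u Q \<noteq> 0" "z * at_du Q = at_du P"
  using assms by (auto simp: differentials_def)

lemma differentials_at_du: "at_du P \<in> differentials"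
  by (rule differentialsI[of 1]) (simp_all add: at_u.hom_one at_du.hom_one)

lemma at_du_const: "at_du (dp_const c) = dual_const \<iota> c"
  unfolding at_du_def dp_eval_ev by (rule dual.ev_const)

lemma at_du_u: "at_du (pvar ((), 0)) = Dual u 1"
  unfolding at_du_def dp_eval_ev by (simp add: dual.ev_pvar)

lemma differentials_const: "dual_const \<iota> c \<in> differentials"
  using differentials_at_du[of "dp_const c"] by (simp add: at_du_const)

lemma differentials_u: "Dual u 1 \<in> differentials"
  using differentials_at_du[of "pvar ((), 0)"] by (simp add: at_du_u)

lemma differentials_add:
  assumes "x \<in> differentials" "y \<in> differentials"
  shows "x + y \<in> differentials"
proof -
  obtain P Q where x: "at_u Q \<noteq> 0" "x * at_du Q = at_du P" using assms(1) by (rule differentialsE)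
  obtain P' Q' where y: "at_u Q' \<noteq> 0" "y * at_du Q' = at_du P'" using assms(2) by (rule differentialsE)
  have "(x + y) * at_du (Q * Q') = (x * at_du Q) * at_du Q' + (y * at_du Q') * at_du Q"
    by (simp only: at_du.hom_mult ring_distribs mult_ac)
  also have "\<dots> = at_du (P * Q' + P' * Q)"
    by (simp add: x y at_du.hom_mult at_du.hom_add)
  finally show ?thesis using x y by (intro differentialsI) (auto simp: at_u.hom_mult)
qed

lemma differentials_mult:
  assumes "x \<in> differentials" "y \<in> differentials"
  shows "x * y \<in> differentials"
proof -
  obtain P Q where x: "at_u Q \<noteq> 0" "x * at_du Q = at_du P" using assms(1) by (rule differentialsE)
  obtain P' Q' where y: "at_u Q' \<noteq> 0" "y * at_du Q' = at_du P'" using assms(2) by (rule differentialsE)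
  have "(x * y) * at_du (Q * Q') = (x * at_du Q) * (y * at_du Q')"
    by (simp only: at_du.hom_mult mult_ac)
  also have "\<dots> = at_du (P * P')" by (simp add: x y at_du.hom_mult)
  finally show ?thesis using x y by (intro differentialsI) (auto simp: at_u.hom_mult)
qed

lemma differentials_diff:
  assumes "x \<in> differentials" "y \<in> differentials"
  shows "x - y \<in> differentials"
proof -
  have "dual_const \<iota> (- 1) = - 1" by (simp add: dual_eq_iff \<iota>.hom_uminus)
  then have "x - y = x + dual_const \<iota> (- 1) * y" by simp
  also have "\<dots> \<in> differentials"
    by (intro differentials_add differentials_mult differentials_const assms)
  finally show ?thesis .
qed

lemma differentials_inverse:
  assumes "x \<in> differentials" "x * y = 1"
  shows "y \<in> differentials"
proof -
  obtain P Q where x: "at_u Q \<noteq> 0" "x * at_du Q = at_du P" using assms(1) by (rule differentialsE)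
  have "base x * base y = 1" using arg_cong[OF assms(2), of base] by simp
  then have "base x \<noteq> 0" by auto
  moreover have "base x * at_u Q = at_u P" using arg_cong[OF x(2), of base] by simp
  ultimately have "at_u P \<noteq> 0" using x(1) by (metis mult_eq_0_iff)
  moreover have "y * at_du P = at_du Q"
  proof -
    have "y * at_du P = (x * y) * at_du Q" by (simp only: x(2)[symmetric] mult_ac)
    then show ?thesis using assms(2) by simp
  qed
  ultimately show ?thesis by (rule differentialsI)
qed

lemma differentials_deriv:
  assumes "x \<in> differentials"
  shows "dual_deriv D x \<in> differentials"
proof -
  obtain P Q where x: "at_u Q \<noteq> 0" "x * at_du Q = at_du P" using assms by (rule differentialsE)
  have "dual_deriv D x * at_du Q + x * at_du (dp_deriv \<delta> Q) = at_du (dp_deriv \<delta> P)"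
    using arg_cong[OF x(2), of "dual_deriv D"] by (simp add: \<Delta>.d_mult at_du_deriv)
  then have "dual_deriv D x * at_du Q = at_du (dp_deriv \<delta> P) - x * at_du (dp_deriv \<delta> Q)"
    by (simp add: algebra_simps)
  then have "dual_deriv D x * at_du Q * at_du Q = (at_du (dp_deriv \<delta> P) - x * at_du (dp_deriv \<delta> Q)) * at_du Q"
    by (simp only:)
  also have "\<dots> = at_du (dp_deriv \<delta> P) * at_du Q - (x * at_du Q) * at_du (dp_deriv \<delta> Q)"
    by (simp add: algebra_simps)
  finally have "dual_deriv D x * at_du Q * at_du Q =
      at_du (dp_deriv \<delta> P) * at_du Q - (x * at_du Q) * at_du (dp_deriv \<delta> Q)" .
  then have "dual_deriv D x * at_du (Q * Q) = at_du (dp_deriv \<delta> P * Q - P * dp_deriv \<delta> Q)"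
    unfolding x(2) by (simp add: at_du.hom_mult at_du.hom_minus mult.assoc)
  then show ?thesis using x by (intro differentialsI) (auto simp: at_u.hom_mult)
qed

text \<open>The differential is well defined because no polynomial relation holds at \<open>u\<close>.\<close>

lemma differentials_base_0:
  assumes "x \<in> differentials" "base x = 0"
  shows "x = 0"
proof -
  obtain P Q where x: "at_u Q \<noteq> 0" "x * at_du Q = at_du P" using assms(1) by (rule differentialsE)
  have "at_u P = 0" using arg_cong[OF x(2), of base] assms(2) by simp
  then have "P = 0" by (simp add: at_u_eq_0_iff)
  then have "x * at_du Q = 0" using x(2) by (simp add: at_du.hom_zero)
  then have "diff (x * at_du Q) = 0" by (simp only: dual_simps)
  then have "diff x = 0" using x(1) assms(2) by simp
  then show ?thesis using assms(2) by (simp add: dual_eq_iff)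
qed

lemma differentials_dp_eval:
  assumes "\<And>w. a w \<in> differentials"
  shows "dp_eval (dual_const \<iota>) (dual_deriv D) a f \<in> differentials"
proof -
  have "(dual_deriv D ^^ k) (a w) \<in> differentials" for w k
    by (induction k) (auto intro: assms differentials_deriv)
  then show ?thesis unfolding dp_eval_ev
    by (induction f rule: dpoly_induct)
      (auto simp: dual.ev_add dual.ev_mult intro: differentials_const differentials_add differentials_mult)
qed

text \<open>
  The elements whose differential lies in a given differential submodule form a differential field.
  When this field contains \<open>a\<close> and \<open>b\<close>, it contains \<open>u\<close>, whose differential is 1.
\<close>

theorem generators_right_coprime:
  assumes x: "x \<in> differentials" and y: "y \<in> differentials"
    and gen: "u \<in> adjoin D \<iota> {base x, base y}"
  shows "right_coprime D (diff x) (diff y)"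
  unfolding right_coprime_def
proof (intro allI impI)
  fix N assume N: "poly_vs.subspace N" "dshift D ` N \<subseteq> N" "diff x \<in> N" "diff y \<in> N"
  define L where "L = {g. \<exists>z\<in>differentials. base z = g \<and> diff z \<in> N}"
  have LI: "base z \<in> L" if "z \<in> differentials" "diff z \<in> N" for z
    using that unfolding L_def by blast
  have const: "\<iota> c \<in> L" for c
    using LI[OF differentials_const[of c]] poly_vs.subspace_0[OF N(1)] by simp
  have "subring L class_ring"
  proof (rule ring.subringI[OF class_ring.ring_axioms])
    show "\<one>\<^bsub>class_ring\<^esub> \<in> L" "L \<subseteq> carrier class_ring" using const[of 1] by (simp_all add: \<iota>.hom_one)
    show mult: "h1 \<otimes>\<^bsub>class_ring\<^esub> h2 \<in> L" if h: "h1 \<in> L" "h2 \<in> L" for h1 h2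
    proof -
      obtain z w where z: "z \<in> differentials" "base z = h1" "diff z \<in> N"
        and w: "w \<in> differentials" "base w = h2" "diff w \<in> N" using h unfolding L_def by blast
      have "diff (z * w) \<in> N"
        using z w N(1) by (simp add: poly_vs.subspace_add poly_vs.subspace_scale)
      then show ?thesis using LI[OF differentials_mult[OF z(1) w(1)]] z w by simp
    qed
    show "\<ominus>\<^bsub>class_ring\<^esub> h \<in> L" if h: "h \<in> L" for h
      using mult[OF const[of "- 1"] h] by (simp add: class_ring_simps \<iota>.hom_uminus)
    show "h1 \<oplus>\<^bsub>class_ring\<^esub> h2 \<in> L" if h: "h1 \<in> L" "h2 \<in> L" for h1 h2
    proof -
      obtain z w where z: "z \<in> differentials" "base z = h1" "diff z \<in> N"
        and w: "w \<in> differentials" "base w = h2" "diff w \<in> N" using h unfolding L_def by blast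
      have "diff (z + w) \<in> N" using z w N(1) by (simp add: poly_vs.subspace_add)
      then show ?thesis using LI[OF differentials_add[OF z(1) w(1)]] z w by simp
    qed
  qed
  moreover have "inv\<^bsub>class_ring\<^esub> k \<in> L" if k: "k \<in> L - {\<zero>\<^bsub>class_ring\<^esub>}" for k
    proof -
      have "k \<noteq> 0" using k by simp
      obtain z where z: "z \<in> differentials" "base z = k" "diff z \<in> N" using k unfolding L_def by blast
      define w where "w = Dual (inverse k) (- smult (inverse k ^ 2) (diff z))"
      have "z * w = 1" using dual_unit[of z] z(2) \<open>k \<noteq> 0\<close> by (simp add: w_def)
      then have "w \<in> differentials" by (rule differentials_inverse[OF z(1)])
      moreover have "diff w \<in> N"
        unfolding w_def using z(3) N(1) by (simp add: poly_vs.subspace_neg poly_vs.subspace_scale)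
      ultimately have "inverse k \<in> L" using LI[of w] by (simp add: w_def)
      then show ?thesis using \<open>k \<noteq> 0\<close> by (simp add: class_ring_simps)
    qed
  ultimately have "subfield L class_ring" by (rule field.subfieldI'[OF class_field])
  moreover have "D ` L \<subseteq> L"
    proof
      fix g assume "g \<in> D ` L"
      then obtain z where z: "z \<in> differentials" "g = D (base z)" "diff z \<in> N" unfolding L_def by blast
      have "diff (dual_deriv D z) \<in> N" using z(3) N(2) by (simp add: image_subset_iff)
      then have "base (dual_deriv D z) \<in> L" by (rule LI[OF differentials_deriv[OF z(1)]])
      then show "g \<in> L" by (simp add: z(2))
    qed
  ultimately have "diff_subfield class_ring D L" by (simp add: diff_subfield_def)
  moreover have "range \<iota> \<union> {base x, base y} \<subseteq> L" using const LI x y N by auto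
  ultimately have "adjoin D \<iota> {base x, base y} \<subseteq> L"
    unfolding adjoin_def by (rule hull_minimal[rotated])
  then obtain z where z: "z \<in> differentials" "base z = u" "diff z \<in> N"
    using gen unfolding L_def by blast
  have "z - Dual u 1 \<in> differentials" using z(1) differentials_u by (rule differentials_diff)
  then have "z = Dual u 1" using differentials_base_0[of "z - Dual u 1"] z(2) by simp
  then show "1 \<in> N" using z(3) by simp
qed

end

lemma UNIV_xy: "(UNIV :: xy set) = {Xvar, Yvar}"
  using xy.exhaust by auto

context transcendental_extension
begin

text \<open>
  The relation persists at the dual numbers over \<open>a\<close> and \<open>b\<close>, because the differential is well
  defined; there it is expanded by Taylor's formula.
\<close>

lemma relation_differential:
  assumes a: "\<And>w. a w \<in> differentials" and A: "dp_eval \<iota> D (\<lambda>w. base (a w)) A = 0"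
    and n: "\<And>w k. (w, k) \<in> dp_vars A \<Longrightarrow> k \<le> n"
  defines "C w \<equiv> (\<Sum>k\<le>n. monom (dp_eval \<iota> D (\<lambda>w. base (a w)) (dp_pdiff (w, k) A)) k)"
  shows "op_apply D (C Xvar) (diff (a Xvar)) + op_apply D (C Yvar) (diff (a Yvar)) = 0"
proof -
  let ?e = "\<lambda>v. dp_eval \<iota> D (\<lambda>w. base (a w)) (dp_pdiff v A)"
  let ?A = "dp_eval (dual_const \<iota>) (dual_deriv D) a A"
  have coeffC: "coeff (C w) k = (if k \<le> n then ?e (w, k) else 0)" for w k
    unfolding C_def coeff_sum coeff_monom by (simp add: sum.delta)
  have degC: "degree (C w) \<le> n" for w by (rule degree_le) (simp only: coeffC, simp)
  have op: "op_apply D (C w) p = (\<Sum>k\<le>n. smult (?e (w, k)) ((dshift D ^^ k) p))" for w p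
    unfolding D.op_apply_superset[OF degC] by (intro sum.cong) (simp_all only: coeffC atMost_iff if_True)
  have "?A = 0"
    using differentials_base_0[OF differentials_dp_eval[of a A]] a A by (simp add: base_dp_eval)
  then have "0 = diff ?A" by simp
  also have "\<dots> = (\<Sum>v\<in>UNIV \<times> {..n}. smult (?e v) (diff ((dual_deriv D ^^ snd v) (a (fst v)))))"
  proof -
    have "finite (UNIV \<times> {..n} :: (xy \<times> nat) set)" "dp_vars A \<subseteq> UNIV \<times> {..n}"
      using n by (auto simp: UNIV_xy del: UNIV_I) (metis xy.exhaust)+
    from diff_ev[OF \<iota>.comm_ring_hom_axioms this] show ?thesis
      unfolding dp_eval_ev by (simp add: case_prod_unfold)
  qed
  also have "\<dots> = (\<Sum>w\<in>UNIV. op_apply D (C w) (diff (a w)))"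
    by (simp add: op sum.cartesian_product case_prod_unfold)
  finally show ?thesis by (simp add: UNIV_xy)
qed

text \<open>
  The relation between \<open>da\<close> and \<open>db\<close> is not trivial because one partial derivative of \<open>A\<close> does not
  vanish, and then neither of its two coefficients is zero. Its order bounds the order of \<open>A\<close> from below.
\<close>

theorem order_lower_bound:
  assumes a: "\<And>w. a w \<in> differentials" and nz: "\<And>w. diff (a w) \<noteq> 0"
    and cop: "right_coprime D (diff (a Xvar)) (diff (a Yvar))"
    and A: "dp_eval \<iota> D (\<lambda>w. base (a w)) A = 0"
    and sep: "dp_eval \<iota> D (\<lambda>w. base (a w)) (dp_pdiff v A) \<noteq> 0"
  shows "\<exists>k\<ge>degree (diff (a Yvar)). (Xvar, k) \<in> dp_vars A"
    "\<exists>k\<ge>degree (diff (a Xvar)). (Yvar, k) \<in> dp_vars A"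
proof -
  let ?e = "\<lambda>v. dp_eval \<iota> D (\<lambda>w. base (a w)) (dp_pdiff v A)"
  obtain n where n: "\<And>w k. (w, k) \<in> dp_vars A \<Longrightarrow> k \<le> n"
    using finite_nat_set_iff_bounded_le[of "snd ` dp_vars A"] by force
  define C where "C w = (\<Sum>k\<le>n. monom (?e (w, k)) k)" for w
  have coeffC: "coeff (C w) k = (if k \<le> n then ?e (w, k) else 0)" for w k
    unfolding C_def coeff_sum coeff_monom by (simp add: sum.delta)
  have rel: "op_apply D (C Xvar) (diff (a Xvar)) + op_apply D (C Yvar) (diff (a Yvar)) = 0"
    unfolding C_def by (rule relation_differential[OF a A n])
  have e0: "?e v = 0" if "v \<notin> dp_vars A" for v
    using dp_pdiff_free[OF that] by (simp add: dp_eval_ev \<iota>.ev_zero)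
  have mem: "(w, degree (C w)) \<in> dp_vars A" if "C w \<noteq> 0" for w
  proof (rule ccontr)
    assume "(w, degree (C w)) \<notin> dp_vars A"
    then have "coeff (C w) (degree (C w)) = 0" unfolding coeffC using e0 by simp
    then show False using that by simp
  qed
  have "v \<in> dp_vars A" using sep e0 by blast
  then have "coeff (C (fst v)) (snd v) \<noteq> 0" using n[of "fst v" "snd v"] sep by (simp add: coeffC)
  then have "C (fst v) \<noteq> 0" by auto
  moreover have "C Yvar \<noteq> 0" if "C Xvar \<noteq> 0"
    using rel degree_op_apply(1)[OF D.derivation_ring_axioms that nz] by auto
  moreover have "C Xvar \<noteq> 0" if "C Yvar \<noteq> 0"
    using rel degree_op_apply(1)[OF D.derivation_ring_axioms that nz] by auto
  ultimately have nzC: "C Xvar \<noteq> 0" "C Yvar \<noteq> 0" by (cases "fst v"; auto)+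
  have "degree (diff (a Yvar)) \<le> degree (C Xvar)"
    by (rule right_coprime_relation_degree[OF D.derivation_ring_axioms cop nz rel nzC(1)])
  then show "\<exists>k\<ge>degree (diff (a Yvar)). (Xvar, k) \<in> dp_vars A" using mem nzC by blast
  have "degree (diff (a Xvar)) \<le> degree (C Yvar)"
    using cop rel
    by (intro right_coprime_relation_degree[OF D.derivation_ring_axioms _ nz _ nzC(2)])
      (simp_all only: right_coprime_commute add.commute[of "op_apply D (C Yvar) _"])
  then show "\<exists>k\<ge>degree (diff (a Xvar)). (Yvar, k) \<in> dp_vars A" using mem nzC by blast
qed

end

section \<open>The determinant of the differential resultant\<close>

text \<open>
  \<open>e1 k j\<close> and \<open>g1 k\<close> are the coefficient of \<open>u\<^sup>(\<^sup>j\<^sup>)\<close> and the constant coefficient of the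
  \<open>k\<close>-th derivative of the first differential polynomial, and similarly for the second one. Rows
  and columns run through the derivatives in decreasing order.
\<close>

definition resultant_matrix ::
  "nat \<Rightarrow> nat \<Rightarrow> (nat \<Rightarrow> nat \<Rightarrow> 'a) \<Rightarrow> (nat \<Rightarrow> 'a) \<Rightarrow> (nat \<Rightarrow> nat \<Rightarrow> 'a) \<Rightarrow> (nat \<Rightarrow> 'a) \<Rightarrow> 'a mat" where
  "resultant_matrix m1 m2 e1 g1 e2 g2 = mat (m1 + m2 + 2) (m1 + m2 + 2) (\<lambda>(i, j).
     if i \<le> m2 then (if j \<le> m1 + m2 then e1 (m2 - i) (m1 + m2 - j) else g1 (m2 - i))
     else (if j \<le> m1 + m2 then e2 (m1 + m2 + 1 - i) (m1 + m2 - j) else g2 (m1 + m2 + 1 - i)))"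

lemma resultant_matrix_carrier [simp]:
  "resultant_matrix m1 m2 e1 g1 e2 g2 \<in> carrier_mat (m1 + m2 + 2) (m1 + m2 + 2)"
  by (simp add: resultant_matrix_def)

lemma sum_rows_split:
  fixes f :: "nat \<Rightarrow> 'a::comm_monoid_add"
  shows "(\<Sum>i<m1 + m2 + 2. f i) = (\<Sum>k\<le>m2. f (m2 - k)) + (\<Sum>k\<le>m1. f (m1 + m2 + 1 - k))"
proof -
  have split: "sum f {..<a + b} = sum f {..<a} + (\<Sum>i<b. f (a + i))" for a b
    by (induction b) (simp_all add: add.assoc)
  have "(\<Sum>i<m1 + m2 + 2. f i) = sum f {..<Suc m2 + Suc m1}" by (simp add: add.commute)
  also have "\<dots> = sum f {..<Suc m2} + (\<Sum>i<Suc m1. f (Suc m2 + i))" by (rule split)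
  also have "sum f {..<Suc m2} = (\<Sum>k\<le>m2. f (m2 - k))"
    using sum.nat_diff_reindex[of f "Suc m2"] by (simp add: lessThan_Suc_atMost)
  also have "(\<Sum>i<Suc m1. f (Suc m2 + i)) = (\<Sum>k<Suc m1. f (Suc m2 + (Suc m1 - Suc k)))"
    by (rule sum.nat_diff_reindex[symmetric])
  also have "\<dots> = (\<Sum>k\<le>m1. f (m1 + m2 + 1 - k))"
    unfolding lessThan_Suc_atMost by (intro sum.cong) (auto intro!: arg_cong[of _ _ f])
  finally show ?thesis .
qed

lemma sum_columns_split:
  fixes f :: "nat \<Rightarrow> 'a::comm_monoid_add"
  shows "(\<Sum>i<n + 2. f i) = (\<Sum>j\<le>n. f (n - j)) + f (n + 1)"
proof -
  have "(\<Sum>i<n + 2. f i) = (\<Sum>i<Suc n. f i) + f (n + 1)" by simp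
  then show ?thesis
    using sum.nat_diff_reindex[of f "Suc n"] by (simp add: lessThan_Suc_atMost)
qed

text \<open>
  The vector of the \<open>w\<^sub>j\<close>, followed by 1, lies in the kernel.
\<close>

lemma det_resultant_matrix_eq_0I:
  fixes e1 e2 :: "nat \<Rightarrow> nat \<Rightarrow> 'a::idom"
  assumes "\<And>k. k \<le> m2 \<Longrightarrow> (\<Sum>j\<le>m1 + m2. e1 k j * w j) + g1 k = 0"
    and "\<And>k. k \<le> m1 \<Longrightarrow> (\<Sum>j\<le>m1 + m2. e2 k j * w j) + g2 k = 0"
  shows "det (resultant_matrix m1 m2 e1 g1 e2 g2) = 0"
proof -
  let ?n = "m1 + m2" and ?M = "resultant_matrix m1 m2 e1 g1 e2 g2"
  define v where "v = vec (?n + 2) (\<lambda>j. if j \<le> ?n then w (?n - j) else 1)"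
  have "v $ (?n + 1) = 1" by (simp add: v_def)
  then have "v \<noteq> 0\<^sub>v (?n + 2)" by auto
  moreover have "?M *\<^sub>v v = 0\<^sub>v (?n + 2)"
  proof (rule eq_vecI)
    fix i assume "i < dim_vec (0\<^sub>v (?n + 2) :: 'a vec)"
    then have i: "i < ?n + 2" by simp
    have "(?M *\<^sub>v v) $ i = (\<Sum>j<?n + 2. ?M $$ (i, j) * v $ j)"
      using i by (simp add: resultant_matrix_def v_def scalar_prod_def lessThan_atLeast0)
    also have "\<dots> = (\<Sum>j\<le>?n. ?M $$ (i, ?n - j) * v $ (?n - j)) + ?M $$ (i, ?n + 1) * v $ (?n + 1)"
      by (rule sum_columns_split)
    also have "\<dots> = 0"
    proof (cases "i \<le> m2")
      case True
      then have "(\<Sum>j\<le>?n. ?M $$ (i, ?n - j) * v $ (?n - j)) = (\<Sum>j\<le>?n. e1 (m2 - i) j * w j)"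
        using i by (intro sum.cong) (auto simp: resultant_matrix_def v_def)
      then show ?thesis using True i assms(1)[of "m2 - i"] by (simp add: resultant_matrix_def v_def)
    next
      case False
      then have "(\<Sum>j\<le>?n. ?M $$ (i, ?n - j) * v $ (?n - j)) = (\<Sum>j\<le>?n. e2 (?n + 1 - i) j * w j)"
        using i by (intro sum.cong) (auto simp: resultant_matrix_def v_def)
      then show ?thesis using False i assms(2)[of "?n + 1 - i"] by (simp add: resultant_matrix_def v_def)
    qed
    finally show "(?M *\<^sub>v v) $ i = 0\<^sub>v (?n + 2) $ i" using i by simp
  qed (simp add: resultant_matrix_def)
  moreover have "v \<in> carrier_vec (?n + 2)" by (simp add: v_def)
  ultimately show ?thesis unfolding det_0_iff_vec_prod_zero[OF resultant_matrix_carrier] by blast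
qed

text \<open>
  A matrix with linearly independent rows is regular; \<open>Z1\<close> and \<open>Z2\<close> are the coefficients of a row
  relation.
\<close>

lemma det_resultant_matrix_neq_0I:
  fixes e1 e2 :: "nat \<Rightarrow> nat \<Rightarrow> 'a::idom"
  assumes "\<And>Z1 Z2 k. (\<And>j. j \<le> m1 + m2 \<Longrightarrow> (\<Sum>k\<le>m2. Z1 k * e1 k j) + (\<Sum>k\<le>m1. Z2 k * e2 k j) = 0) \<Longrightarrow>
      (\<Sum>k\<le>m2. Z1 k * g1 k) + (\<Sum>k\<le>m1. Z2 k * g2 k) = 0 \<Longrightarrow>
      (\<forall>k\<le>m2. Z1 k = 0) \<and> (\<forall>k\<le>m1. Z2 k = 0)"
  shows "det (resultant_matrix m1 m2 e1 g1 e2 g2) \<noteq> 0"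
proof
  let ?n = "m1 + m2" and ?M = "resultant_matrix m1 m2 e1 g1 e2 g2"
  assume "det ?M = 0"
  then have "det (transpose_mat ?M) = 0" by (simp only: det_transpose[OF resultant_matrix_carrier])
  then obtain z where z: "z \<in> carrier_vec (?n + 2)" "z \<noteq> 0\<^sub>v (?n + 2)"
    and prod: "transpose_mat ?M *\<^sub>v z = 0\<^sub>v (?n + 2)"
    using det_0_iff_vec_prod_zero[OF iffD2[OF transpose_carrier_mat resultant_matrix_carrier]] by blast
  have col: "(\<Sum>k\<le>m2. z $ (m2 - k) * ?M $$ (m2 - k, j)) + (\<Sum>k\<le>m1. z $ (?n + 1 - k) * ?M $$ (?n + 1 - k, j)) = 0"
    if "j < ?n + 2" for j
  proof -
    have "0 = (transpose_mat ?M *\<^sub>v z) $ j" using prod that by simp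
    also have "\<dots> = (\<Sum>i<?n + 2. z $ i * ?M $$ (i, j))"
      using that z(1) by (simp add: resultant_matrix_def scalar_prod_def lessThan_atLeast0 mult.commute)
    finally show ?thesis by (simp only: sum_rows_split)
  qed
  have M1: "?M $$ (m2 - k, j) = (if j \<le> ?n then e1 k (?n - j) else g1 k)" if "k \<le> m2" "j < ?n + 2" for k j
    using that by (simp add: resultant_matrix_def)
  have M2: "?M $$ (?n + 1 - k, j) = (if j \<le> ?n then e2 k (?n - j) else g2 k)" if "k \<le> m1" "j < ?n + 2" for k j
    using that by (auto simp: resultant_matrix_def)
  have "(\<Sum>k\<le>m2. z $ (m2 - k) * e1 k j) + (\<Sum>k\<le>m1. z $ (?n + 1 - k) * e2 k j) = 0" if "j \<le> ?n" for j
    using col[of "?n - j"] that M1[of _ "?n - j"] M2[of _ "?n - j"] by (simp cong: sum.cong_simp)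
  moreover have "(\<Sum>k\<le>m2. z $ (m2 - k) * g1 k) + (\<Sum>k\<le>m1. z $ (?n + 1 - k) * g2 k) = 0"
    using col[of "?n + 1"] M1[of _ "?n + 1"] M2[of _ "?n + 1"] by (simp cong: sum.cong_simp)
  ultimately have z0: "\<forall>k\<le>m2. z $ (m2 - k) = 0" "\<forall>k\<le>m1. z $ (?n + 1 - k) = 0"
    using assms[of "\<lambda>k. z $ (m2 - k)" "\<lambda>k. z $ (?n + 1 - k)"] by blast+
  have "z $ i = 0" if "i < ?n + 2" for i
  proof (cases "i \<le> m2")
    case True
    then show ?thesis using z0(1)[rule_format, of "m2 - i"] by simp
  next
    case False
    then show ?thesis using z0(2)[rule_format, of "?n + 1 - i"] that by simp
  qed
  then have "z = 0\<^sub>v (?n + 2)" using z(1) by (intro eq_vecI) auto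
  then show False using z(2) by simp
qed

lemma (in comm_ring_hom) hom_det_resultant_matrix:
  "hom (det (resultant_matrix m1 m2 e1 g1 e2 g2)) =
     det (resultant_matrix m1 m2 (\<lambda>k j. hom (e1 k j)) (\<lambda>k. hom (g1 k)) (\<lambda>k j. hom (e2 k j)) (\<lambda>k. hom (g2 k)))"
proof -
  have "map_mat hom (resultant_matrix m1 m2 e1 g1 e2 g2) =
      resultant_matrix m1 m2 (\<lambda>k j. hom (e1 k j)) (\<lambda>k. hom (g1 k)) (\<lambda>k j. hom (e2 k j)) (\<lambda>k. hom (g2 k))"
    by (rule eq_matI) (auto simp: resultant_matrix_def)
  then show ?thesis by (metis hom_det)
qed

text \<open>
  Every term of the Leibniz formula takes one factor from each row.
\<close>

lemma dp_degree_in_det_resultant_matrix: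
  fixes e1 e2 :: "nat \<Rightarrow> nat \<Rightarrow> ('w, 'a::comm_ring_1) dpoly"
  assumes "\<And>k j. k \<le> m2 \<Longrightarrow> dp_degree_in v (e1 k j) \<le> \<beta>1 k" "\<And>k. k \<le> m2 \<Longrightarrow> dp_degree_in v (g1 k) \<le> \<beta>1 k"
    and "\<And>k j. k \<le> m1 \<Longrightarrow> dp_degree_in v (e2 k j) \<le> \<beta>2 k" "\<And>k. k \<le> m1 \<Longrightarrow> dp_degree_in v (g2 k) \<le> \<beta>2 k"
  shows "dp_degree_in v (det (resultant_matrix m1 m2 e1 g1 e2 g2)) \<le> (\<Sum>k\<le>m2. \<beta>1 k) + (\<Sum>k\<le>m1. \<beta>2 k)"
proof -
  let ?n = "m1 + m2" and ?M = "resultant_matrix m1 m2 e1 g1 e2 g2"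
  define \<beta> where "\<beta> i = (if i \<le> m2 then \<beta>1 (m2 - i) else \<beta>2 (?n + 1 - i))" for i
  have entry: "dp_degree_in v (?M $$ (i, j)) \<le> \<beta> i" if "i < ?n + 2" "j < ?n + 2" for i j
    using that by (auto simp: resultant_matrix_def \<beta>_def intro!: assms)
  have sign: "dp_degree_in v (signof p :: ('w, 'a) dpoly) = 0" for p :: "nat \<Rightarrow> nat"
    by (simp add: sign_def dp_degree_in_eq_0_iff)
  have "dp_degree_in v (det ?M) \<le> (\<Sum>i<?n + 2. \<beta> i)"
    unfolding det_def'[OF resultant_matrix_carrier]
  proof (rule dp_degree_in_sum_le)
    fix p assume "p \<in> {p. p permutes {0..<?n + 2}}"
    then have p: "p i < ?n + 2" if "i < ?n + 2" for i using that permutes_in_image[of p "{0..<?n + 2}" i] by auto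
    have "dp_degree_in v (signof p * (\<Prod>i = 0..<?n + 2. ?M $$ (i, p i))) \<le>
        dp_degree_in v (\<Prod>i = 0..<?n + 2. ?M $$ (i, p i))"
      using dp_degree_in_mult_le[of v "signof p" "\<Prod>i = 0..<?n + 2. ?M $$ (i, p i)"] sign[of p] by simp
    also have "\<dots> \<le> (\<Sum>i = 0..<?n + 2. dp_degree_in v (?M $$ (i, p i)))" by (rule dp_degree_in_prod_le)
    also have "\<dots> \<le> (\<Sum>i = 0..<?n + 2. \<beta> i)" using entry p by (intro sum_mono) auto
    finally show "dp_degree_in v (signof p * (\<Prod>i = 0..<?n + 2. ?M $$ (i, p i))) \<le> (\<Sum>i<?n + 2. \<beta> i)"
      by (simp add: lessThan_atLeast0)
  qed
  also have "\<dots> = (\<Sum>k\<le>m2. \<beta>1 k) + (\<Sum>k\<le>m1. \<beta>2 k)"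
    unfolding sum_rows_split by (intro arg_cong2[where f="(+)"] sum.cong) (auto simp: \<beta>_def)
  finally show ?thesis .
qed

subsection \<open>Derivatives of linear differential polynomials\<close>

definition linear_form :: "'b::comm_ring_1 \<Rightarrow> (nat \<Rightarrow> 'b) \<Rightarrow> nat \<Rightarrow> (unit, 'b) dpoly" where
  "linear_form c0 c n = dp_const c0 + (\<Sum>k\<le>n. dp_const (c k) * pvar ((), k))"

lemma dp_const_pvar: "dp_const c * pvar v = single (single v 1) (c :: 'b::comm_ring_1)"
  by (simp add: pvar_def dp_const_mult_single)

lemma lookup_linear_form:
  "lookup (linear_form c0 c n) m =
     (if 0 = m then c0 else 0) + (\<Sum>k\<le>n. if single ((), k) 1 = m then c k else 0)"
  unfolding linear_form_def dp_const_pvar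
  by (simp add: lookup_add lookup_sum lookup_single dp_const_def when_def)

lemma single_neq_0 [simp]: "single v (1::nat) \<noteq> 0" "0 \<noteq> single v (1::nat)"
  by (metis lookup_single_eq lookup_zero zero_neq_one)+

lemma single_eq_iff: "single v (1::nat) = single w 1 \<longleftrightarrow> v = w"
  by (metis lookup_single_eq lookup_single_not_eq zero_neq_one)

lemma lookup_linear_form_simps:
  "lookup (linear_form c0 c n) 0 = c0"
  "lookup (linear_form c0 c n) (single ((), j) 1) = (if j \<le> n then c j else 0)"
  unfolding lookup_linear_form by (simp_all add: single_eq_iff del: One_nat_def)

lemma linear_form_cong: "(\<And>k. k \<le> n \<Longrightarrow> c k = c' k) \<Longrightarrow> linear_form c0 c n = linear_form c0 c' n"
  by (simp add: linear_form_def)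

lemma linear_formI:
  assumes "\<And>m. m \<in> keys f \<Longrightarrow> m = 0 \<or> (\<exists>k\<le>n. m = single ((), k) 1)"
  shows "f = linear_form (lookup f 0) (\<lambda>k. lookup f (single ((), k) 1)) n"
proof (rule poly_mapping_eqI)
  fix m
  consider "m = 0" | k where "k \<le> n" "m = single ((), k) 1"
    | "m \<notin> keys f" "0 \<noteq> m" "\<And>k. k \<le> n \<Longrightarrow> single ((), k) 1 \<noteq> m"
    using assms by blast
  then show "lookup f m = lookup (linear_form (lookup f 0)
      (\<lambda>k. lookup f (single ((), k) 1)) n) m"
  proof cases
    case 3
    then have "lookup f m = 0" by (simp add: in_keys_iff)
    then show ?thesis using 3 unfolding lookup_linear_form by (simp del: One_nat_def)
  qed (simp_all add: lookup_linear_form_simps del: One_nat_def)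
qed

text \<open>The coefficients of the derivatives of \<open>\<Sum>j. c\<^sub>j u\<^sup>(\<^sup>j\<^sup>)\<close>.\<close>

primrec deriv_coeffs :: "('b \<Rightarrow> 'b) \<Rightarrow> (nat \<Rightarrow> 'b::comm_ring_1) \<Rightarrow> nat \<Rightarrow> nat \<Rightarrow> 'b" where
  "deriv_coeffs d c 0 j = c j"
| "deriv_coeffs d c (Suc k) j = d (deriv_coeffs d c k j) + (if j = 0 then 0 else deriv_coeffs d c k (j - 1))"

lemma deriv_coeffs_dshift:
  assumes "derivation_ring D"
  shows "deriv_coeffs D (coeff p) k j = coeff ((dshift D ^^ k) p) j"
  by (induction k arbitrary: j) (simp_all add: derivation_ring.coeff_dshift[OF assms])

context derivation_ring
begin

lemma deriv_coeffs_beyond: "(\<And>j. j > n \<Longrightarrow> c j = 0) \<Longrightarrow> n + k < j \<Longrightarrow> deriv_coeffs d c k j = 0"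
  by (induction k arbitrary: j) simp_all

lemma dp_deriv_linear_form:
  assumes "c (Suc n) = 0"
  shows "dp_deriv d (linear_form c0 c n) =
    linear_form (d c0) (\<lambda>j. d (c j) + (if j = 0 then 0 else c (j - 1))) (Suc n)"
proof -
  interpret dd: derivation_ring "dp_deriv d :: (unit, 'a) dpoly \<Rightarrow> _" by (rule dp_deriv_derivation)
  interpret const: comm_ring_hom "dp_const :: 'a \<Rightarrow> (unit, 'a) dpoly" by (rule comm_ring_hom_dp_const)
  have sum: "dp_deriv d (\<Sum>k\<le>n. f k) = (\<Sum>k\<le>n. dp_deriv d (f k))" for f :: "nat \<Rightarrow> (unit, 'a) dpoly" and n
    by (induction n) (simp_all add: dp_deriv_add)
  have "(\<Sum>k\<le>n. dp_const (c k) * pvar ((), Suc k) :: (unit, 'a) dpoly) =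
      (\<Sum>k\<le>Suc n. dp_const (if k = 0 then 0 else c (k - 1)) * pvar ((), k))"
    unfolding sum.atMost_Suc_shift by simp
  moreover have "(\<Sum>k\<le>n. dp_const (d (c k)) * pvar ((), k) :: (unit, 'a) dpoly) =
      (\<Sum>k\<le>Suc n. dp_const (d (c k)) * pvar ((), k))"
    using assms by simp
  ultimately show ?thesis
    unfolding linear_form_def
    by (simp only: dp_deriv_add sum dp_deriv_mult dp_deriv_const dp_deriv_pvar fst_conv snd_conv
        sum.distrib const.hom_add distrib_right)
qed

lemma dp_deriv_iterate_linear_form:
  assumes "\<And>j. j > n \<Longrightarrow> c j = 0"
  shows "(dp_deriv d ^^ k) (linear_form c0 c n) = linear_form ((d ^^ k) c0) (deriv_coeffs d c k) (n + k)"
proof (induction k)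
  case 0
  then show ?case by (auto intro: linear_form_cong)
next
  case (Suc k)
  have "(dp_deriv d ^^ Suc k) (linear_form c0 c n) =
      dp_deriv d (linear_form ((d ^^ k) c0) (deriv_coeffs d c k) (n + k))"
    using Suc by simp
  also have "\<dots> = linear_form ((d ^^ Suc k) c0) (deriv_coeffs d c (Suc k)) (n + Suc k)"
    by (subst dp_deriv_linear_form)
      (simp_all add: deriv_coeffs_beyond[of n c, OF assms] linear_form_def)
  finally show ?case .
qed

lemma linear_coeffs_derivative:
  assumes "\<And>j. j > n \<Longrightarrow> c j = 0" "n + k \<le> N"
  shows "linear_coeffs N ((dp_deriv d ^^ k) (linear_form c0 c n)) =
    map (deriv_coeffs d c k) (rev [0..<Suc N]) @ [(d ^^ k) c0]"
proof -
  have F: "(dp_deriv d ^^ k) (linear_form c0 c n) = linear_form ((d ^^ k) c0) (deriv_coeffs d c k) (n + k)"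
    by (rule dp_deriv_iterate_linear_form) (rule assms(1))
  have "(if j \<le> n + k then deriv_coeffs d c k j else 0) = deriv_coeffs d c k j" for j
    using deriv_coeffs_beyond[of n c k j, OF assms(1)] by auto
  then show ?thesis
    unfolding linear_coeffs_def F lookup_linear_form_simps by (simp only:)
qed

end

lemma nth_coeffs_row:
  assumes "j \<le> Suc N"
  shows "(map f (rev [0..<Suc N]) @ [g]) ! j = (if j \<le> N then f (N - j) else g)"
proof -
  have len: "length (map f (rev [0..<Suc N])) = Suc N" by simp
  show ?thesis
  proof (cases "j \<le> N")
    case True
    then show ?thesis unfolding nth_append len by (simp add: rev_nth del: upt_Suc)
  next
    case False
    then have "j = Suc N" using assms by simp
    then show ?thesis unfolding nth_append len by (simp del: upt_Suc)
  qed
qed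

lemma resultant_matrix_of_rows:
  "mat_of_rows_list (m1 + m2 + 2)
     (map (\<lambda>k. map (e1 k) (rev [0..<Suc (m1 + m2)]) @ [g1 k]) (rev [0..<Suc m2]) @
      map (\<lambda>k. map (e2 k) (rev [0..<Suc (m1 + m2)]) @ [g2 k]) (rev [0..<Suc m1])) =
   resultant_matrix m1 m2 e1 g1 e2 g2"
  (is "mat_of_rows_list _ (?A @ ?B) = _")
proof -
  have lA: "length ?A = Suc m2" and lB: "length ?B = Suc m1" by simp_all
  have A: "?A ! i = map (e1 (m2 - i)) (rev [0..<Suc (m1 + m2)]) @ [g1 (m2 - i)]" if "i \<le> m2" for i
    using that by (simp add: rev_nth del: upt_Suc)
  have B: "?B ! i = map (e2 (m1 - i)) (rev [0..<Suc (m1 + m2)]) @ [g2 (m1 - i)]" if "i \<le> m1" for i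
    using that by (simp add: rev_nth del: upt_Suc)
  show ?thesis
  proof (rule eq_matI)
    fix i j assume "i < dim_row (resultant_matrix m1 m2 e1 g1 e2 g2)" "j < dim_col (resultant_matrix m1 m2 e1 g1 e2 g2)"
    then have ij: "i < m1 + m2 + 2" "j \<le> Suc (m1 + m2)" by (simp_all add: resultant_matrix_def)
    have "mat_of_rows_list (m1 + m2 + 2) (?A @ ?B) $$ (i, j) = (?A @ ?B) ! i ! j"
      unfolding mat_of_rows_list_def using ij lA lB by (subst index_mat) auto
    also have "\<dots> = resultant_matrix m1 m2 e1 g1 e2 g2 $$ (i, j)"
    proof (cases "i \<le> m2")
      case True
      then have "(?A @ ?B) ! i = ?A ! i" unfolding nth_append lA by simp
      then have row: "(?A @ ?B) ! i ! j = (if j \<le> m1 + m2 then e1 (m2 - i) (m1 + m2 - j) else g1 (m2 - i))"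
        unfolding A[OF True] by (simp only: nth_coeffs_row[OF ij(2)])
      show ?thesis unfolding row using ij True by (simp add: resultant_matrix_def)
    next
      case False
      then have "(?A @ ?B) ! i = ?B ! (i - Suc m2)" unfolding nth_append lA by simp
      moreover have i': "i - Suc m2 \<le> m1" "m1 - (i - Suc m2) = m1 + m2 + 1 - i" using ij False by simp_all
      ultimately have row: "(?A @ ?B) ! i ! j =
          (if j \<le> m1 + m2 then e2 (m1 + m2 + 1 - i) (m1 + m2 - j) else g2 (m1 + m2 + 1 - i))"
        unfolding B[OF i'(1)] i'(2) by (simp only: nth_coeffs_row[OF ij(2)])
      show ?thesis unfolding row using ij False by (simp add: resultant_matrix_def)
    qed
    finally show "mat_of_rows_list (m1 + m2 + 2) (?A @ ?B) $$ (i, j) =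
      resultant_matrix m1 m2 e1 g1 e2 g2 $$ (i, j)" .
  qed (simp_all add: mat_of_rows_list_def resultant_matrix_def)
qed

theorem diff_resultant_linear_forms:
  assumes "derivation_ring d"
    and "f1 = linear_form c1 a1 m1" "\<And>j. j > m1 \<Longrightarrow> a1 j = 0" "dp_ord_in () f1 = Fin m1"
    and "f2 = linear_form c2 a2 m2" "\<And>j. j > m2 \<Longrightarrow> a2 j = 0" "dp_ord_in () f2 = Fin m2"
  shows "diff_resultant d f1 f2 = det (resultant_matrix m1 m2
           (deriv_coeffs d a1) (\<lambda>k. (d ^^ k) c1) (deriv_coeffs d a2) (\<lambda>k. (d ^^ k) c2))"
proof -
  interpret derivation_ring d by fact
  have "map (\<lambda>k. linear_coeffs (m1 + m2) ((dp_deriv d ^^ k) f1)) (rev [0..<Suc m2]) =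
      map (\<lambda>k. map (deriv_coeffs d a1 k) (rev [0..<Suc (m1 + m2)]) @ [(d ^^ k) c1]) (rev [0..<Suc m2])"
    unfolding assms(2) by (rule map_cong[OF refl], rule linear_coeffs_derivative) (use assms(3) in auto)
  moreover have "map (\<lambda>k. linear_coeffs (m1 + m2) ((dp_deriv d ^^ k) f2)) (rev [0..<Suc m1]) =
      map (\<lambda>k. map (deriv_coeffs d a2 k) (rev [0..<Suc (m1 + m2)]) @ [(d ^^ k) c2]) (rev [0..<Suc m1])"
    unfolding assms(5) by (rule map_cong[OF refl], rule linear_coeffs_derivative) (use assms(6) in auto)
  ultimately show ?thesis
    unfolding diff_resultant_def assms(4,7) prod.case extended.case
    by (simp only: resultant_matrix_of_rows)
qed

lemma resultant_matrix_cong: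
  assumes "\<And>k j. k \<le> m2 \<Longrightarrow> e1 k j = e1' k j" "\<And>k. k \<le> m2 \<Longrightarrow> g1 k = g1' k"
    and "\<And>k j. k \<le> m1 \<Longrightarrow> e2 k j = e2' k j" "\<And>k. k \<le> m1 \<Longrightarrow> g2 k = g2' k"
  shows "resultant_matrix m1 m2 e1 g1 e2 g2 = resultant_matrix m1 m2 e1' g1' e2' g2'"
  by (rule eq_matI) (auto simp: resultant_matrix_def assms)

lemma degree_sum_monom: "degree (\<Sum>k\<le>n. monom (Z k) k) \<le> n"
  by (rule degree_sum_le) (auto intro: order_trans[OF degree_monom_le])

lemma coeff_sum_monom: "coeff (\<Sum>k\<le>n. monom (Z k) k) j = (if j \<le> n then Z j else 0)"
  unfolding coeff_sum coeff_monom by (simp add: sum.delta)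

text \<open>
  The unperturbed matrix is singular. A row relation of the perturbed matrix, evaluated at \<open>w\<close>,
  shows that the perturbed row does not take part in it; what remains would be a relation between
  \<open>p\<close> and \<open>q\<close> of too small an order.
\<close>

lemma perturbed_resultant_neq_0:
  fixes p q :: "'e::field poly"
  assumes D: "derivation_ring D" and cop: "right_coprime D p q" and nz: "p \<noteq> 0" "q \<noteq> 0"
    and deg: "degree p = m1" "degree q = m2"
    and w1: "\<And>k. k \<le> m2 \<Longrightarrow> (\<Sum>j\<le>m1 + m2. coeff ((dshift D ^^ k) p) j * w j) + g1 k = 0"
    and w2: "\<And>k. k \<le> m1 \<Longrightarrow> (\<Sum>j\<le>m1 + m2. coeff ((dshift D ^^ k) q) j * w j) + g2 k = 0"
    and pert: "(\<Sum>j\<le>m1 + m2. s j * w j) + s0 \<noteq> 0"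
  shows "det (resultant_matrix m1 m2
      (\<lambda>k j. coeff ((dshift D ^^ k) p) j + (if k = m2 then s j else 0)) (\<lambda>k. g1 k + (if k = m2 then s0 else 0))
      (\<lambda>k j. coeff ((dshift D ^^ k) q) j) g2) \<noteq> 0"
proof (rule det_resultant_matrix_neq_0I)
  interpret derivation_ring D by fact
  let ?n = "m1 + m2"
  let ?p = "\<lambda>k j. coeff ((dshift D ^^ k) p) j" and ?q = "\<lambda>k j. coeff ((dshift D ^^ k) q) j"
  let ?e = "\<lambda>k j. ?p k j + (if k = m2 then s j else 0)"
  let ?g = "\<lambda>k. g1 k + (if k = m2 then s0 else 0)"
  fix Z1 Z2 :: "nat \<Rightarrow> 'e"
  assume cols: "\<And>j. j \<le> ?n \<Longrightarrow> (\<Sum>k\<le>m2. Z1 k * ?e k j) + (\<Sum>k\<le>m1. Z2 k * ?q k j) = 0"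
    and const: "(\<Sum>k\<le>m2. Z1 k * ?g k) + (\<Sum>k\<le>m1. Z2 k * g2 k) = 0"
  let ?r = "\<lambda>k. (\<Sum>j\<le>?n. ?e k j * w j) + ?g k"
  have row1: "?r k = (if k = m2 then (\<Sum>j\<le>?n. s j * w j) + s0 else 0)" if "k \<le> m2" for k
    using w1[OF that] by (auto simp: distrib_right sum.distrib algebra_simps eq_neg_iff_add_eq_0)
  have weighted: "(\<Sum>j\<le>?n. \<Sum>k\<le>N. Z k * (e k j * w j)) + (\<Sum>k\<le>N. Z k * g k) =
      (\<Sum>k\<le>N. Z k * ((\<Sum>j\<le>?n. e k j * w j) + g k))" for N and Z g :: "nat \<Rightarrow> 'e" and e
    by (subst sum.swap) (simp only: distrib_left sum.distrib sum_distrib_left)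
  have "0 = (\<Sum>j\<le>?n. ((\<Sum>k\<le>m2. Z1 k * ?e k j) + (\<Sum>k\<le>m1. Z2 k * ?q k j)) * w j) +
      ((\<Sum>k\<le>m2. Z1 k * ?g k) + (\<Sum>k\<le>m1. Z2 k * g2 k))"
    unfolding const using cols by simp
  also have "\<dots> = (\<Sum>j\<le>?n. \<Sum>k\<le>m2. Z1 k * (?e k j * w j)) + (\<Sum>k\<le>m2. Z1 k * ?g k) +
      ((\<Sum>j\<le>?n. \<Sum>k\<le>m1. Z2 k * (?q k j * w j)) + (\<Sum>k\<le>m1. Z2 k * g2 k))"
    by (simp only: distrib_right sum.distrib sum_distrib_right mult.assoc add_ac)
  also have "\<dots> = (\<Sum>k\<le>m2. Z1 k * ?r k) + (\<Sum>k\<le>m1. Z2 k * ((\<Sum>j\<le>?n. ?q k j * w j) + g2 k))"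
    by (simp only: weighted)
  also have "(\<Sum>k\<le>m1. Z2 k * ((\<Sum>j\<le>?n. ?q k j * w j) + g2 k)) = 0"
    using w2 by (intro sum.neutral) simp
  also have "(\<Sum>k\<le>m2. Z1 k * ?r k) = (\<Sum>k\<le>m2. if k = m2 then Z1 k * ((\<Sum>j\<le>?n. s j * w j) + s0) else 0)"
    using row1 by (intro sum.cong) auto
  finally have "Z1 m2 * ((\<Sum>j\<le>?n. s j * w j) + s0) = 0" by simp
  then have Z0: "Z1 m2 = 0" using pert by simp
  define C1 where "C1 = (\<Sum>k\<le>m2. monom (Z1 k) k)"
  define C2 where "C2 = (\<Sum>k\<le>m1. monom (Z2 k) k)"
  have op1: "op_apply D C1 p = (\<Sum>k\<le>m2. smult (Z1 k) ((dshift D ^^ k) p))"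
    unfolding C1_def op_apply_superset[OF degree_sum_monom] by (intro sum.cong) (simp_all add: coeff_sum_monom)
  have op2: "op_apply D C2 q = (\<Sum>k\<le>m1. smult (Z2 k) ((dshift D ^^ k) q))"
    unfolding C2_def op_apply_superset[OF degree_sum_monom] by (intro sum.cong) (simp_all add: coeff_sum_monom)
  have rel: "op_apply D C1 p + op_apply D C2 q = 0"
  proof (rule poly_eqI)
    fix j
    have "coeff (op_apply D C1 p + op_apply D C2 q) j = (\<Sum>k\<le>m2. Z1 k * ?p k j) + (\<Sum>k\<le>m1. Z2 k * ?q k j)"
      by (simp add: op1 op2 coeff_sum)
    also have "\<dots> = 0"
    proof (cases "j \<le> ?n")
      case True
      have "(\<Sum>k\<le>m2. Z1 k * ?p k j) = (\<Sum>k\<le>m2. Z1 k * ?e k j)"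
        by (intro sum.cong) (auto simp: Z0)
      then show ?thesis using cols[OF True] by simp
    next
      case False
      have "?p k j = 0" if "k \<le> m2" for k
        using that False nz deg by (intro coeff_eq_0) (simp add: degree_dshift_iterate)
      moreover have "?q k j = 0" if "k \<le> m1" for k
        using that False nz deg by (intro coeff_eq_0) (simp add: degree_dshift_iterate)
      ultimately show ?thesis by simp
    qed
    finally show "coeff (op_apply D C1 p + op_apply D C2 q) j = coeff 0 j" by simp
  qed
  have "C1 = 0"
  proof (rule ccontr)
    assume C: "C1 \<noteq> 0"
    then have "m2 \<le> degree C1" using right_coprime_relation_degree[OF D cop nz(2) rel] deg by simp
    then have "degree C1 = m2" using degree_sum_monom[of Z1 m2] by (simp add: C1_def)
    then have "lead_coeff C1 = 0" by (simp add: C1_def coeff_sum_monom Z0)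
    then show False using C by simp
  qed
  moreover from this have "C2 = 0"
    using rel degree_op_apply(1)[OF D _ nz(2), of C2] by auto
  ultimately show "(\<forall>k\<le>m2. Z1 k = 0) \<and> (\<forall>k\<le>m1. Z2 k = 0)"
    using coeff_sum_monom[of Z1 m2] coeff_sum_monom[of Z2 m1] unfolding C1_def C2_def
    by (metis coeff_0)
qed

section \<open>Linear parametrizations\<close>

abbreviation lin_coeff :: "(unit, 'a::zero) dpoly \<Rightarrow> nat \<Rightarrow> 'a" where
  "lin_coeff f k \<equiv> lookup f (single ((), k) 1)"

lemma dp_ord_in_eq_Fin_iff:
  "dp_ord_in w f = Fin m \<longleftrightarrow> (w, m) \<in> dp_vars f \<and> (\<forall>k. (w, k) \<in> dp_vars f \<longrightarrow> k \<le> m)"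
proof -
  let ?K = "{k. (w, k) \<in> dp_vars f}"
  have "?K \<subseteq> snd ` dp_vars f" by force
  then have "finite ?K" by (rule finite_subset) simp
  then show ?thesis using Max_eq_iff[of ?K m] by (auto simp: dp_ord_in_def)
qed

lemma dp_ord_in_less_FinI:
  assumes "\<And>k. (w, k) \<in> dp_vars f \<Longrightarrow> k < m"
  shows "dp_ord_in w f < Fin m"
proof (cases "\<exists>k. (w, k) \<in> dp_vars f")
  case True
  then obtain n where n: "dp_ord_in w f = Fin n" by (auto simp: dp_ord_in_def)
  then have "(w, n) \<in> dp_vars f" by (simp add: dp_ord_in_eq_Fin_iff)
  then show ?thesis using assms by (simp add: n)
qed (simp add: dp_ord_in_def)

lemma linear_keys:
  fixes P :: "(unit, 'a::zero) dpoly"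
  assumes "dp_degree P \<le> 1" "m \<in> keys P"
  shows "m = 0 \<or> (\<exists>k. m = single ((), k) 1)"
proof (cases "m = 0")
  case False
  then obtain v where v: "v \<in> keys m" by (metis all_not_in_conv keys_eq_empty)
  have "(\<Sum>v\<in>keys m. lookup m v) \<le> 1"
    using assms unfolding dp_degree_def by (simp add: Max_le_iff)
  then have "lookup m v + (\<Sum>v\<in>keys m - {v}. lookup m v) \<le> 1"
    using v by (simp add: sum.remove)
  moreover have "0 < lookup m v" using v by (simp add: in_keys_iff)
  ultimately have m: "lookup m v = 1" "(\<Sum>v\<in>keys m - {v}. lookup m v) = 0"
    by linarith+
  then have "\<forall>w\<in>keys m - {v}. lookup m w = 0" by simp
  then have "lookup m w = 0" if "w \<noteq> v" for w
    using that in_keys_iff[of w m] by blast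
  then have "m = single v 1"
    using m(1) by (intro poly_mapping_eqI) (auto simp: lookup_single when_def)
  then show ?thesis by (cases v) auto
qed simp

lemma lin_coeff_dp_vars:
  fixes P :: "(unit, 'a::zero) dpoly"
  assumes "dp_degree P \<le> 1"
  shows "((), k) \<in> dp_vars P \<longleftrightarrow> lin_coeff P k \<noteq> 0"
proof
  assume "((), k) \<in> dp_vars P"
  then obtain m where m: "m \<in> keys P" "((), k) \<in> keys m"
    by (auto simp: dp_vars_def)
  then have "m = single ((), k) 1" using linear_keys[OF assms m(1)] by auto
  then show "lin_coeff P k \<noteq> 0" using m(1) by (simp add: in_keys_iff)
next
  assume "lin_coeff P k \<noteq> 0"
  then have "single ((), k) 1 \<in> keys P" by (simp add: in_keys_iff)
  then show "((), k) \<in> dp_vars P" unfolding dp_vars_def by (rule UN_I) simp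
qed

lemma fraction_ord_vars:
  assumes "fraction_ord P Q = Fin m"
  shows "((), m) \<in> dp_vars P \<union> dp_vars Q" "((), k) \<in> dp_vars P \<union> dp_vars Q \<Longrightarrow> k \<le> m"
proof -
  have max: "max (dp_ord_in () P) (dp_ord_in () Q) = Fin m" using assms by (simp add: fraction_ord_def)
  then have "dp_ord_in () P = Fin m \<or> dp_ord_in () Q = Fin m" by (auto simp: max_def split: if_splits)
  then show "((), m) \<in> dp_vars P \<union> dp_vars Q" unfolding dp_ord_in_eq_Fin_iff by blast
  have le: "k \<le> m" if k: "((), k) \<in> dp_vars f" "dp_ord_in () f \<le> Fin m" for f :: "(unit, 'a) dpoly"
  proof -
    have "dp_ord_in () f = Fin (Max {k. ((), k) \<in> dp_vars f})"
      unfolding dp_ord_in_def by (rule if_P) (use k(1) in blast)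
    then obtain n where n: "dp_ord_in () f = Fin n" by blast
    then have "k \<le> n" using k(1) by (simp add: dp_ord_in_eq_Fin_iff)
    then show ?thesis using n k(2) by simp
  qed
  have "dp_ord_in () P \<le> Fin m" "dp_ord_in () Q \<le> Fin m" using max by (metis max.cobounded1, metis max.cobounded2)
  then show "((), k) \<in> dp_vars P \<union> dp_vars Q \<Longrightarrow> k \<le> m" using le by blast
qed

lemma lookup_implicit_poly:
  "lookup (implicit_poly w P Q) m =
     pvar (w, 0) * dp_const (lookup Q m) - dp_const (lookup P m)"
proof -
  interpret const: comm_ring_hom "dp_const :: 'a \<Rightarrow> (xy, 'a) dpoly" by (rule comm_ring_hom_dp_const)
  show ?thesis
    unfolding implicit_poly_def dp_var_pvar dp_const_def[of "pvar (w, 0)"] mult_map_scale_conv_mult[symmetric]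
    by (simp add: lookup_minus lookup_map_zero)
qed

lemma pvar_mult_const_diff_eq_0_iff:
  "pvar v * dp_const q - dp_const p = (0 :: ('w, 'a::comm_ring_1) dpoly) \<longleftrightarrow> q = 0 \<and> p = 0"
proof -
  have eq: "pvar v * dp_const q - dp_const p = single (single v 1) q - single 0 p"
    by (simp add: pvar_def dp_const_def mult_single)
  show ?thesis
  proof
    assume 0: "pvar v * dp_const q - dp_const p = 0"
    have "lookup (pvar v * dp_const q - dp_const p) (single v 1) = q"
      "lookup (pvar v * dp_const q - dp_const p) 0 = - p"
      unfolding eq by (simp_all add: lookup_minus lookup_single when_def del: One_nat_def)
    then show "q = 0 \<and> p = 0" unfolding 0 by simp
  qed (simp add: dp_const_def)
qed

text \<open>
  Each differentiation of \<open>w Q(u) - P(u)\<close> raises the highest derivative of \<open>w\<close> by one and leaves its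
  coefficient, which comes from \<open>Q\<close>, unchanged.
\<close>

context derivation_ring
begin

lemma dp_vars_linear_in_var:
  assumes "dp_vars t \<subseteq> {w} \<times> {..<k}"
  shows "dp_vars (pvar (w, k) * dp_const (q :: 'a) + t) \<subseteq> {w} \<times> {..<Suc k}"
proof -
  have "dp_vars (pvar (w, k) * dp_const q) \<subseteq> {(w, k)}"
    using dp_vars_mult[of "pvar (w, k)" "dp_const q"] by simp
  also have "\<dots> \<subseteq> {w} \<times> {..<Suc k}" by simp
  finally have "dp_vars (pvar (w, k) * dp_const q) \<subseteq> {w} \<times> {..<Suc k}" .
  moreover have "dp_vars t \<subseteq> {w} \<times> {..<Suc k}" using assms by (rule order_trans) auto
  ultimately show ?thesis by (intro order_trans[OF dp_vars_add] Un_least)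
qed

lemma derivative_of_linear_in_var:
  assumes "f = pvar (w, k) * dp_const q + t" "dp_vars t \<subseteq> {w} \<times> {..<k}"
  shows "\<exists>t'. dp_deriv d f = pvar (w, Suc k) * dp_const q + t' \<and> dp_vars t' \<subseteq> {w} \<times> {..<Suc k}"
proof -
  let ?t = "pvar (w, k) * dp_const (d q) + dp_deriv d t"
  have "dp_vars ?t \<subseteq> {w} \<times> {..<Suc k}"
    using dp_vars_add[of "pvar (w, k) * dp_const (d q)" "dp_deriv d t"]
      dp_vars_mult[of "pvar (w, k)" "dp_const (d q)"] dp_vars_deriv[of d t] assms(2)
    by fastforce
  moreover have "dp_deriv d f = pvar (w, Suc k) * dp_const q + ?t"
    unfolding assms(1) by (simp add: dp_deriv_add dp_deriv_mult add_ac)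
  ultimately show ?thesis by blast
qed

lemma derivative_const_shape:
  "\<exists>t. (dp_deriv d ^^ k) (pvar (w, 0) * dp_const q - dp_const p) = pvar (w, k) * dp_const q + t \<and>
       dp_vars t \<subseteq> {w} \<times> {..<k}"
proof (induction k)
  case 0
  show ?case by (intro exI[of _ "- dp_const p"]) simp
next
  case (Suc k)
  then obtain t where t: "(dp_deriv d ^^ k) (pvar (w, 0) * dp_const q - dp_const p) = pvar (w, k) * dp_const q + t"
    "dp_vars t \<subseteq> {w} \<times> {..<k}" by blast
  show ?case using derivative_of_linear_in_var[OF t] by simp
qed

lemma deriv_coeffs_shape:
  assumes "\<And>j. c j = pvar (w, 0) * dp_const (q j) - dp_const (p j)"
  shows "\<exists>t. deriv_coeffs (dp_deriv d) c k j = pvar (w, k) * dp_const (q j) + t \<and> dp_vars t \<subseteq> {w} \<times> {..<k}"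
proof (induction k arbitrary: j)
  case 0
  show ?case by (intro exI[of _ "- dp_const (p j)"]) (simp add: assms)
next
  case (Suc k)
  obtain t where t: "dp_deriv d (deriv_coeffs (dp_deriv d) c k j) = pvar (w, Suc k) * dp_const (q j) + t"
    "dp_vars t \<subseteq> {w} \<times> {..<Suc k}"
  proof -
    obtain t where t: "deriv_coeffs (dp_deriv d) c k j = pvar (w, k) * dp_const (q j) + t"
      "dp_vars t \<subseteq> {w} \<times> {..<k}" using Suc[of j] by blast
    show ?thesis using derivative_of_linear_in_var[OF t] that by blast
  qed
  obtain s where s: "deriv_coeffs (dp_deriv d) c k (j - 1) = pvar (w, k) * dp_const (q (j - 1)) + s"
    "dp_vars s \<subseteq> {w} \<times> {..<k}" using Suc[of "j - 1"] by blast
  let ?e = "if j = 0 then 0 else deriv_coeffs (dp_deriv d) c k (j - 1)"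
  have "dp_vars ?e \<subseteq> {w} \<times> {..<Suc k}"
    using dp_vars_linear_in_var[OF s(2), of "q (j - 1)"] unfolding s(1) by simp
  then have "dp_vars (t + ?e) \<subseteq> {w} \<times> {..<Suc k}" using t(2) dp_vars_add[of t ?e] by blast
  then show ?case using t(1) by (intro exI[of _ "t + ?e"]) (simp add: add.assoc)
qed

end

lemma linear_in_var_degree:
  fixes t :: "('w, 'a::comm_ring_1) dpoly"
  assumes "dp_vars t \<subseteq> {w} \<times> {..<k}" "w' = w \<Longrightarrow> k \<le> n"
  shows "dp_degree_in (w', n) (pvar (w, k) * dp_const q + t) \<le> (if w' = w \<and> n = k then 1 else 0)"
proof -
  have "dp_degree_in (w', n) t = 0" using assms by (auto simp: dp_degree_in_eq_0_iff)
  moreover have "dp_degree_in (w', n) (pvar (w, k) * dp_const q) \<le> (if w' = w \<and> n = k then 1 else 0)"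
    by (auto simp: pvar_def dp_const_def mult_single dp_degree_in_le_iff lookup_single when_def)
  ultimately show ?thesis using dp_degree_in_add_le[of "(w', n)" "pvar (w, k) * dp_const q" t] by auto
qed

lemma hom_deriv_coeffs:
  assumes "\<And>x y. h (x + y) = h x + h y" "h 0 = 0" "\<And>x. h (d x) = D (h x)"
  shows "h (deriv_coeffs d c k j) = deriv_coeffs D (\<lambda>j. h (c j)) k j"
  by (induction k arbitrary: j) (simp_all add: assms)

lemma dp_eval_linear_form:
  assumes "comm_ring_hom \<kappa>"
  shows "dp_eval \<kappa> D (\<lambda>_. u) (linear_form c0 c n) = \<kappa> c0 + (\<Sum>k\<le>n. \<kappa> (c k) * (D ^^ k) u)"
proof -
  interpret comm_ring_hom \<kappa> by fact
  interpret e: comm_ring_hom "ev \<kappa> (\<lambda>(w, k). (D ^^ k) u) :: (unit, 'a) dpoly \<Rightarrow> _" by (rule ev_comm_ring_hom)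
  show ?thesis unfolding dp_eval_ev linear_form_def
    by (simp add: e.hom_add e.hom_sum e.hom_mult)
qed

text \<open>
  The two coordinates are indexed by \<^typ>\<open>xy\<close>, so that what holds for one of them is shown for both.
\<close>

locale linear_curve = transcendental_extension \<delta> D \<iota> u
  for \<delta> :: "'f::field \<Rightarrow> 'f" and D :: "'e::field \<Rightarrow> 'e" and \<iota> :: "'f \<Rightarrow> 'e" and u :: 'e +
  fixes P Q :: "xy \<Rightarrow> (unit, 'f) dpoly" and m :: "xy \<Rightarrow> nat"
  assumes Q_neq_0: "Q w \<noteq> 0" and coprime_PQ: "dp_coprime (P w) (Q w)"
    and linear: "dp_degree (P w) \<le> 1" "dp_degree (Q w) \<le> 1"
    and ord_PQ: "fraction_ord (P w) (Q w) = Fin (m w)"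
    and proper: "u \<in> adjoin D \<iota> {fraction_at \<iota> D u (P Xvar) (Q Xvar), fraction_at \<iota> D u (P Yvar) (Q Yvar)}"
begin

definition point :: "xy \<Rightarrow> 'e" where
  "point w = fraction_at \<iota> D u (P w) (Q w)"

lemma at_u_Q: "at_u (Q w) \<noteq> 0"
  using Q_neq_0 by (simp add: at_u_eq_0_iff)

lemma point_eq: "point w * at_u (Q w) = at_u (P w)"
  using at_u_Q[of w] by (simp add: point_def fraction_at_def at_u_def)

lemma lin_coeff_beyond:
  assumes "k > m w"
  shows "lin_coeff (P w) k = 0" "lin_coeff (Q w) k = 0"
proof -
  have "((), k) \<notin> dp_vars (P w) \<union> dp_vars (Q w)" using fraction_ord_vars(2)[OF ord_PQ[of w], of k] assms by force
  then show "lin_coeff (P w) k = 0" "lin_coeff (Q w) k = 0"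
    using lin_coeff_dp_vars[OF linear(1)[of w], of k] lin_coeff_dp_vars[OF linear(2)[of w], of k] by auto
qed

lemma lin_coeff_top: "lin_coeff (P w) (m w) \<noteq> 0 \<or> lin_coeff (Q w) (m w) \<noteq> 0"
  using fraction_ord_vars(1)[OF ord_PQ[of w]] lin_coeff_dp_vars[OF linear(1)[of w], of "m w"]
    lin_coeff_dp_vars[OF linear(2)[of w], of "m w"] by auto

lemma linear_form_PQ:
  "P w = linear_form (lookup (P w) 0) (lin_coeff (P w)) (m w)" (is ?P)
  "Q w = linear_form (lookup (Q w) 0) (lin_coeff (Q w)) (m w)" (is ?Q)
proof -
  have key: "n = 0 \<or> (\<exists>k\<le>m w. n = single ((), k) 1)"
    if n: "n \<in> keys f" and f: "dp_degree f \<le> 1" "dp_vars f \<subseteq> dp_vars (P w) \<union> dp_vars (Q w)"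
    for f :: "(unit, 'f) dpoly" and n
  proof (cases "n = 0")
    case False
    then obtain k where k: "n = single ((), k) 1" using linear_keys[OF f(1) n] by blast
    then have "((), k) \<in> dp_vars f" unfolding dp_vars_def using n by (intro UN_I[of n]) simp_all
    then have "k \<le> m w" using fraction_ord_vars(2)[OF ord_PQ[of w], of k] f(2) by blast
    then show ?thesis using k by blast
  qed simp
  show ?P by (rule linear_formI, rule key[OF _ linear(1)[of w] Un_upper1])
  show ?Q by (rule linear_formI, rule key[OF _ linear(2)[of w] Un_upper2])
qed

text \<open>
  If the top coefficients cancelled at the generic point, then \<open>P\<close> and \<open>Q\<close> would be proportional,
  because \<open>u\<close> satisfies no relation; but they are coprime and not both constant.
\<close>

lemma point_top: "point w * \<iota> (lin_coeff (Q w) (m w)) - \<iota> (lin_coeff (P w) (m w)) \<noteq> 0"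
proof
  let ?p = "lin_coeff (P w) (m w)" and ?q = "lin_coeff (Q w) (m w)"
  assume eq: "point w * \<iota> ?q - \<iota> ?p = 0"
  interpret const: comm_ring_hom "dp_const :: 'f \<Rightarrow> (unit, 'f) dpoly" by (rule comm_ring_hom_dp_const)
  have const: "at_u (dp_const c) = \<iota> c" for c by (simp add: at_u_def dp_eval_ev \<iota>.ev_const)
  have "dp_const c = (0 :: (unit, 'f) dpoly) \<longleftrightarrow> c = 0" for c
    using const.hom_zero by (metis dp_const_def lookup_single_eq lookup_zero)
  then have \<iota>0: "\<iota> c = 0 \<longleftrightarrow> c = 0" for c
    using at_u_eq_0_iff[of "dp_const c"] const[of c] by simp
  have q0: "?q \<noteq> 0"
  proof
    assume "?q = 0"
    then have "\<iota> ?p = 0" using eq \<iota>.hom_zero by simp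
    then show False using lin_coeff_top[of w] \<open>?q = 0\<close> \<iota>0 by blast
  qed
  have "at_u (dp_const ?p * Q w - dp_const ?q * P w) = 0"
    using eq by (simp add: at_u.hom_minus at_u.hom_mult const algebra_simps flip: point_eq)
  then have "dp_const ?p * Q w = dp_const ?q * P w" by (simp only: at_u_eq_0_iff right_minus_eq)
  then have "dp_const (inverse ?q) * (dp_const ?p * Q w) = dp_const (inverse ?q) * (dp_const ?q * P w)"
    by (simp only:)
  also have "\<dots> = dp_const (inverse ?q * ?q) * P w" by (simp only: const.hom_mult mult.assoc)
  also have "\<dots> = P w" using q0 by (simp add: const.hom_one)
  finally have Pw: "P w = (dp_const (inverse ?q) * dp_const ?p) * Q w" by (simp only: mult.assoc)
  then have "Q w dvd P w" by (metis dvd_triv_right)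
  then have "Q w dvd 1"
    by (rule coprime_PQ[of w, unfolded dp_coprime_def, rule_format]) (rule dvd_refl)
  then have "dp_vars (Q w) = {}" by (simp add: dp_unit_iff)
  moreover have "dp_vars (P w) = {}"
    using dp_vars_mult[of "dp_const (inverse ?q) * dp_const ?p" "Q w"]
      dp_vars_mult[of "dp_const (inverse ?q)" "dp_const ?p :: (unit, 'f) dpoly"] \<open>dp_vars (Q w) = {}\<close>
    by (subst Pw) simp
  ultimately show False using fraction_ord_vars(1)[OF ord_PQ[of w]] by simp
qed

text \<open>The operator of \<open>w Q(u) - P(u)\<close> at the generic point; up to a factor, it is the differential of \<open>w\<close>.\<close>

definition operator :: "xy \<Rightarrow> 'e poly" where
  "operator w = (\<Sum>k\<le>m w. monom (point w * \<iota> (lin_coeff (Q w) k) - \<iota> (lin_coeff (P w) k)) k)"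

lemma coeff_operator: "coeff (operator w) k = point w * \<iota> (lin_coeff (Q w) k) - \<iota> (lin_coeff (P w) k)"
  using lin_coeff_beyond[of w k] \<iota>.hom_zero by (auto simp: operator_def coeff_sum_monom)

lemma degree_operator: "degree (operator w) = m w" "operator w \<noteq> 0"
proof -
  have "coeff (operator w) (m w) \<noteq> 0" using point_top by (simp add: coeff_operator)
  moreover have "degree (operator w) \<le> m w" unfolding operator_def by (rule degree_sum_monom)
  ultimately show "degree (operator w) = m w" "operator w \<noteq> 0" by (auto intro!: antisym le_degree)
qed

definition dual_point :: "xy \<Rightarrow> 'e dual" where
  "dual_point w = at_du (P w) *
     Dual (inverse (at_u (Q w))) (- smult (inverse (at_u (Q w)) ^ 2) (diff (at_du (Q w))))"

lemma dual_point_mult: "dual_point w * at_du (Q w) = at_du (P w)"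
proof -
  have "dual_point w * at_du (Q w) = at_du (P w) * (at_du (Q w) *
      Dual (inverse (at_u (Q w))) (- smult (inverse (at_u (Q w)) ^ 2) (diff (at_du (Q w)))))"
    unfolding dual_point_def by (simp only: mult_ac)
  then show ?thesis using dual_unit[of "at_du (Q w)"] at_u_Q[of w] by simp
qed

lemma dual_point_differentials: "dual_point w \<in> differentials"
  using at_u_Q dual_point_mult by (rule differentialsI)

lemma base_dual_point: "base (dual_point w) = point w"
  by (simp add: dual_point_def point_def fraction_at_def at_u_def divide_inverse)

lemma diff_at_du_linear_form: "diff (at_du (linear_form c0 c n)) = (\<Sum>k\<le>n. monom (\<iota> (c k)) k)"
proof -
  have T1: "(dshift D ^^ k) 1 = monom 1 k" for k
    by (induction k) (simp_all add: one_pCons monom_0 D.dshift_monom)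
  have dsum: "diff (\<Sum>k\<le>n. f k) = (\<Sum>k\<le>n. diff (f k))" for f :: "nat \<Rightarrow> 'e dual" and n
    by (induction n) simp_all
  show ?thesis
    unfolding at_du_def dp_eval_linear_form[OF dual.comm_ring_hom_axioms]
    by (simp add: dsum T1 smult_monom)
qed

lemma operator_diff: "operator w = smult (- at_u (Q w)) (diff (dual_point w))"
proof -
  have "smult (point w) (diff (at_du (Q w))) + smult (at_u (Q w)) (diff (dual_point w)) =
      diff (at_du (P w))"
    using arg_cong[OF dual_point_mult[of w], of diff] by (simp add: base_dual_point)
  moreover have "operator w = smult (point w) (diff (at_du (Q w))) - diff (at_du (P w))"
  proof -
    have "diff (at_du (P w)) = (\<Sum>k\<le>m w. monom (\<iota> (lin_coeff (P w) k)) k)"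
      by (subst linear_form_PQ(1)) (rule diff_at_du_linear_form)
    moreover have "diff (at_du (Q w)) = (\<Sum>k\<le>m w. monom (\<iota> (lin_coeff (Q w) k)) k)"
      by (subst linear_form_PQ(2)) (rule diff_at_du_linear_form)
    ultimately show ?thesis
      by (intro poly_eqI) (simp add: operator_def coeff_sum_monom)
  qed
  ultimately have "operator w = smult (point w) (diff (at_du (Q w))) -
      (smult (point w) (diff (at_du (Q w))) + smult (at_u (Q w)) (diff (dual_point w)))"
    by (simp only:)
  then show ?thesis by simp
qed

lemma right_coprime_diff: "right_coprime D (diff (dual_point Xvar)) (diff (dual_point Yvar))"
  using generators_right_coprime[OF dual_point_differentials dual_point_differentials, of Xvar Yvar] proper
  by (simp add: base_dual_point point_def)

lemma right_coprime_operator: "right_coprime D (operator Xvar) (operator Yvar)"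
  unfolding operator_diff using right_coprime_diff at_u_Q by (subst right_coprime_smult) auto

lemma degree_diff_dual_point: "degree (diff (dual_point w)) = m w" "diff (dual_point w) \<noteq> 0"
  using degree_operator[of w] at_u_Q[of w] unfolding operator_diff by auto

subsection \<open>The resultant\<close>

definition at_point :: "(xy, 'f) dpoly \<Rightarrow> 'e" where
  "at_point f = dp_eval \<iota> D point f"

sublocale at_point: comm_ring_hom at_point
  unfolding at_point_def dp_eval_ev by (rule \<iota>.ev_comm_ring_hom)

lemma at_point_deriv: "D (at_point f) = at_point (dp_deriv \<delta> f)"
  unfolding at_point_def by (rule \<delta>.dp_eval_deriv[OF \<iota>.comm_ring_hom_axioms D.derivation_ring_axioms \<iota>_\<delta>])

lemma at_point_pvar: "at_point (pvar (w, 0)) = point w"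
  unfolding at_point_def dp_eval_ev by (simp add: \<iota>.ev_pvar)

lemma at_point_const: "at_point (dp_const c) = \<iota> c"
  unfolding at_point_def dp_eval_ev by (rule \<iota>.ev_const)

definition coeff1 :: "xy \<Rightarrow> nat \<Rightarrow> (xy, 'f) dpoly" where
  "coeff1 w j = pvar (w, 0) * dp_const (lin_coeff (Q w) j) - dp_const (lin_coeff (P w) j)"

definition coeff0 :: "xy \<Rightarrow> (xy, 'f) dpoly" where
  "coeff0 w = pvar (w, 0) * dp_const (lookup (Q w) 0) - dp_const (lookup (P w) 0)"

lemma coeff1_beyond: "j > m w \<Longrightarrow> coeff1 w j = 0"
  using lin_coeff_beyond[where w=w and k=j] by (simp add: coeff1_def dp_const_def)

lemma implicit_poly_linear_form: "implicit_poly w (P w) (Q w) = linear_form (coeff0 w) (coeff1 w) (m w)"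
proof (rule poly_mapping_eqI)
  fix n
  have lf: "lookup f n = lookup (linear_form (lookup f 0) (lin_coeff f) (m w)) n"
    if "f = linear_form (lookup f 0) (lin_coeff f) (m w)" for f :: "(unit, 'f) dpoly"
    using that by (simp only:)
  consider "n = 0" | j where "n = single ((), j) 1"
    | "0 \<noteq> n" "\<And>j. single ((), j) 1 \<noteq> n" by blast
  then show "lookup (implicit_poly w (P w) (Q w)) n =
      lookup (linear_form (coeff0 w) (coeff1 w) (m w)) n"
  proof cases
    case 1
    then show ?thesis by (simp add: lookup_implicit_poly lookup_linear_form_simps coeff0_def)
  next
    case 2
    then have "lookup (implicit_poly w (P w) (Q w)) n = coeff1 w j"
      by (simp only: lookup_implicit_poly coeff1_def)
    then show ?thesis unfolding 2 lookup_linear_form_simps using coeff1_beyond[of w j] by simp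
  next
    case 3
    have "lookup f n = 0"
      if "f = linear_form (lookup f 0) (lin_coeff f) (m w)" for f :: "(unit, 'f) dpoly"
      by (subst that) (use 3 in \<open>simp add: lookup_linear_form del: One_nat_def\<close>)
    from this[OF linear_form_PQ(1)] this[OF linear_form_PQ(2)] show ?thesis
      using 3 by (simp add: lookup_implicit_poly lookup_linear_form dp_const_def del: One_nat_def)
  qed
qed

lemma dp_ord_implicit_poly: "dp_ord_in () (implicit_poly w (P w) (Q w)) = Fin (m w)"
  unfolding dp_ord_in_eq_Fin_iff
proof (intro conjI allI impI)
  let ?f = "implicit_poly w (P w) (Q w)"
  have key: "n \<in> keys ?f \<longleftrightarrow> n \<in> keys (P w) \<or> n \<in> keys (Q w)" for n
    using pvar_mult_const_diff_eq_0_iff[of "(w, 0)" "lookup (Q w) n" "lookup (P w) n"]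
    by (auto simp: in_keys_iff lookup_implicit_poly)
  then have "dp_vars ?f = dp_vars (P w) \<union> dp_vars (Q w)" unfolding dp_vars_def by blast
  then show "((), m w) \<in> dp_vars ?f" "((), k) \<in> dp_vars ?f \<Longrightarrow> k \<le> m w" for k
    using fraction_ord_vars[OF ord_PQ[of w]] by auto
qed

definition resultant :: "(xy, 'f) dpoly" where
  "resultant = diff_resultant (dp_deriv \<delta>) (implicit_poly Xvar (P Xvar) (Q Xvar)) (implicit_poly Yvar (P Yvar) (Q Yvar))"

lemma resultant_det:
  "resultant = det (resultant_matrix (m Xvar) (m Yvar)
     (deriv_coeffs (dp_deriv \<delta>) (coeff1 Xvar)) (\<lambda>k. (dp_deriv \<delta> ^^ k) (coeff0 Xvar))
     (deriv_coeffs (dp_deriv \<delta>) (coeff1 Yvar)) (\<lambda>k. (dp_deriv \<delta> ^^ k) (coeff0 Yvar)))"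
  unfolding resultant_def
  by (rule diff_resultant_linear_forms[OF \<delta>.dp_deriv_derivation])
    (simp_all add: implicit_poly_linear_form coeff1_beyond dp_ord_implicit_poly[unfolded implicit_poly_linear_form])

lemma at_point_coeff1: "at_point (deriv_coeffs (dp_deriv \<delta>) (coeff1 w) k j) = coeff ((dshift D ^^ k) (operator w)) j"
proof -
  have "at_point (coeff1 w j) = coeff (operator w) j" for j
    by (simp add: coeff1_def coeff_operator at_point.hom_minus at_point.hom_mult at_point_pvar at_point_const)
  then have "at_point (deriv_coeffs (dp_deriv \<delta>) (coeff1 w) k j) = deriv_coeffs D (coeff (operator w)) k j"
    by (subst hom_deriv_coeffs[where D=D]) (simp_all add: at_point.hom_add at_point.hom_zero at_point_deriv)
  then show ?thesis by (simp add: deriv_coeffs_dshift[OF D.derivation_ring_axioms])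
qed

text \<open>
  The \<open>k\<close>-th derivative of \<open>w Q(u) - P(u)\<close> vanishes at the generic point.
\<close>

lemma row_relation:
  assumes "m w + k \<le> n"
  shows "(\<Sum>j\<le>n. coeff ((dshift D ^^ k) (operator w)) j * (D ^^ j) u) + at_point ((dp_deriv \<delta> ^^ k) (coeff0 w)) = 0"
proof -
  interpret dd: derivation_ring "dp_deriv \<delta> :: (xy, 'f) dpoly \<Rightarrow> _" by (rule \<delta>.dp_deriv_derivation)
  let ?f = "linear_form (coeff0 w) (coeff1 w) (m w)"
  have PQ: "at_u f = \<iota> (lookup f 0) + (\<Sum>k\<le>m w. \<iota> (lin_coeff f k) * (D ^^ k) u)"
    if "f = linear_form (lookup f 0) (lin_coeff f) (m w)" for f
    by (subst that) (simp only: at_u_def dp_eval_linear_form[OF \<iota>.comm_ring_hom_axioms])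
  have "dp_eval at_point D (\<lambda>_. u) ?f = at_point (coeff0 w) + (\<Sum>k\<le>m w. at_point (coeff1 w k) * (D ^^ k) u)"
    by (rule dp_eval_linear_form[OF at_point.comm_ring_hom_axioms])
  also have "\<dots> = point w * at_u (Q w) - at_u (P w)"
    unfolding PQ[OF linear_form_PQ(1)] PQ[OF linear_form_PQ(2)]
    by (simp add: coeff1_def coeff0_def at_point.hom_minus at_point.hom_mult at_point_pvar at_point_const
        algebra_simps sum_distrib_left sum_subtractf)
  also have "\<dots> = 0" by (simp add: point_eq)
  finally have "(D ^^ k) (dp_eval at_point D (\<lambda>_. u) ?f) = (D ^^ k) 0" by (simp only:)
  also have "(D ^^ k) 0 = 0" by (induction k) simp_all
  finally have "0 = dp_eval at_point D (\<lambda>_. u) ((dp_deriv (dp_deriv \<delta>) ^^ k) ?f)"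
    by (simp only: dd.dp_eval_deriv_iterate[OF at_point.comm_ring_hom_axioms D.derivation_ring_axioms at_point_deriv])
  also have "\<dots> = at_point ((dp_deriv \<delta> ^^ k) (coeff0 w)) +
      (\<Sum>j\<le>m w + k. coeff ((dshift D ^^ k) (operator w)) j * (D ^^ j) u)"
    by (subst dd.dp_deriv_iterate_linear_form)
      (simp_all add: coeff1_beyond dp_eval_linear_form[OF at_point.comm_ring_hom_axioms] at_point_coeff1)
  also have "(\<Sum>j\<le>m w + k. coeff ((dshift D ^^ k) (operator w)) j * (D ^^ j) u) =
      (\<Sum>j\<le>n. coeff ((dshift D ^^ k) (operator w)) j * (D ^^ j) u)"
    using assms degree_operator[of w]
    by (intro sum.mono_neutral_left) (auto intro!: coeff_eq_0 simp: D.degree_dshift_iterate)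
  finally show ?thesis by (simp add: add.commute)
qed

lemma resultant_vanishes: "at_point resultant = 0"
  unfolding resultant_det at_point.hom_det_resultant_matrix
  by (rule det_resultant_matrix_eq_0I[where w = "\<lambda>j. (D ^^ j) u"])
    (simp_all only: at_point_coeff1, (rule row_relation; simp)+)

text \<open>
  The substitution \<open>\<pi>\<close> adds 1 to the value of the derivative of \<open>x\<close> of order \<open>m Yvar\<close>. In the
  matrix this derivative occurs only in the first row, with the coefficients of \<open>Q Xvar\<close>. These
  combine to the value of \<open>Q Xvar\<close> at \<open>u\<close>, which is not zero.
\<close>

lemma resultant_neq_0: "resultant \<noteq> 0"
proof
  let ?n = "m Xvar + m Yvar"
  define \<pi> where "\<pi> = ev \<iota> (\<lambda>v. (D ^^ snd v) (point (fst v)) + (if v = (Xvar, m Yvar) then 1 else 0))"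
  interpret \<pi>: comm_ring_hom "\<pi> :: (xy, 'f) dpoly \<Rightarrow> 'e" unfolding \<pi>_def by (rule \<iota>.ev_comm_ring_hom)
  have free: "\<pi> f = at_point f" if "(Xvar, m Yvar) \<notin> dp_vars f" for f
    unfolding \<pi>_def at_point_def dp_eval_ev case_prod_unfold using that by (intro ev_cong) auto
  have shape: "\<pi> f = at_point f + (if w = Xvar \<and> k = m Yvar then \<iota> q else 0)"
    if f: "f = pvar (w, k) * dp_const q + t" "dp_vars t \<subseteq> {w} \<times> {..<k}" and k: "w = Xvar \<Longrightarrow> k \<le> m Yvar"
    for f w k q t
  proof (cases "w = Xvar \<and> k = m Yvar")
    case True
    have "\<pi> (pvar (w, k)) = at_point (pvar (w, k)) + 1"
      using True by (simp add: \<pi>_def at_point_def dp_eval_ev \<iota>.ev_pvar case_prod_unfold)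
    moreover have "\<pi> t = at_point t" "\<pi> (dp_const q) = at_point (dp_const q)" using f(2) True by (auto intro!: free)
    ultimately show ?thesis
      using True unfolding f(1) by (simp add: \<pi>.hom_add \<pi>.hom_mult at_point.hom_add at_point.hom_mult at_point_const algebra_simps)
  next
    case False
    have "dp_vars f \<subseteq> {w} \<times> {..k}"
      using dp_vars_add[of "pvar (w, k) * dp_const q" t] dp_vars_mult[of "pvar (w, k)" "dp_const q"] f by fastforce
    then show ?thesis using False k by (subst free) auto
  qed
  have e: "\<pi> (deriv_coeffs (dp_deriv \<delta>) (coeff1 w) k j) =
      coeff ((dshift D ^^ k) (operator w)) j + (if w = Xvar \<and> k = m Yvar then \<iota> (lin_coeff (Q w) j) else 0)"
    if "w = Xvar \<Longrightarrow> k \<le> m Yvar" for w k j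
    using \<delta>.deriv_coeffs_shape[of "coeff1 w", OF coeff1_def, of k j] shape that
    unfolding at_point_coeff1[symmetric] by blast
  have g: "\<pi> ((dp_deriv \<delta> ^^ k) (coeff0 w)) =
      at_point ((dp_deriv \<delta> ^^ k) (coeff0 w)) + (if w = Xvar \<and> k = m Yvar then \<iota> (lookup (Q w) 0) else 0)"
    if "w = Xvar \<Longrightarrow> k \<le> m Yvar" for w k
    using \<delta>.derivative_const_shape[of k w "lookup (Q w) 0" "lookup (P w) 0"] shape that
    unfolding coeff0_def[symmetric] by blast
  have "(\<Sum>j\<le>?n. \<iota> (lin_coeff (Q Xvar) j) * (D ^^ j) u) = (\<Sum>j\<le>m Xvar. \<iota> (lin_coeff (Q Xvar) j) * (D ^^ j) u)"
    using lin_coeff_beyond(2)[of Xvar] by (intro sum.mono_neutral_right) (auto simp: \<iota>.hom_zero)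
  also have "\<dots> + \<iota> (lookup (Q Xvar) 0) = at_u (Q Xvar)"
    by (subst (3) linear_form_PQ(2)) (simp only: at_u_def dp_eval_linear_form[OF \<iota>.comm_ring_hom_axioms] add.commute)
  finally have pert: "(\<Sum>j\<le>?n. \<iota> (lin_coeff (Q Xvar) j) * (D ^^ j) u) + \<iota> (lookup (Q Xvar) 0) \<noteq> 0"
    using at_u_Q by simp
  have "\<pi> resultant = det (resultant_matrix (m Xvar) (m Yvar)
      (\<lambda>k j. coeff ((dshift D ^^ k) (operator Xvar)) j + (if k = m Yvar then \<iota> (lin_coeff (Q Xvar) j) else 0))
      (\<lambda>k. at_point ((dp_deriv \<delta> ^^ k) (coeff0 Xvar)) + (if k = m Yvar then \<iota> (lookup (Q Xvar) 0) else 0))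
      (\<lambda>k j. coeff ((dshift D ^^ k) (operator Yvar)) j) (\<lambda>k. at_point ((dp_deriv \<delta> ^^ k) (coeff0 Yvar))))"
    unfolding resultant_det \<pi>.hom_det_resultant_matrix
    by (rule arg_cong[of _ _ det], rule resultant_matrix_cong) (simp_all add: e g)
  also have "\<dots> \<noteq> 0"
    by (rule perturbed_resultant_neq_0[OF D.derivation_ring_axioms right_coprime_operator degree_operator(2) degree_operator(2)
          degree_operator(1) degree_operator(1) _ _ pert])
      (rule row_relation; simp)+
  finally have "\<pi> resultant \<noteq> 0" .
  moreover assume "resultant = 0"
  ultimately show False by (simp add: \<pi>.hom_zero)
qed

lemma resultant_degree:
  "dp_degree_in (Xvar, m Yvar) resultant \<le> 1" "dp_degree_in (Yvar, m Xvar) resultant \<le> 1"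
  "k > m Yvar \<Longrightarrow> (Xvar, k) \<notin> dp_vars resultant" "k > m Xvar \<Longrightarrow> (Yvar, k) \<notin> dp_vars resultant"
proof -
  have e: "dp_degree_in (w', n) (deriv_coeffs (dp_deriv \<delta>) (coeff1 w) k j) \<le> (if w' = w \<and> n = k then 1 else 0)"
    if "w' = w \<Longrightarrow> k \<le> n" for w' n w k j
  proof -
    obtain t where t: "deriv_coeffs (dp_deriv \<delta>) (coeff1 w) k j = pvar (w, k) * dp_const (lin_coeff (Q w) j) + t"
      "dp_vars t \<subseteq> {w} \<times> {..<k}"
      using \<delta>.deriv_coeffs_shape[of "coeff1 w", OF coeff1_def, of k j] by blast
    show ?thesis unfolding t(1) by (rule linear_in_var_degree[OF t(2)]) (rule that)
  qed
  have g: "dp_degree_in (w', n) ((dp_deriv \<delta> ^^ k) (coeff0 w)) \<le> (if w' = w \<and> n = k then 1 else 0)"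
    if "w' = w \<Longrightarrow> k \<le> n" for w' n w k
  proof -
    obtain t where t: "(dp_deriv \<delta> ^^ k) (coeff0 w) = pvar (w, k) * dp_const (lookup (Q w) 0) + t"
      "dp_vars t \<subseteq> {w} \<times> {..<k}"
      using \<delta>.derivative_const_shape[of k w "lookup (Q w) 0" "lookup (P w) 0"]
      unfolding coeff0_def[symmetric] by blast
    show ?thesis unfolding t(1) by (rule linear_in_var_degree[OF t(2)]) (rule that)
  qed
  have X: "dp_degree_in (Xvar, n) resultant \<le> (\<Sum>k\<le>m Yvar. if n = k then 1 else 0)" if "n \<ge> m Yvar" for n
  proof -
    have "dp_degree_in (Xvar, n) resultant \<le> (\<Sum>k\<le>m Yvar. if n = k then 1 else 0) + (\<Sum>k\<le>m Xvar. 0)"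
      unfolding resultant_det
      by (rule dp_degree_in_det_resultant_matrix)
        (use e[of Xvar Xvar _ n] g[of Xvar Xvar _ n] e[of Xvar Yvar _ n] g[of Xvar Yvar _ n] that in auto)
    then show ?thesis by simp
  qed
  have Y: "dp_degree_in (Yvar, n) resultant \<le> (\<Sum>k\<le>m Xvar. if n = k then 1 else 0)" if "n \<ge> m Xvar" for n
  proof -
    have "dp_degree_in (Yvar, n) resultant \<le> (\<Sum>k\<le>m Yvar. 0) + (\<Sum>k\<le>m Xvar. if n = k then 1 else 0)"
      unfolding resultant_det
      by (rule dp_degree_in_det_resultant_matrix)
        (use e[of Yvar Yvar _ n] g[of Yvar Yvar _ n] e[of Yvar Xvar _ n] g[of Yvar Xvar _ n] that in auto)
    then show ?thesis by simp
  qed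
  show "dp_degree_in (Xvar, m Yvar) resultant \<le> 1" "dp_degree_in (Yvar, m Xvar) resultant \<le> 1"
    using X[of "m Yvar"] Y[of "m Xvar"] by simp_all
  show "(Xvar, k) \<notin> dp_vars resultant" if "k > m Yvar"
    using X[of k] that by (simp flip: dp_degree_in_eq_0_iff)
  show "(Yvar, k) \<notin> dp_vars resultant" if "k > m Xvar"
    using Y[of k] that by (simp flip: dp_degree_in_eq_0_iff)
qed

text \<open>
  The lower bounds on the orders in \<open>A\<close> make the resultant partially reduced, whatever indeterminate
  the leader of \<open>A\<close> comes from. So \<open>A\<close> divides it, and its upper bounds become upper bounds for \<open>A\<close>.
\<close>

theorem main_factor:
  fixes A :: "(xy, 'f) dpoly"
  assumes r: "ranking r" and irr: "dp_irreducible A" and ne: "A \<notin> range dp_const"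
    and sat: "vanishing_ideal \<iota> D point = sat \<delta> r A"
  shows "A dvd resultant" "resultant = A * B \<Longrightarrow> dp_ord B < dp_ord resultant"
    "dp_degree_in (Xvar, m Yvar) A = 1" "dp_degree_in (Yvar, m Xvar) A = 1"
proof -
  have mem: "f \<in> sat \<delta> r A \<longleftrightarrow> at_point f = 0" for f
    using sat by (auto simp: vanishing_ideal_def at_point_def)
  have vars: "dp_vars A \<noteq> {}" using ne dp_vars_empty_const[of A] by simp
  obtain w k where lead: "leader r A = (w, k)" by (cases "leader r A")
  have sep: "at_point (separant r A) \<noteq> 0"
  proof
    assume "at_point (separant r A) = 0"
    then have "separant r A \<in> sat \<delta> r A" using mem by simp
    then obtain n where "separant r A ^ n * separant r A \<in> diff_ideal \<delta> hull {A}" by (auto simp: sat_def)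
    then have "separant r A ^ Suc n * 1 \<in> diff_ideal \<delta> hull {A}" by (simp add: mult.commute)
    then have "1 \<in> sat \<delta> r A" unfolding sat_def by blast
    then show False using mem[of 1] at_point.hom_one by simp
  qed
  have "A \<in> sat \<delta> r A"
    unfolding sat_def by (auto intro!: exI[of _ 0] hull_inc)
  then have A0: "dp_eval \<iota> D (\<lambda>w. base (dual_point w)) A = 0"
    using mem by (simp add: base_dual_point at_point_def)
  have sep': "dp_eval \<iota> D (\<lambda>w. base (dual_point w)) (dp_pdiff (leader r A) A) \<noteq> 0"
    using sep by (simp add: base_dual_point at_point_def separant_def)
  obtain kx where kx: "kx \<ge> m Yvar" "(Xvar, kx) \<in> dp_vars A"
    using order_lower_bound(1)[OF dual_point_differentials degree_diff_dual_point(2) right_coprime_diff A0 sep']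
    by (auto simp: degree_diff_dual_point)
  obtain ky where ky: "ky \<ge> m Xvar" "(Yvar, ky) \<in> dp_vars A"
    using order_lower_bound(2)[OF dual_point_differentials degree_diff_dual_point(2) right_coprime_diff A0 sep']
    by (auto simp: degree_diff_dual_point)
  \<comment> \<open>the leader is the highest derivative of its indeterminate\<close>
  have top: "k' \<le> k" if k': "(w, k') \<in> dp_vars A" for k'
  proof (rule ccontr)
    assume "\<not> k' \<le> k"
    then have "((w, k), (w, k')) \<in> r" by (intro ranking_less[OF r]) simp
    moreover have "(w, k') \<noteq> leader r A" using lead \<open>\<not> k' \<le> k\<close> by auto
    then have "((w, k'), (w, k)) \<in> r"
      using leader_props(2)[OF r vars k'] lead by simp
    ultimately have "((w, k), (w, k)) \<in> r" by (rule ranking_trans[OF r])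
    then show False using ranking_irrefl[OF r] by simp
  qed
  have red: "(w, k + Suc j) \<notin> dp_vars resultant" for j
  proof (cases w)
    case Xvar
    then have "kx \<le> k" using top kx by simp
    then show ?thesis unfolding Xvar using kx by (intro resultant_degree(3)) simp
  next
    case Yvar
    then have "ky \<le> k" using top ky by simp
    then show ?thesis unfolding Yvar using ky by (intro resultant_degree(4)) simp
  qed
  have "separant r A \<noteq> 0" using sep at_point.hom_zero by auto
  then show dvd: "A dvd resultant"
    using irreducible_dvd_partially_reduced[OF \<delta>.derivation_ring_axioms r irr vars _ lead red]
      mem[of resultant] resultant_vanishes by simp
  have sub: "dp_vars A \<subseteq> dp_vars resultant" by (rule dp_vars_dvd[OF dvd resultant_neq_0])
  then have "kx \<le> m Yvar" "ky \<le> m Xvar"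
    using kx ky resultant_degree(3)[of kx] resultant_degree(4)[of ky] not_le by blast+
  then have inA: "(Xvar, m Yvar) \<in> dp_vars A" "(Yvar, m Xvar) \<in> dp_vars A" using kx ky by auto
  have "dp_degree_in v A \<le> dp_degree_in v resultant" for v
    by (rule dp_degree_in_dvd[OF dvd resultant_neq_0])
  then show deg: "dp_degree_in (Xvar, m Yvar) A = 1" "dp_degree_in (Yvar, m Xvar) A = 1"
    using inA resultant_degree(1,2) by (fastforce intro: antisym order_trans simp flip: dp_degree_in_pos_iff)+
  show "dp_ord B < dp_ord resultant" if B: "resultant = A * B"
  proof -
    have nz: "A \<noteq> 0" "B \<noteq> 0" using resultant_neq_0 B by auto
    have subB: "dp_vars B \<subseteq> dp_vars resultant" using B resultant_neq_0 by (intro dp_vars_dvd) auto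
    have "dp_degree_in v resultant = dp_degree_in v A + dp_degree_in v B" for v
      unfolding B using nz by (rule dp_degree_in_mult)
    then have "(Xvar, m Yvar) \<notin> dp_vars B" "(Yvar, m Xvar) \<notin> dp_vars B"
      using deg resultant_degree(1,2) by (simp_all flip: dp_degree_in_eq_0_iff)
    then have "dp_ord_in Xvar B < Fin (m Yvar)" "dp_ord_in Yvar B < Fin (m Xvar)"
      using subB resultant_degree(3,4) by (auto intro!: dp_ord_in_less_FinI) (metis linorder_neqE_nat subsetD)+
    moreover have "dp_ord_in Xvar resultant = Fin (m Yvar)" "dp_ord_in Yvar resultant = Fin (m Xvar)"
      unfolding dp_ord_in_eq_Fin_iff using inA sub resultant_degree(3,4) by (auto simp: not_le[symmetric])
    ultimately show ?thesis unfolding dp_ord_def by (simp only: max_less_iff_conj) (simp only: less_max_iff_disj simp_thms)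
  qed
qed

end

theorem corollary4p6:
  fixes \<delta> :: "'f::field_char_0 \<Rightarrow> 'f"
    and D :: "'e::field_char_0 \<Rightarrow> 'e"
    and \<iota> :: "'f \<Rightarrow> 'e"
    and u :: 'e
    and r :: "(xy \<times> nat) rel"
    and A R :: "(xy, 'f) dpoly"
    and P\<^sub>1 Q\<^sub>1 P\<^sub>2 Q\<^sub>2 :: "(unit, 'f) dpoly"
    and m\<^sub>1 m\<^sub>2 :: nat
  assumes "derivation \<delta>" and "derivation D"
    and "diff_hom class_ring \<delta> class_ring D \<iota>"
    and "universal_extension D \<iota>"
    and "diff_transcendental \<iota> D u"
    and "ranking r"
    and "comm_semiring_1_class.irreducible A" and "A \<notin> range dp_const"
    and "rational_parametrization \<delta> \<iota> D r A u P\<^sub>1 Q\<^sub>1 P\<^sub>2 Q\<^sub>2"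
    and "linear_parametrization P\<^sub>1 Q\<^sub>1 P\<^sub>2 Q\<^sub>2"
    and "fraction_ord P\<^sub>1 Q\<^sub>1 = Fin m\<^sub>1" and "fraction_ord P\<^sub>2 Q\<^sub>2 = Fin m\<^sub>2"
    and "proper_parametrization \<iota> D u P\<^sub>1 Q\<^sub>1 P\<^sub>2 Q\<^sub>2"
  defines "R \<equiv> diff_resultant (dp_deriv \<delta>) (implicit_poly Xvar P\<^sub>1 Q\<^sub>1) (implicit_poly Yvar P\<^sub>2 Q\<^sub>2)"
  shows "comm_semiring_1_class.irreducible A \<and> A dvd R \<and>
         (\<forall>B. R = A * B \<longrightarrow> dp_ord B < dp_ord R) \<and>
         dp_degree_in (Xvar, m\<^sub>2) A = 1 \<and>
         dp_degree_in (Yvar, m\<^sub>1) A = 1"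
proof -
  have \<delta>: "derivation_ring \<delta>" and D: "derivation_ring D" using assms by (simp_all only: derivation_iff)
  note \<iota> = diff_hom_class_ring[OF assms(3)]
  let ?P = "case_xy P\<^sub>1 P\<^sub>2" and ?Q = "case_xy Q\<^sub>1 Q\<^sub>2" and ?m = "case_xy m\<^sub>1 m\<^sub>2"
  have te: "transcendental_extension \<delta> D \<iota> u"
    by (intro transcendental_extension.intro transcendental_extension_axioms.intro \<delta> D \<iota>(1) assms(5))
      (simp add: \<iota>(2))
  note par = assms(9)[unfolded rational_parametrization_def]
  note lin = assms(10)[unfolded linear_parametrization_def]
  have "u \<in> adjoin D \<iota> {u}"
    unfolding adjoin_def by (intro hull_inc) simp
  then have u: "u \<in> adjoin D \<iota> {fraction_at \<iota> D u P\<^sub>1 Q\<^sub>1, fraction_at \<iota> D u P\<^sub>2 Q\<^sub>2}"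
    using assms(13) by (simp add: proper_parametrization_def)
  interpret linear_curve \<delta> D \<iota> u ?P ?Q ?m
  proof (intro linear_curve.intro te linear_curve_axioms.intro)
    fix w
    show "?Q w \<noteq> 0" "dp_coprime (?P w) (?Q w)" "dp_degree (?P w) \<le> 1" "dp_degree (?Q w) \<le> 1"
      "fraction_ord (?P w) (?Q w) = Fin (?m w)"
      using par lin assms(11,12) by (cases w; simp)+
  qed (simp add: u)
  have "point = case_xy (fraction_at \<iota> D u P\<^sub>1 Q\<^sub>1) (fraction_at \<iota> D u P\<^sub>2 Q\<^sub>2)"
    by (rule ext) (simp add: point_def split: xy.split)
  then have sat: "vanishing_ideal \<iota> D point = sat \<delta> r A" using par by simp
  have "R = resultant" by (simp add: R_def resultant_def)
  then show ?thesis
    using main_factor[OF assms(6,7,8) sat] assms(7) by (auto simp only: xy.case)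
qed

end
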